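(* Let $\Omega$ be a simply connected domain in $\mathbb{R}^2$. Then the following three conditions are equivalent: (i) $$\sup_{u\in H_0^1(\Omega),\ \int_\Omega|\nabla u|^2\,dx\le 1}\ \int_\Omega\left(e^{4\pi u^2}-1\right)dx<+\infty;$$ (ii) $\lambda_1(\Omega)>0$; (iii) $\omega(\Omega)<+\infty$.
   Context: $\lambda_1(\Omega):=\inf\left\{\int_\Omega|\nabla u|^2\,dx:\ u\in C_0^\infty(\Omega),\ \int_\Omega|u|^2\,dx=1\right\}$, and $\omega(\Omega):=\sup\{r>0:\ \text{there exists } x \text{ with } D_r(x)\subset\Omega\}$, where $D_r(x)$ is the open disc of radius $r$ centered at $x$. The domain $\Omega$ is not assumed bounded or of finite measure. $H_0^1(\Omega)$ is the usual Sobolev space (closure of $C_0^\infty(\Omega)$ in $H^1(\Omega)$). *)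

theory Defs
  imports "HOL-Analysis.Analysis"
begin

text \<open>Continuous differentiability of order \<open>k\<close> on the whole space, by iterating directional
  derivatives.\<close>

fun C_k :: "nat \<Rightarrow> ('a::euclidean_space \<Rightarrow> real) \<Rightarrow> bool" where
  "C_k 0 f \<longleftrightarrow> continuous_on UNIV f"
| "C_k (Suc k) f \<longleftrightarrow>
     (\<forall>x. f differentiable (at x)) \<and> (\<forall>v. C_k k (\<lambda>x. frechet_derivative f (at x) v))"

text \<open>An element of \<open>C\<^sub>0\<^sup>\<infinity>(\<Omega>)\<close> is represented by its extension by zero to the whole space.\<close>

definition test_functions :: "'a::euclidean_space set \<Rightarrow> ('a \<Rightarrow> real) set" where
  "test_functions \<Omega> =
     {\<phi>. (\<forall>k. C_k k \<phi>) \<and> compact (closure {x. \<phi> x \<noteq> 0}) \<and> closure {x. \<phi> x \<noteq> 0} \<subseteq> \<Omega>}"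

definition grad :: "('a::euclidean_space \<Rightarrow> real) \<Rightarrow> 'a \<Rightarrow> 'a" where
  "grad \<phi> x = (\<Sum>b\<in>Basis. frechet_derivative \<phi> (at x) b *\<^sub>R b)"

definition L2 :: "'a::euclidean_space set \<Rightarrow> ('a \<Rightarrow> 'b::euclidean_space) set" where
  "L2 \<Omega> = {f. f \<in> borel_measurable (lebesgue_on \<Omega>) \<and>
               integrable (lebesgue_on \<Omega>) (\<lambda>x. (norm (f x))\<^sup>2)}"

definition locally_integrable_on ::
    "('a::euclidean_space \<Rightarrow> 'b::euclidean_space) \<Rightarrow> 'a set \<Rightarrow> bool" where
  "locally_integrable_on f \<Omega> \<longleftrightarrow> (\<forall>K. compact K \<and> K \<subseteq> \<Omega> \<longrightarrow> f absolutely_integrable_on K)"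

definition has_weak_gradient ::
    "'a::euclidean_space set \<Rightarrow> ('a \<Rightarrow> real) \<Rightarrow> ('a \<Rightarrow> 'a) \<Rightarrow> bool" where
  "has_weak_gradient \<Omega> u g \<longleftrightarrow>
     locally_integrable_on u \<Omega> \<and> locally_integrable_on g \<Omega> \<and>
     (\<forall>\<phi>\<in>test_functions \<Omega>.
        integral\<^sup>L (lebesgue_on \<Omega>) (\<lambda>x. u x *\<^sub>R grad \<phi> x) =
        - integral\<^sup>L (lebesgue_on \<Omega>) (\<lambda>x. \<phi> x *\<^sub>R g x))"

text \<open>Weak gradients are unique up to null sets, so every integral below is independent of the
  representative that is chosen here.\<close>

definition weak_grad :: "'a::euclidean_space set \<Rightarrow> ('a \<Rightarrow> real) \<Rightarrow> 'a \<Rightarrow> 'a" where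
  "weak_grad \<Omega> u = (SOME g. has_weak_gradient \<Omega> u g)"

text \<open>Sobolev functions are represented by functions on the whole space; their values outside
  \<open>\<Omega>\<close> are irrelevant, and functions that agree almost everywhere on \<open>\<Omega>\<close> are not identified.\<close>

definition H1 :: "'a::euclidean_space set \<Rightarrow> ('a \<Rightarrow> real) set" where
  "H1 \<Omega> = {u \<in> L2 \<Omega>. (\<exists>g. has_weak_gradient \<Omega> u g) \<and> weak_grad \<Omega> u \<in> L2 \<Omega>}"

definition dirichlet :: "'a::euclidean_space set \<Rightarrow> ('a \<Rightarrow> real) \<Rightarrow> real" where
  "dirichlet \<Omega> u = integral\<^sup>L (lebesgue_on \<Omega>) (\<lambda>x. (norm (weak_grad \<Omega> u x))\<^sup>2)"

definition H1_norm :: "'a::euclidean_space set \<Rightarrow> ('a \<Rightarrow> real) \<Rightarrow> real" where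
  "H1_norm \<Omega> u = sqrt (integral\<^sup>L (lebesgue_on \<Omega>) (\<lambda>x. \<bar>u x\<bar>\<^sup>2) + dirichlet \<Omega> u)"

definition H1_0 :: "'a::euclidean_space set \<Rightarrow> ('a \<Rightarrow> real) set" where
  "H1_0 \<Omega> =
     {u \<in> H1 \<Omega>. \<forall>\<epsilon>>0. \<exists>\<phi>\<in>test_functions \<Omega>. H1_norm \<Omega> (\<lambda>x. u x - \<phi> x) < \<epsilon>}"

definition lambda1 :: "'a::euclidean_space set \<Rightarrow> real" where
  "lambda1 \<Omega> =
     Inf {integral\<^sup>L (lebesgue_on \<Omega>) (\<lambda>x. (norm (grad u x))\<^sup>2) | u.
            u \<in> test_functions \<Omega> \<and> integral\<^sup>L (lebesgue_on \<Omega>) (\<lambda>x. \<bar>u x\<bar>\<^sup>2) = 1}"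

definition inradius :: "'a::euclidean_space set \<Rightarrow> ereal" where
  "inradius \<Omega> = Sup {ereal r | r. r > 0 \<and> (\<exists>x. ball x r \<subseteq> \<Omega>)}"

end

theory Submission
  imports Defs "HOL-Complex_Analysis.Cauchy_Integral_Formula"
begin

text \<open>
The three conditions are linked in a cycle.

If the Moser-Trudinger supremum \<open>S\<close> is finite, inserting \<open>t u\<close> for a test function \<open>u\<close> with unit
\<open>L\<^sup>2\<close> norm and using \<open>e\<^sup>s - 1 \<ge> s\<close> bounds the Dirichlet energy of \<open>u\<close> from below by a
multiple of \<open>1 / (S + 1)\<close>. If \<open>lambda1\<close> is positive, discs of large radius \<open>r\<close> are excluded because
a rescaled bump has Rayleigh quotient of order \<open>r\<^sup>-\<^sup>2\<close>. Simple connectedness enters in the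
step from a finite inradius to the sharp inequality, which is the heart of the matter. It combines two
independent facts.

The first is a Poincare inequality that survives truncation (\<open>truncated_poincare\<close>): the integral of
\<open>min(|u|, A)\<^sup>2\<close> is at most \<open>C\<close> times the energy of \<open>u\<close> on \<open>{|u| \<le> A}\<close>, uniformly in
\<open>A\<close>. Every circle about a point outside a simply connected open set leaves that set
(\<open>circle_meets_complement\<close>), since otherwise its winding number about the centre would vanish; so a
test function vanishes somewhere on the circle, and a one-dimensional estimate along the circle bounds
it everywhere. A finite inradius provides such centres near every point of the plane, and discs of one
fixed radius about them cover the plane with bounded overlap.

The second is the sharp inequality on sets of finite measure. Above a level \<open>A\<close>, integration along
rays bounds \<open>2 pi (|u(x)| - A)\<close> by the Riesz potential of order one of \<open>|grad u|\<close> restricted to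
\<open>{|u| > A}\<close> (\<open>ray_representation\<close>), and \<open>riesz_exponential_integrability\<close> shows that the
critical exponential of such a potential is integrable. This is Adams' argument, arranged so that no
rearrangement of functions is needed. Let \<open>F\<close> be a superlevel set of the potential \<open>I f\<close>, of
measure \<open>t\<close>. Self-adjointness of \<open>I\<close> bounds the level times \<open>t\<close> by the integral of
\<open>f \<cdot> I 1\<^sub>F\<close>, and the \<open>L\<^sup>2\<close> norm of \<open>I 1\<^sub>F\<close> is known with the sharp logarithmic constant
(\<open>riesz_square_integral\<close>). One level alone gives a distribution estimate that just misses
integrability. Two levels together give more: if a level is nearly optimal then \<open>f\<close> has little
mass on the small sets that a much higher level would have to use, so the nearly optimal levels lie
within a bounded distance of each other, apart from a bounded initial range
(\<open>two_level_arithmetic\<close>), and the layer-cake sum converges (\<open>sum_exp_levels\<close>).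

The two facts are combined in \<open>moser_trudinger_test_functions\<close>. Choose \<open>A\<close> so that
\<open>{|u| > A}\<close> has measure at most one and \<open>{|u| > a}\<close> has measure larger than one for
all \<open>0 \<le> a < A\<close>. The
truncated inequality then says that at least \<open>A\<^sup>2 / C\<close> of the unit energy is spent below the level
\<open>A\<close>. This leaves room to enlarge \<open>|u| - A\<close> by the factor \<open>(1 + A\<^sup>2 / C)\<^sup>1\<^sup>/\<^sup>2\<close> without
exceeding unit energy above the level, and this factor is exactly what absorbs the cross term in
\<open>u\<^sup>2 = ((|u| - A) + A)\<^sup>2\<close>. The passage from test functions to \<open>H1_0\<close> is Fatou's lemma.

The remaining sections supply the prerequisites: integration in polar coordinates, smooth bumps for
the iterated notion of differentiability, and the uniqueness of weak gradients, by which the Dirichlet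
energy of a test function is the integral of its squared classical gradient.
\<close>

section \<open>Polar coordinates in the plane\<close>

abbreviation pt :: "real \<Rightarrow> real \<Rightarrow> real^2" where
  "pt a b \<equiv> vector [a, b]"

lemma Basis_real2: "(Basis :: (real^2) set) = {axis 1 1, axis 2 1}"
  unfolding Basis_vec_def by (auto simp: UNIV_2)

lemma axis12_neq: "(axis 1 1 :: real^2) \<noteq> axis 2 1"
  by (simp add: axis_eq_axis)

lemma norm_real2: "norm (x::real^2) = sqrt ((x$1)\<^sup>2 + (x$2)\<^sup>2)"
  by (simp add: norm_vec_def L2_set_def UNIV_2)

lemma pt_eq_axis: "pt a b = a *\<^sub>R axis 1 1 + b *\<^sub>R axis 2 1"
  by (simp add: vec_eq_iff forall_2 vector_2 axis_def)

lemma measurable_pt [measurable]: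
  assumes [measurable]: "f \<in> borel_measurable M" "g \<in> borel_measurable M"
  shows "(\<lambda>x. pt (f x) (g x)) \<in> borel_measurable M"
  unfolding pt_eq_axis by measurable

text \<open>The vector type is not a product type, so Fubini for the plane is obtained by transporting the
  product measure; boxes determine Lebesgue measure.\<close>

lemma lborel_real2: "lborel = distr (lborel \<Otimes>\<^sub>M lborel) borel (\<lambda>(a, b). pt a b)"
proof (rule lborel_eqI)
  fix l u :: "real^2"
  assume le: "\<And>b. b \<in> Basis \<Longrightarrow> l \<bullet> b \<le> u \<bullet> b"
  have le': "l$1 \<le> u$1" "l$2 \<le> u$2"
    using le[of "axis 1 1"] le[of "axis 2 1"] by (auto simp: Basis_real2 inner_axis)
  have eq: "(\<lambda>(a, b). pt a b) -` box l u = {l$1<..<u$1} \<times> {l$2<..<u$2}"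
    by (auto simp: mem_box Basis_real2 inner_axis vector_2)
  have "emeasure (distr (lborel \<Otimes>\<^sub>M lborel) borel (\<lambda>(a, b). pt a b)) (box l u)
      = emeasure (lborel \<Otimes>\<^sub>M lborel) ({l$1<..<u$1} \<times> {l$2<..<u$2})"
    by (subst emeasure_distr) (auto simp: eq space_pair_measure)
  also have "\<dots> = ennreal (u$1 - l$1) * ennreal (u$2 - l$2)"
    by (subst lborel.emeasure_pair_measure_Times) (auto simp: le')
  also have "\<dots> = (\<Prod>b\<in>Basis. (u - l) \<bullet> b)"
    by (simp add: Basis_real2 axis12_neq inner_axis ennreal_mult le')
  finally show "emeasure (distr (lborel \<Otimes>\<^sub>M lborel) borel (\<lambda>(a, b). pt a b)) (box l u)
     = (\<Prod>b\<in>Basis. (u - l) \<bullet> b)" .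
qed simp

lemma nn_integral_real2:
  assumes [measurable]: "F \<in> borel_measurable borel"
  shows "(\<integral>\<^sup>+ x. F x \<partial>lborel) = (\<integral>\<^sup>+ a. \<integral>\<^sup>+ b. F (pt a b) \<partial>lborel \<partial>lborel)"
proof -
  have "(\<integral>\<^sup>+ x. F x \<partial>lborel) = (\<integral>\<^sup>+ p. F ((\<lambda>(a, b). pt a b) p) \<partial>(lborel \<Otimes>\<^sub>M lborel))"
    by (subst lborel_real2) (auto intro!: nn_integral_distr)
  also have "\<dots> = (\<integral>\<^sup>+ a. \<integral>\<^sup>+ b. F (pt a b) \<partial>lborel \<partial>lborel)"
    by (subst lborel.nn_integral_fst[symmetric]) auto
  finally show ?thesis .
qed

definition dir :: "real \<Rightarrow> real^2" where
  "dir \<theta> = pt (cos \<theta>) (sin \<theta>)"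

lemma measurable_dir [measurable]: "dir \<in> borel_measurable borel"
  unfolding dir_def by measurable

lemma norm_dir [simp]: "norm (dir \<theta>) = 1"
  by (simp add: norm_real2 dir_def vector_2)

text \<open>Polar coordinates for indicators of boxes. The change of variables theorem applies on the strip
  \<open>0 < r\<close>, \<open>0 < \<theta> < 2 pi\<close>, where the Jacobian is \<open>r\<close>; the image
  misses only a half-line.\<close>

lemma polar_box_integral:
  fixes l u :: "real^2"
  assumes le: "\<And>b. b \<in> Basis \<Longrightarrow> l \<bullet> b \<le> u \<bullet> b"
  shows "(\<integral>\<^sup>+ p. ennreal (p$1) * indicator (box l u) ((p$1) *\<^sub>R dir (p$2))
            * indicator {p::real^2. 0 < p$1 \<and> 0 < p$2 \<and> p$2 < 2*pi} p \<partial>lborel)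
       = (\<Prod>b\<in>Basis. (u - l) \<bullet> b)"
proof -
  define S where "S = {p::real^2. 0 < p$1 \<and> 0 < p$2 \<and> p$2 < 2*pi}"
  define g where "g = (\<lambda>p::real^2. (p$1) *\<^sub>R dir (p$2))"
  define g' where "g' = (\<lambda>(p::real^2) (h::real^2). (h$1) *\<^sub>R dir (p$2) + (p$1 * h$2) *\<^sub>R pt (- sin (p$2)) (cos (p$2)))"
  define f where "f = (\<lambda>x. indicator (box l u) x *\<^sub>R (1 :: real^1))"
  have "open S"
    unfolding S_def by (intro open_Collect_conj open_Collect_less continuous_intros)
  then have Sb [measurable]: "S \<in> sets borel" and S: "S \<in> sets lebesgue"
    by auto
  have der: "(g has_derivative g' p) (at p within S)" for p
    unfolding g_def g'_def dir_def pt_eq_axis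
    by (auto intro!: derivative_eq_intros bounded_linear_imp_has_derivative[OF bounded_linear_vec_nth] simp: algebra_simps scaleR_add_left)
  have det: "\<bar>det (matrix (g' p))\<bar> = \<bar>p$1\<bar>" for p
  proof -
    have "det (matrix (g' p)) = p$1 * (cos (p$2) * cos (p$2)) + p$1 * (sin (p$2) * sin (p$2))"
      by (simp add: det_2 matrix_def g'_def dir_def vector_2 axis_def algebra_simps)
    also have "\<dots> = p$1 * ((cos (p$2))\<^sup>2 + (sin (p$2))\<^sup>2)"
      by (simp only: power2_eq_square distrib_left)
    finally have "det (matrix (g' p)) = p$1"
      by simp
    then show ?thesis by simp
  qed
  have inj: "inj_on g S"
  proof
    fix p q assume p: "p \<in> S" and q: "q \<in> S" and e: "g p = g q"
    have "norm (g p) = norm (g q)" using e by simp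
    then have 1: "p$1 = q$1" using p q by (simp add: g_def S_def)
    then have "dir (p$2) = dir (q$2)" using e p by (simp add: g_def S_def)
    then have "cos (p$2) = cos (q$2)" "sin (p$2) = sin (q$2)"
      by (auto simp: dir_def vec_eq_iff forall_2 vector_2)
    then have "cis (p$2) = cis (q$2)" by (simp add: complex_eq_iff)
    then obtain n :: int where n: "p$2 = q$2 + of_int n * (2 * pi)"
      using sin_cos_eq_iff[of "p$2" "q$2"] \<open>cos (p$2) = cos (q$2)\<close> \<open>sin (p$2) = sin (q$2)\<close>
      by (auto simp: algebra_simps)
    have "\<bar>of_int n * (2*pi)\<bar> < 2 * pi" using n p q by (auto simp: S_def)
    then have "\<bar>n\<bar> < 1" by (simp add: abs_mult)
    then have "p$2 = q$2" using n by simp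
    with 1 show "p = q" by (simp add: vec_eq_iff forall_2)
  qed
  have img: "- g ` S \<subseteq> {x. x$2 = 0}"
  proof
    fix x assume x: "x \<in> - g ` S"
    show "x \<in> {x. x$2 = 0}"
    proof (rule ccontr)
      assume "x \<notin> {x. x$2 = 0}"
      then have x2: "x$2 \<noteq> 0" by simp
      let ?r = "norm x"
      have r: "?r > 0" using x2 by (auto simp: )
      have "(x$1/?r)\<^sup>2 + (x$2/?r)\<^sup>2 = 1"
        using x2 by (simp add: norm_real2 power_divide add_divide_distrib[symmetric] sum_power2_eq_zero_iff)
      then obtain t where t: "0 \<le> t" "t < 2*pi" "x$1/?r = cos t" "x$2/?r = sin t"
        using sincos_total_2pi by blast
      have "t \<noteq> 0" using t x2 r by auto
      then have "pt ?r t \<in> S" using t r by (auto simp: S_def vector_2)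
      moreover have "?r * cos t = x$1" "?r * sin t = x$2"
        unfolding t(3,4)[symmetric] using r by simp_all
      then have "g (pt ?r t) = x"
        by (simp add: g_def dir_def vec_eq_iff forall_2 vector_2)
      ultimately show False using x by (metis ComplD imageI)
    qed
  qed
  have "negligible {x::real^2. x$2 = 0}"
    using negligible_standard_hyperplane[of "axis 2 1 :: real^2" 0] by (simp add: inner_axis Basis_real2)
  then have neg: "negligible (- g ` S)"
    using img negligible_subset by blast
  let ?c = "(\<Prod>b\<in>Basis. (u - l) \<bullet> b)"
  have hib: "(f has_integral ?c *\<^sub>R 1) (g ` S)"
  proof -
    have "((\<lambda>x. 1::real) has_integral measure lborel (box l u)) (box l u)"
      by (rule has_integral_measure_lborel) (auto simp: emeasure_lborel_box_eq)
    also have "measure lborel (box l u) = ?c"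
      using le by (simp add: measure_lborel_box_eq)
    finally have "((\<lambda>x. if x \<in> box l u then 1 else 0::real) has_integral ?c) UNIV"
      by (simp only: has_integral_restrict_UNIV)
    then have "((\<lambda>x. if x \<in> box l u then 1 else 0::real) has_integral ?c) (g ` S)"
      by (subst has_integral_spike_set_eq[of _ UNIV]) (rule negligible_subset[OF neg] | force)+
    from has_integral_scaleR_left[OF this, of "1::real^1"] show ?thesis
      unfolding f_def indicator_def by (simp add: of_bool_def if_distrib cong: if_cong)
  qed
  have "f absolutely_integrable_on (g ` S)"
    using hib unfolding f_def
    by (intro nonnegative_absolutely_integrable) (auto simp: Basis_vec_def inner_axis)
  then have gS: "f absolutely_integrable_on (g ` S) \<and> integral (g ` S) f = ?c *\<^sub>R 1"
    using integral_unique[OF hib] by (rule conjI)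
  have D: "(\<lambda>x. \<bar>det (matrix (g' x))\<bar> *\<^sub>R f(g x)) absolutely_integrable_on S \<and>
     integral S (\<lambda>x. \<bar>det (matrix (g' x))\<bar> *\<^sub>R f(g x)) = ?c *\<^sub>R 1"
    by (rule iffD2[OF has_absolute_integral_change_of_variables[OF S der inj] gS])
  have D': "((\<lambda>x. \<bar>det (matrix (g' x))\<bar> *\<^sub>R f(g x)) has_integral ?c *\<^sub>R 1) S"
    using integrable_integral[OF set_lebesgue_integral_eq_integral(1)[OF conjunct1[OF D]]] 
    by (simp only: conjunct2[OF D])
  have "((\<lambda>x. (\<bar>det (matrix (g' x))\<bar> *\<^sub>R f(g x)) \<bullet> axis 1 1) has_integral (?c *\<^sub>R 1 :: real^1) \<bullet> axis 1 1) S"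
    using has_integral_linear[OF D' bounded_linear_inner_left[of "axis 1 1"]] by (simp only: o_def)
  then have "((\<lambda>x. \<bar>x$1\<bar> * indicator (box l u) (g x)) has_integral ?c) S"
    by (simp only: det inner_axis f_def vector_scaleR_component one_index inner_real_def real_scaleR_def mult_1_right)
  then have "((\<lambda>x. if x \<in> S then \<bar>x$1\<bar> * indicator (box l u) (g x) else 0) has_integral ?c) UNIV"
    by (simp only: has_integral_restrict_UNIV)
  moreover have [measurable]: "(\<lambda>x::real^2. x$1) \<in> borel_measurable borel" "(\<lambda>x::real^2. x$2) \<in> borel_measurable borel"
    by (auto intro!: borel_measurable_continuous_onI continuous_intros)
  moreover have "(\<lambda>x. if x \<in> S then \<bar>x$1\<bar> * indicator (box l u) (g x) else 0) \<in> borel_measurable borel"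
    unfolding g_def by measurable
  ultimately have "(\<integral>\<^sup>+ x. ennreal (if x \<in> S then \<bar>x$1\<bar> * indicator (box l u) (g x) else 0) \<partial>lborel) = ?c"
    by (intro nn_integral_has_integral_lborel) auto
  also have "(\<integral>\<^sup>+ x. ennreal (if x \<in> S then \<bar>x$1\<bar> * indicator (box l u) (g x) else 0) \<partial>lborel) =
     (\<integral>\<^sup>+ p. ennreal (p$1) * indicator (box l u) ((p$1) *\<^sub>R dir (p$2))
            * indicator {p::real^2. 0 < p$1 \<and> 0 < p$2 \<and> p$2 < 2*pi} p \<partial>lborel)"
    by (intro nn_integral_cong) (auto simp: S_def g_def split: split_indicator)
  finally show ?thesis .
qed

text \<open>Both sides, as functions of \<open>F\<close>, are integrals against measures that agree on
  boxes.\<close>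

lemma nn_integral_polar:
  assumes [measurable]: "F \<in> borel_measurable borel"
  shows "(\<integral>\<^sup>+ x. F x \<partial>lborel) =
     (\<integral>\<^sup>+ r\<in>{0<..}. ennreal r * (\<integral>\<^sup>+ \<theta>\<in>{0<..<2*pi}. F (z + r *\<^sub>R dir \<theta>) \<partial>lborel) \<partial>lborel)"
proof -
  define M where "M = distr (density (lborel \<Otimes>\<^sub>M lborel)
     (\<lambda>(r, t). ennreal r * indicator {0<..} r * indicator {0<..<2*pi} t)) borel (\<lambda>(r, t). r *\<^sub>R dir t)"
  have [measurable]: "(\<lambda>x::real^2. x$1) \<in> borel_measurable borel" "(\<lambda>x::real^2. x$2) \<in> borel_measurable borel"
    by (auto intro!: borel_measurable_continuous_onI continuous_intros)
  have M: "(\<integral>\<^sup>+ x. G x \<partial>M) = (\<integral>\<^sup>+ r\<in>{0<..}. ennreal r * (\<integral>\<^sup>+ t\<in>{0<..<2*pi}. G (r *\<^sub>R dir t) \<partial>lborel) \<partial>lborel)"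
    if [measurable]: "G \<in> borel_measurable borel" for G
  proof -
    have "(\<integral>\<^sup>+ x. G x \<partial>M) = (\<integral>\<^sup>+ p. (case p of (r, t) \<Rightarrow> ennreal r * indicator {0<..} r * indicator {0<..<2*pi} t * G (r *\<^sub>R dir t)) \<partial>(lborel \<Otimes>\<^sub>M lborel))"
      unfolding M_def by (subst nn_integral_distr) (auto simp: nn_integral_density case_prod_unfold)
    also have "\<dots> = (\<integral>\<^sup>+ r. \<integral>\<^sup>+ t. ennreal r * indicator {0<..} r * indicator {0<..<2*pi} t * G (r *\<^sub>R dir t) \<partial>lborel \<partial>lborel)"
      by (subst lborel.nn_integral_fst[symmetric]) auto
    also have "\<dots> = (\<integral>\<^sup>+ r\<in>{0<..}. ennreal r * (\<integral>\<^sup>+ t\<in>{0<..<2*pi}. G (r *\<^sub>R dir t) \<partial>lborel) \<partial>lborel)"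
      by (intro nn_integral_cong) (auto simp: nn_integral_cmult[symmetric] mult_ac split: split_indicator intro!: nn_integral_cong)
    finally show ?thesis .
  qed
  have "lborel = M"
  proof (rule lborel_eqI)
    fix l u :: "real^2"
    assume le: "\<And>b. b \<in> Basis \<Longrightarrow> l \<bullet> b \<le> u \<bullet> b"
    let ?J = "\<lambda>p::real^2. ennreal (p$1) * indicator (box l u) ((p$1) *\<^sub>R dir (p$2))
            * indicator {p::real^2. 0 < p$1 \<and> 0 < p$2 \<and> p$2 < 2*pi} p"
    have J: "?J \<in> borel_measurable borel"
      by measurable
    have "emeasure M (box l u) = (\<integral>\<^sup>+ x. indicator (box l u) x \<partial>M)"
      by (simp add: M_def)
    also have "\<dots> = (\<integral>\<^sup>+ r. \<integral>\<^sup>+ t. ?J (pt r t) \<partial>lborel \<partial>lborel)"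
      by (subst M) (auto simp: nn_integral_cmult[symmetric] mult_ac vector_2 split: split_indicator intro!: nn_integral_cong)
    also have "\<dots> = (\<integral>\<^sup>+ p. ?J p \<partial>lborel)"
      by (rule nn_integral_real2[OF J, symmetric])
    also have "\<dots> = (\<Prod>b\<in>Basis. (u - l) \<bullet> b)"
      by (rule polar_box_integral[OF le])
    finally show "emeasure M (box l u) = (\<Prod>b\<in>Basis. (u - l) \<bullet> b)" .
  qed (simp add: M_def)
  have "(\<integral>\<^sup>+ x. F x \<partial>lborel) = (\<integral>\<^sup>+ x. F x \<partial>distr lborel borel ((+) z))"
    by (simp add: lborel_distr_plus)
  also have "\<dots> = (\<integral>\<^sup>+ x. F (z + x) \<partial>lborel)"
    by (subst nn_integral_distr) auto
  also have "\<dots> = (\<integral>\<^sup>+ x. F (z + x) \<partial>M)"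
    using \<open>lborel = M\<close> by simp
  also have "\<dots> = (\<integral>\<^sup>+ r\<in>{0<..}. ennreal r * (\<integral>\<^sup>+ t\<in>{0<..<2*pi}. F (z + r *\<^sub>R dir t) \<partial>lborel) \<partial>lborel)"
    by (rule M) measurable
  finally show ?thesis .
qed

section \<open>Topology of the complement and one-dimensional crossings\<close>

text \<open>In the complex plane the circle would be a closed path in a simply connected set that does not
  contain the centre, hence of winding number zero about it; but the winding number is one.\<close>

lemma circle_meets_complement:
  fixes \<Omega> :: "(real^2) set"
  assumes sc: "simply_connected \<Omega>" and z: "z \<notin> \<Omega>" and r: "r > 0"
  shows "\<exists>\<theta>\<in>{0..2*pi}. z + r *\<^sub>R dir \<theta> \<notin> \<Omega>"
proof (rule ccontr)
  assume neg: "\<not> ?thesis"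
  define T where "T = (\<lambda>x::real^2. Complex (x$1) (x$2))"
  have T: "linear T"
    unfolding T_def by (rule linearI) (auto simp: complex_eq_iff)
  have inj: "inj T"
    by (rule injI) (auto simp: T_def vec_eq_iff forall_2)
  have sc': "simply_connected (T ` \<Omega>)"
    using sc homeomorphic_simply_connected_eq linear_homeomorphic_image[OF T inj] by blast
  have zT: "T z \<notin> T ` \<Omega>"
    using z inj by (auto simp: inj_image_mem_iff)
  have "path_image (circlepath (T z) r) \<subseteq> T ` \<Omega>"
  proof
    fix w assume "w \<in> path_image (circlepath (T z) r)"
    then obtain t where t: "t \<in> {0..1}" "w = T z + r * exp (2 * of_real pi * \<i> * of_real t)"
      by (auto simp: path_image_def circlepath)
    have "w = T (z + r *\<^sub>R dir (2 * pi * t))"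
      unfolding t(2) by (simp add: T_def dir_def vector_2 complex_eq_iff Re_exp Im_exp)
    moreover have "2 * pi * t \<in> {0..2*pi}"
      using t by (auto simp: mult_le_cancel_left1)
    ultimately show "w \<in> T ` \<Omega>" using neg by blast
  qed
  then have "winding_number (circlepath (T z) r) (T z) = 0"
    using simply_connected_imp_winding_number_zero[OF sc' _ _ _ zT] by auto
  moreover have "winding_number (circlepath (T z) r) (T z) = 1"
    by (rule winding_number_circlepath_centre[OF r])
  ultimately show False by simp
qed

text \<open>Take \<open>b'\<close> to be the first time at which \<open>p\<close> equals \<open>d\<close>, and
  \<open>a'\<close> the last time before it at which \<open>p\<close> equals \<open>c\<close>.\<close>

lemma crossing_interval:
  fixes p :: "real \<Rightarrow> real"
  assumes ab: "a \<le> b" and cont: "continuous_on {a..b} p" and pa: "p a \<le> c" and cd: "c < d" and pb: "d \<le> p b"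
  shows "\<exists>a' b'. a \<le> a' \<and> a' < b' \<and> b' \<le> b \<and> p a' = c \<and> p b' = d \<and> (\<forall>t\<in>{a'<..<b'}. c < p t \<and> p t < d)"
proof -
  define B where "B = {t \<in> {a..b}. p t = d}"
  have "\<exists>t\<ge>a. t \<le> b \<and> p t = d"
    using IVT'[of p a d b] pa cd pb ab cont by auto
  then have Bne: "B \<noteq> {}" by (auto simp: B_def)
  have "closed B"
    unfolding B_def by (rule continuous_closed_preimage_constant[OF cont]) simp
  have "bounded B"
    by (rule bounded_subset[OF bounded_closed_interval[of a b]]) (auto simp: B_def)
  define b' where "b' = Inf B"
  have bdd: "bdd_below B" by (rule bounded_imp_bdd_below[OF \<open>bounded B\<close>])
  have b'B: "b' \<in> B"
    unfolding b'_def by (rule closed_contains_Inf[OF Bne bdd \<open>closed B\<close>])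
  have b'min: "b' \<le> t" if "t \<in> B" for t
    unfolding b'_def by (rule cInf_lower[OF that bdd])
  define A where "A = {t \<in> {a..b'}. p t = c}"
  have cont': "continuous_on {a..b'} p"
    using cont b'B by (auto simp: B_def intro: continuous_on_subset)
  have "\<exists>t\<ge>a. t \<le> b' \<and> p t = c"
    using IVT'[of p a c b'] pa cd b'B cont' by (auto simp: B_def)
  then have Ane: "A \<noteq> {}" by (auto simp: A_def)
  have "closed A"
    unfolding A_def by (rule continuous_closed_preimage_constant[OF cont']) simp
  have "bounded A"
    by (rule bounded_subset[OF bounded_closed_interval[of a b']]) (auto simp: A_def)
  define a' where "a' = Sup A"
  have bdd': "bdd_above A" by (rule bounded_imp_bdd_above[OF \<open>bounded A\<close>])
  have a'A: "a' \<in> A"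
    unfolding a'_def by (rule closed_contains_Sup[OF Ane bdd' \<open>closed A\<close>])
  have a'max: "t \<le> a'" if "t \<in> A" for t
    unfolding a'_def by (rule cSup_upper[OF that bdd'])
  have ab': "a \<le> a'" "a' \<le> b'" "b' \<le> b" "p a' = c" "p b' = d"
    using a'A b'B by (auto simp: A_def B_def)
  have "c < p t \<and> p t < d" if t: "t \<in> {a'<..<b'}" for t
  proof -
    have "p t < d"
    proof (rule ccontr)
      assume "\<not> p t < d"
      then obtain s where "a' \<le> s" "s \<le> t" "p s = d"
        using IVT'[of p a' d t] ab' cd t continuous_on_subset[OF cont, of "{a'..t}"] by auto
      then have "s \<in> B" using ab' t by (auto simp: B_def)
      then show False using b'min[of s] \<open>s \<le> t\<close> t by auto
    qed
    moreover have "c < p t"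
    proof (rule ccontr)
      assume "\<not> c < p t"
      then obtain s where "t \<le> s" "s \<le> b'" "p s = c"
        using IVT'[of p t c b'] ab' cd t continuous_on_subset[OF cont, of "{t..b'}"] by auto
      then have "s \<in> A" using ab' t by (auto simp: A_def)
      then show False using a'max[of s] \<open>t \<le> s\<close> t by auto
    qed
    ultimately show ?thesis by simp
  qed
  moreover have "a' < b'" using ab' cd by (cases "a' = b'") auto
  ultimately show ?thesis using ab' by blast
qed

text \<open>The variation of \<open>p\<close> between two levels is paid for by the part of its derivative
  that lives strictly between these levels. This localisation in the values of \<open>p\<close> is what makes
  both the Poincare inequality and the ray representation compatible with truncation.\<close>

lemma crossing_up:
  fixes p p' :: "real \<Rightarrow> real"
  assumes ab: "a \<le> b" and der: "\<And>t. t \<in> {a..b} \<Longrightarrow> (p has_real_derivative p' t) (at t)"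
    and cont': "continuous_on {a..b} p'"
    and pa: "p a \<le> c" and cd: "c < d" and pb: "d \<le> p b"
  shows "ennreal (d - c) \<le> (\<integral>\<^sup>+ t\<in>{a<..<b}. ennreal \<bar>p' t\<bar> * indicator {c<..<d} (p t) \<partial>lborel)"
proof -
  have cont: "continuous_on {a..b} p"
    using der by (meson DERIV_isCont continuous_at_imp_continuous_on)
  from crossing_interval[OF ab cont pa cd pb] obtain a' b' where
    ab': "a \<le> a'" "a' < b'" "b' \<le> b" "p a' = c" "p b' = d" "\<And>t. t \<in> {a'<..<b'} \<Longrightarrow> c < p t \<and> p t < d"
    by blast
  have "(p' has_integral (p b' - p a')) {a'..b'}"
  proof (rule fundamental_theorem_of_calculus)
    fix t assume "t \<in> {a'..b'}"
    then have "(p has_real_derivative p' t) (at t)" using der ab' by auto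
    then show "(p has_vector_derivative p' t) (at t within {a'..b'})"
      by (simp add: has_real_derivative_iff_has_vector_derivative has_vector_derivative_at_within)
  qed (use ab' in simp)
  then have int': "(p' has_integral (d - c)) {a'..b'}"
    using ab' by simp
  have c2: "continuous_on {a'..b'} p'"
    using cont' ab' by (auto intro: continuous_on_subset)
  then have c3: "continuous_on {a'..b'} (\<lambda>t. \<bar>p' t\<bar>)"
    by (intro continuous_intros)
  have "d - c = integral {a'..b'} p'" using int' by (simp add: integral_unique)
  also have "\<dots> \<le> integral {a'..b'} (\<lambda>t. \<bar>p' t\<bar>)"
    by (intro integral_le integrable_continuous_real c2 c3) auto
  finally have le: "d - c \<le> integral {a'..b'} (\<lambda>t. \<bar>p' t\<bar>)" .
  have "((\<lambda>t. \<bar>p' t\<bar>) has_integral integral {a'..b'} (\<lambda>t. \<bar>p' t\<bar>)) {a'..b'}"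
    using c3 integrable_continuous_real by blast
  then have I: "((\<lambda>t. \<bar>p' t\<bar> * indicator {a'..b'} t) has_integral integral {a'..b'} (\<lambda>t. \<bar>p' t\<bar>)) UNIV"
    by (subst (asm) has_integral_restrict_UNIV[symmetric]) (auto simp: indicator_def of_bool_def if_distrib cong: if_cong)
  have m: "(\<lambda>t. \<bar>p' t\<bar> * indicator {a'..b'} t) \<in> borel_measurable borel"
    using borel_measurable_continuous_on_indicator[OF _ c3] by (simp add: mult.commute)
  have "ennreal (integral {a'..b'} (\<lambda>t. \<bar>p' t\<bar>)) = (\<integral>\<^sup>+ t. ennreal (\<bar>p' t\<bar> * indicator {a'..b'} t) \<partial>lborel)"
    by (rule nn_integral_has_integral_lborel[OF m _ I, symmetric]) auto
  also have "\<dots> \<le> (\<integral>\<^sup>+ t\<in>{a<..<b}. ennreal \<bar>p' t\<bar> * indicator {c<..<d} (p t) \<partial>lborel)"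
  proof (rule nn_integral_mono_AE)
    have "AE t in lborel. t \<noteq> a'" "AE t in lborel. t \<noteq> b'"
      by (auto intro: AE_lborel_singleton)
    then show "AE t in lborel. ennreal (\<bar>p' t\<bar> * indicator {a'..b'} t) \<le> ennreal \<bar>p' t\<bar> * indicator {c<..<d} (p t) * indicator {a<..<b} t"
    proof eventually_elim
      case (elim t)
      then show ?case using ab'(6)[of t] ab'(1-3) by (auto split: split_indicator)
    qed
  qed
  finally show ?thesis using le order_trans ennreal_leI by blast
qed

lemma crossing_down:
  fixes p p' :: "real \<Rightarrow> real"
  assumes ab: "a \<le> b" and der: "\<And>t. t \<in> {a..b} \<Longrightarrow> (p has_real_derivative p' t) (at t)"
    and cont': "continuous_on {a..b} p'"
    and pa: "d \<le> p a" and cd: "c < d" and pb: "p b \<le> c"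
  shows "ennreal (d - c) \<le> (\<integral>\<^sup>+ t\<in>{a<..<b}. ennreal \<bar>p' t\<bar> * indicator {c<..<d} (p t) \<partial>lborel)"
proof -
  have "ennreal (- c - (- d)) \<le> (\<integral>\<^sup>+ t\<in>{a<..<b}. ennreal \<bar>- p' t\<bar> * indicator {-d<..<-c} (- p t) \<partial>lborel)"
    using assms by (intro crossing_up) (auto intro!: derivative_eq_intros continuous_intros)
  also have "\<dots> = (\<integral>\<^sup>+ t\<in>{a<..<b}. ennreal \<bar>p' t\<bar> * indicator {c<..<d} (p t) \<partial>lborel)"
    by (intro nn_integral_cong) (auto split: split_indicator)
  finally show ?thesis by simp
qed

section \<open>The kernel of the Riesz potential of order one\<close>

lemma nn_integral_radial:
  assumes [measurable]: "h \<in> borel_measurable borel"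
  shows "(\<integral>\<^sup>+ y. h (norm (x - y)) \<partial>(lborel :: (real^2) measure)) = (\<integral>\<^sup>+ r\<in>{0<..}. ennreal (2 * pi * r) * h r \<partial>lborel)"
proof -
  have "(\<integral>\<^sup>+ y. h (norm (x - y)) \<partial>(lborel :: (real^2) measure)) =
     (\<integral>\<^sup>+ r\<in>{0<..}. ennreal r * (\<integral>\<^sup>+ \<theta>\<in>{0<..<2*pi}. h (norm (x - (x + r *\<^sub>R dir \<theta>))) \<partial>lborel) \<partial>lborel)"
    by (rule nn_integral_polar) measurable
  also have "\<dots> = (\<integral>\<^sup>+ r\<in>{0<..}. ennreal (2 * pi * r) * h r \<partial>lborel)"
  proof (intro nn_integral_cong)
    fix r :: real
    show "ennreal r * (\<integral>\<^sup>+ \<theta>\<in>{0<..<2*pi}. h (norm (x - (x + r *\<^sub>R dir \<theta>))) \<partial>lborel) * indicator {0<..} r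
        = ennreal (2 * pi * r) * h r * indicator {0<..} r"
    proof (cases "r > 0")
      case True
      then have "(\<integral>\<^sup>+ \<theta>\<in>{0<..<2*pi}. h (norm (x - (x + r *\<^sub>R dir \<theta>))) \<partial>lborel) = h r * ennreal (2 * pi)"
        by (simp add: nn_integral_cmult_indicator)
      with True show ?thesis
        by (simp add: ennreal_mult' mult_ac)
    qed simp
  qed
  finally show ?thesis .
qed

lemma disc_kernel:
  fixes x :: "real^2"
  assumes "\<rho> > 0"
  shows "(\<integral>\<^sup>+ y. ennreal (1 / norm (x - y)) * indicator {..<\<rho>} (norm (x - y)) \<partial>lborel) = ennreal (2 * pi * \<rho>)"
proof -
  have "(\<integral>\<^sup>+ y. ennreal (1 / norm (x - y)) * indicator {..<\<rho>} (norm (x - y)) \<partial>lborel)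
     = (\<integral>\<^sup>+ r\<in>{0<..}. ennreal (2 * pi * r) * (ennreal (1 / r) * indicator {..<\<rho>} r) \<partial>lborel)"
    by (rule nn_integral_radial) measurable
  also have "\<dots> = (\<integral>\<^sup>+ r. ennreal (2 * pi) * indicator {0<..<\<rho>} r \<partial>lborel)"
    by (intro nn_integral_cong) (auto simp: ennreal_mult[symmetric] split: split_indicator)
  also have "\<dots> = ennreal (2 * pi * \<rho>)"
    using assms by (simp add: nn_integral_cmult_indicator ennreal_mult)
  finally show ?thesis .
qed

lemma annulus_kernel:
  fixes x :: "real^2"
  assumes "0 < \<rho>" "\<rho> \<le> R"
  shows "(\<integral>\<^sup>+ y. ennreal ((1 / norm (x - y))\<^sup>2) * indicator {\<rho>..R} (norm (x - y)) \<partial>lborel) = ennreal (2 * pi * ln (R / \<rho>))"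
proof -
  have "(\<integral>\<^sup>+ y. ennreal ((1 / norm (x - y))\<^sup>2) * indicator {\<rho>..R} (norm (x - y)) \<partial>lborel)
     = (\<integral>\<^sup>+ r\<in>{0<..}. ennreal (2 * pi * r) * (ennreal ((1 / r)\<^sup>2) * indicator {\<rho>..R} r) \<partial>lborel)"
    by (rule nn_integral_radial) measurable
  also have "\<dots> = (\<integral>\<^sup>+ r. ennreal (2 * pi * inverse r) * indicator {\<rho>..R} r \<partial>lborel)"
    using assms by (intro nn_integral_cong) (auto simp: ennreal_mult[symmetric] power2_eq_square field_simps split: split_indicator)
  also have "\<dots> = ennreal (2 * pi * ln R - 2 * pi * ln \<rho>)"
    using assms
    by (intro nn_integral_FTC_Icc) (auto intro!: derivative_eq_intros DERIV_ln simp: field_simps)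
  also have "2 * pi * ln R - 2 * pi * ln \<rho> = 2 * pi * ln (R / \<rho>)"
    using assms by (simp add: ln_div right_diff_distrib)
  finally show ?thesis .
qed

text \<open>Compare with the disc of the same area: inside it the kernel is integrated exactly, outside it the
  kernel is at most \<open>1 / \<rho>\<close>. Only the order of magnitude matters here.\<close>

lemma kernel_integral_le:
  fixes x :: "real^2"
  assumes [measurable]: "A \<in> sets borel" and A: "emeasure lborel A \<le> ennreal a" and a: "0 \<le> a"
  shows "(\<integral>\<^sup>+ y\<in>A. ennreal (1 / norm (x - y)) \<partial>lborel) \<le> ennreal (3 * sqrt (pi * a))"
proof (cases "a = 0")
  case True
  then have "A \<in> null_sets lborel" using A by (auto simp: null_sets_def)
  then have "AE y in lborel. y \<notin> A" by (rule AE_not_in)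
  then have "AE y in lborel. ennreal (1 / norm (x - y)) * indicator A y = 0"
    by eventually_elim simp
  then have "(\<integral>\<^sup>+ y\<in>A. ennreal (1 / norm (x - y)) \<partial>lborel) = (\<integral>\<^sup>+ y. 0 \<partial>(lborel :: (real^2) measure))"
    by (rule nn_integral_cong_AE)
  then show ?thesis by simp
next
  case False
  define \<rho> where "\<rho> = sqrt (a / pi)"
  have \<rho>: "\<rho> > 0" using False a by (simp add: \<rho>_def)
  have "(\<integral>\<^sup>+ y\<in>A. ennreal (1 / norm (x - y)) \<partial>lborel) \<le>
     (\<integral>\<^sup>+ y. ennreal (1 / norm (x - y)) * indicator {..<\<rho>} (norm (x - y)) + ennreal (1 / \<rho>) * indicator A y \<partial>lborel)"
  proof (intro nn_integral_mono)
    fix y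
    show "ennreal (1 / norm (x - y)) * indicator A y \<le> ennreal (1 / norm (x - y)) * indicator {..<\<rho>} (norm (x - y)) + ennreal (1 / \<rho>) * indicator A y"
      using \<rho> by (cases "norm (x - y) < \<rho>") (auto simp: divide_left_mono ennreal_leI frac_le split: split_indicator)
  qed
  also have "\<dots> = ennreal (2 * pi * \<rho>) + ennreal (1 / \<rho>) * emeasure lborel A"
    using disc_kernel[OF \<rho>, of x] by (subst nn_integral_add) (auto simp: nn_integral_cmult_indicator)
  also have "\<dots> \<le> ennreal (2 * pi * \<rho>) + ennreal (1 / \<rho>) * ennreal a"
    by (intro add_mono mult_left_mono A) auto
  also have "\<dots> = ennreal (2 * pi * \<rho> + a / \<rho>)"
    using \<rho> a by (simp add: ennreal_mult[symmetric] ennreal_plus[symmetric] del: ennreal_plus)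
  also have "2 * pi * \<rho> + a / \<rho> = 3 * sqrt (pi * a)"
  proof -
    have 1: "pi * \<rho> = sqrt (pi * a)"
      using a by (simp add: \<rho>_def real_sqrt_divide real_sqrt_mult real_div_sqrt field_simps)
    have "\<rho> * \<rho> = a / pi" using a by (simp add: \<rho>_def)
    then have "a / \<rho> = pi * \<rho>" using \<rho> by (simp add: field_simps)
    with 1 show ?thesis by simp
  qed
  finally show ?thesis .
qed

text \<open>Here the coefficient of the logarithm is sharp, since it decides the critical exponent. The disc
  of area \<open>\<sigma>\<close> is removed; up to the radius \<open>R\<close> of a disc of area \<open>a +
  \<sigma>\<close> the integral is computed exactly, and beyond \<open>R\<close> the kernel is at most
  \<open>1 / R\<close>.\<close>

lemma kernel_square_integral_le:
  fixes x :: "real^2"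
  assumes [measurable]: "A \<in> sets borel" and A: "emeasure lborel A \<le> ennreal a" and a: "0 \<le> a" and \<sigma>: "0 < \<sigma>"
  shows "(\<integral>\<^sup>+ y\<in>A. ennreal ((1 / norm (x - y))\<^sup>2) * indicator {sqrt (\<sigma> / pi)..} (norm (x - y)) \<partial>lborel)
    \<le> ennreal (pi * (ln (1 + a / \<sigma>) + 1))"
proof -
  define \<rho> where "\<rho> = sqrt (\<sigma> / pi)"
  define R where "R = sqrt ((a + \<sigma>) / pi)"
  have \<rho>: "\<rho> > 0" "\<rho> \<le> R" "R > 0" using \<sigma> a by (auto simp: \<rho>_def R_def divide_right_mono add_nonneg_pos)
  have "(\<integral>\<^sup>+ y\<in>A. ennreal ((1 / norm (x - y))\<^sup>2) * indicator {\<rho>..} (norm (x - y)) \<partial>lborel) \<le>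
     (\<integral>\<^sup>+ y. ennreal ((1 / norm (x - y))\<^sup>2) * indicator {\<rho>..R} (norm (x - y)) + ennreal ((1 / R)\<^sup>2) * indicator A y \<partial>lborel)"
  proof (intro nn_integral_mono)
    fix y
    show "ennreal ((1 / norm (x - y))\<^sup>2) * indicator {\<rho>..} (norm (x - y)) * indicator A y
       \<le> ennreal ((1 / norm (x - y))\<^sup>2) * indicator {\<rho>..R} (norm (x - y)) + ennreal ((1 / R)\<^sup>2) * indicator A y"
      using \<rho> by (cases "norm (x - y) \<le> R")
        (auto simp: divide_left_mono ennreal_leI frac_le power_mono split: split_indicator)
  qed
  also have "\<dots> = ennreal (2 * pi * ln (R / \<rho>)) + ennreal ((1 / R)\<^sup>2) * emeasure lborel A"
    using annulus_kernel[OF \<rho>(1,2), of x] by (subst nn_integral_add) (auto simp: nn_integral_cmult_indicator)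
  also have "\<dots> \<le> ennreal (2 * pi * ln (R / \<rho>)) + ennreal ((1 / R)\<^sup>2) * ennreal a"
    by (intro add_mono mult_left_mono A) auto
  also have "\<dots> = ennreal (2 * pi * ln (R / \<rho>) + (1/R)\<^sup>2 * a)"
    using \<rho> a by (simp add: ennreal_mult[symmetric] ennreal_plus[symmetric] del: ennreal_plus)
  also have "\<dots> \<le> ennreal (pi * (ln (1 + a / \<sigma>) + 1))"
  proof (rule ennreal_leI)
    have "R / \<rho> = sqrt (1 + a / \<sigma>)"
      using \<sigma> by (simp add: R_def \<rho>_def real_sqrt_divide[symmetric] field_simps)
    then have "2 * pi * ln (R / \<rho>) = pi * ln (1 + a / \<sigma>)"
      using a \<sigma> by (simp add: ln_sqrt add_pos_nonneg)
    moreover have "(1/R)\<^sup>2 * a \<le> pi"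
      using a \<sigma> by (simp add: R_def power_divide field_simps)
    ultimately show "2 * pi * ln (R / \<rho>) + (1/R)\<^sup>2 * a \<le> pi * (ln (1 + a / \<sigma>) + 1)"
      by (simp add: algebra_simps)
  qed
  finally show ?thesis by (simp add: \<rho>_def)
qed

text \<open>The Riesz potential of order one in the plane, up to its usual normalisation.\<close>

definition riesz :: "(real^2 \<Rightarrow> ennreal) \<Rightarrow> real^2 \<Rightarrow> ennreal" where
  "riesz f x = (\<integral>\<^sup>+ y. f y * ennreal (1 / norm (x - y)) \<partial>lborel)"

lemma measurable_riesz [measurable]:
  assumes [measurable]: "f \<in> borel_measurable borel"
  shows "riesz f \<in> borel_measurable borel"
  unfolding riesz_def by measurable

lemma riesz_adjoint:
  assumes [measurable]: "f \<in> borel_measurable borel" "g \<in> borel_measurable borel"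
  shows "(\<integral>\<^sup>+ x. riesz f x * g x \<partial>lborel) = (\<integral>\<^sup>+ y. f y * riesz g y \<partial>lborel)"
proof -
  have "(\<integral>\<^sup>+ x. riesz f x * g x \<partial>lborel) = (\<integral>\<^sup>+ x. \<integral>\<^sup>+ y. f y * ennreal (1 / norm (x - y)) * g x \<partial>lborel \<partial>lborel)"
    unfolding riesz_def by (intro nn_integral_cong nn_integral_multc[symmetric]) measurable
  also have "\<dots> = (\<integral>\<^sup>+ y. \<integral>\<^sup>+ x. f y * ennreal (1 / norm (x - y)) * g x \<partial>lborel \<partial>lborel)"
    by (rule lborel_pair.Fubini') measurable
  also have "\<dots> = (\<integral>\<^sup>+ y. \<integral>\<^sup>+ x. f y * (g x * ennreal (1 / norm (y - x))) \<partial>lborel \<partial>lborel)"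
    by (intro nn_integral_cong) (simp add: norm_minus_commute mult_ac)
  also have "\<dots> = (\<integral>\<^sup>+ y. f y * riesz g y \<partial>lborel)"
    unfolding riesz_def by (intro nn_integral_cong nn_integral_cmult) measurable
  finally show ?thesis .
qed

lemma riesz_indicator_le:
  assumes "F \<in> sets borel" "emeasure lborel F \<le> ennreal t" "0 \<le> t"
  shows "riesz (indicator F) y \<le> ennreal (3 * sqrt (pi * t))"
  using kernel_integral_le[OF assms, of y] by (simp add: riesz_def mult.commute)

text \<open>Testing the lower bound on \<open>H\<close> against the indicator of \<open>H\<close> and moving
  the potential over to \<open>H\<close> yields a quadratic inequality for the measure of
  \<open>H\<close>.\<close>

lemma riesz_weak_type:
  assumes [measurable]: "F \<in> sets borel" "H \<in> sets borel" and F: "emeasure lborel F \<le> ennreal t" and t: "0 < t"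
    and \<sigma>: "0 < \<sigma>" and fin: "emeasure lborel H < \<infinity>"
    and H: "\<And>y. y \<in> H \<Longrightarrow> ennreal (3 * sqrt pi * t / sqrt \<sigma>) \<le> riesz (indicator F) y"
  shows "emeasure lborel H \<le> ennreal \<sigma>"
proof -
  define \<eta> where "\<eta> = measure lborel H"
  have \<eta>: "emeasure lborel H = ennreal \<eta>" "0 \<le> \<eta>"
    using fin by (auto simp: \<eta>_def emeasure_eq_ennreal_measure)
  let ?c = "3 * sqrt pi * t / sqrt \<sigma>"
  have "ennreal (?c * \<eta>) = ennreal ?c * emeasure lborel H"
    using t \<sigma> \<eta> by (subst \<eta>(1), subst ennreal_mult[symmetric]) auto
  also have "\<dots> = (\<integral>\<^sup>+ y. ennreal ?c * indicator H y \<partial>lborel)"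
    by (simp add: nn_integral_cmult_indicator)
  also have "\<dots> \<le> (\<integral>\<^sup>+ y. riesz (indicator F) y * indicator H y \<partial>lborel)"
    using H by (intro nn_integral_mono) (auto split: split_indicator)
  also have "\<dots> = (\<integral>\<^sup>+ y. indicator F y * riesz (indicator H) y \<partial>lborel)"
    by (rule riesz_adjoint) measurable
  also have "\<dots> \<le> (\<integral>\<^sup>+ y. ennreal (3 * sqrt (pi * \<eta>)) * indicator F y \<partial>lborel)"
    using riesz_indicator_le[of H \<eta>] \<eta> by (intro nn_integral_mono) (auto split: split_indicator)
  also have "\<dots> = ennreal (3 * sqrt (pi * \<eta>)) * emeasure lborel F"
    by (simp add: nn_integral_cmult_indicator)
  also have "\<dots> \<le> ennreal (3 * sqrt (pi * \<eta>)) * ennreal t"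
    by (intro mult_left_mono F) simp
  also have "\<dots> = ennreal (3 * sqrt (pi * \<eta>) * t)"
    using \<eta> t by (simp add: ennreal_mult)
  finally have "?c * \<eta> \<le> 3 * sqrt (pi * \<eta>) * t"
    using \<eta> t by (subst (asm) ennreal_le_iff) auto
  then have le: "\<eta> \<le> sqrt \<eta> * sqrt \<sigma>"
    using t \<sigma> by (simp add: real_sqrt_mult field_simps)
  have "\<eta> \<le> \<sigma>"
  proof (cases "\<eta> = 0")
    case False
    then have "sqrt \<eta> * sqrt \<eta> \<le> sqrt \<eta> * sqrt \<sigma>" "sqrt \<eta> > 0"
      using le \<eta> by auto
    then have "sqrt \<eta> \<le> sqrt \<sigma>" using mult_le_cancel_left_pos by blast
    then show ?thesis by simp
  qed (use \<sigma> in simp)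
  then show ?thesis using \<eta> by (simp add: ennreal_leI)
qed

text \<open>Split the kernel at the radius \<open>\<rho>\<close> of a disc of area \<open>\<sigma>\<close>.
  The far part is estimated by the Cauchy-Schwarz inequality and carries the sharp logarithm. The near part
  has a small integral, and because the whole potential is bounded on \<open>P\<close> it contributes,
  together with the mixed term, only a constant multiple of \<open>t\<^sup>2\<close>. That the error is a
  constant added to the logarithm, and not a multiple of its square root, is essential at the critical
  exponent.\<close>

lemma riesz_square_integral:
  assumes [measurable]: "F \<in> sets borel" "P \<in> sets borel" and F: "emeasure lborel F \<le> ennreal t" and t: "0 < t"
    and \<sigma>: "0 < \<sigma>" and Pm: "emeasure lborel P \<le> ennreal m" and m: "0 \<le> m"
    and P: "\<And>y. y \<in> P \<Longrightarrow> riesz (indicator F) y \<le> ennreal (3 * sqrt pi * t / sqrt \<sigma>)"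
  shows "(\<integral>\<^sup>+ y\<in>P. (riesz (indicator F) y)\<^sup>2 \<partial>lborel) \<le> ennreal (pi * t\<^sup>2 * (ln (1 + m / \<sigma>) + 13))"
proof -
  define \<rho> where "\<rho> = sqrt (\<sigma> / pi)"
  have \<rho>: "\<rho> > 0" using \<sigma> by (simp add: \<rho>_def)
  define c where "c = 3 * sqrt pi * t / sqrt \<sigma>"
  have c: "c \<ge> 0" using t \<sigma> by (simp add: c_def)
  define k1 where "k1 = (\<lambda>z::real^2. ennreal (1 / norm z) * indicator {..<\<rho>} (norm z))"
  define k2 where "k2 = (\<lambda>z::real^2. ennreal (1 / norm z) * indicator {\<rho>..} (norm z))"
  have [measurable]: "k1 \<in> borel_measurable borel" "k2 \<in> borel_measurable borel"
    unfolding k1_def k2_def by measurable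
  define g1 where "g1 = (\<lambda>y. \<integral>\<^sup>+ x. indicator F x * k1 (y - x) \<partial>lborel)"
  define g2 where "g2 = (\<lambda>y. \<integral>\<^sup>+ x. indicator F x * k2 (y - x) \<partial>lborel)"
  have [measurable]: "g1 \<in> borel_measurable borel" "g2 \<in> borel_measurable borel"
    unfolding g1_def g2_def by measurable
  have g: "riesz (indicator F) y = g1 y + g2 y" for y
    unfolding riesz_def g1_def g2_def
    by (subst nn_integral_add[symmetric]) (auto intro!: nn_integral_cong simp: k1_def k2_def split: split_indicator)
  have ptw: "(riesz (indicator F) y)\<^sup>2 * indicator P y \<le> (g2 y)\<^sup>2 * indicator P y + 2 * ennreal c * g1 y" for y
  proof (cases "y \<in> P")
    case True
    have "(riesz (indicator F) y)\<^sup>2 = (g2 y)\<^sup>2 + g1 y * (g1 y + 2 * g2 y)"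
      unfolding g by (simp add: power2_eq_square algebra_simps mult_2 mult_2_right)
    also have "g1 y * (g1 y + 2 * g2 y) \<le> g1 y * (2 * riesz (indicator F) y)"
      unfolding g by (intro mult_left_mono) (auto simp: distrib_left mult_2)
    also have "\<dots> \<le> g1 y * (2 * ennreal c)"
      using P[OF True] by (intro mult_left_mono) (auto simp: c_def)
    finally show ?thesis using True by (simp add: mult_ac)
  qed simp
  have I1: "(\<integral>\<^sup>+ y. g1 y \<partial>lborel) \<le> ennreal (2 * pi * \<rho> * t)"
  proof -
    have "(\<integral>\<^sup>+ y. g1 y \<partial>lborel) = (\<integral>\<^sup>+ x. \<integral>\<^sup>+ y. indicator F x * k1 (y - x) \<partial>lborel \<partial>lborel)"
      unfolding g1_def by (rule lborel_pair.Fubini') measurable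
    also have "\<dots> = (\<integral>\<^sup>+ x. indicator F x * (\<integral>\<^sup>+ y. k1 (y - x) \<partial>lborel) \<partial>lborel)"
      by (intro nn_integral_cong nn_integral_cmult) measurable
    also have "\<dots> = (\<integral>\<^sup>+ x. ennreal (2 * pi * \<rho>) * indicator F x \<partial>lborel)"
      using disc_kernel[OF \<rho>] by (intro nn_integral_cong) (simp add: k1_def norm_minus_commute mult.commute)
    also have "\<dots> = ennreal (2 * pi * \<rho>) * emeasure lborel F"
      by (simp add: nn_integral_cmult_indicator)
    also have "\<dots> \<le> ennreal (2 * pi * \<rho>) * ennreal t"
      by (intro mult_left_mono F) simp
    finally show ?thesis using \<rho> t by (simp add: ennreal_mult)
  qed
  have I2: "(\<integral>\<^sup>+ y\<in>P. (g2 y)\<^sup>2 \<partial>lborel) \<le> ennreal (t * (pi * (ln (1 + m / \<sigma>) + 1) * t))"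
  proof -
    have l: "0 \<le> pi * (ln (1 + m / \<sigma>) + 1)" using m \<sigma> by simp
    have "(g2 y)\<^sup>2 \<le> ennreal t * (\<integral>\<^sup>+ x. indicator F x * (k2 (y - x))\<^sup>2 \<partial>lborel)" for y
    proof -
      have "(g2 y)\<^sup>2 = (\<integral>\<^sup>+ x. indicator F x * (indicator F x * k2 (y - x)) \<partial>lborel)\<^sup>2"
        unfolding g2_def by (intro arg_cong[of _ _ "\<lambda>x. x\<^sup>2"] nn_integral_cong) (auto split: split_indicator)
      also have "\<dots> \<le> (\<integral>\<^sup>+ x. (indicator F x)\<^sup>2 \<partial>lborel) * (\<integral>\<^sup>+ x. (indicator F x * k2 (y - x))\<^sup>2 \<partial>lborel)"
        by (rule Cauchy_Schwarz_nn_integral) measurable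
      also have "(\<integral>\<^sup>+ x. (indicator F x)\<^sup>2 \<partial>lborel) = (\<integral>\<^sup>+ x. indicator F x \<partial>lborel)"
        by (intro nn_integral_cong) (auto split: split_indicator)
      also have "\<dots> = emeasure lborel F" by simp
      also have "(\<integral>\<^sup>+ x. (indicator F x * k2 (y - x))\<^sup>2 \<partial>lborel) = (\<integral>\<^sup>+ x. indicator F x * (k2 (y - x))\<^sup>2 \<partial>lborel)"
        by (intro nn_integral_cong) (auto split: split_indicator)
      finally show ?thesis using F by (meson mult_right_mono order_trans zero_le)
    qed
    then have "(\<integral>\<^sup>+ y\<in>P. (g2 y)\<^sup>2 \<partial>lborel) \<le> (\<integral>\<^sup>+ y. ennreal t * (\<integral>\<^sup>+ x. indicator P y * (indicator F x * (k2 (y - x))\<^sup>2) \<partial>lborel) \<partial>lborel)"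
      by (intro nn_integral_mono) (auto simp: nn_integral_cmult split: split_indicator)
    also have "\<dots> = ennreal t * (\<integral>\<^sup>+ y. (\<integral>\<^sup>+ x. indicator P y * (indicator F x * (k2 (y - x))\<^sup>2) \<partial>lborel) \<partial>lborel)"
      by (rule nn_integral_cmult) measurable
    also have "(\<integral>\<^sup>+ y. (\<integral>\<^sup>+ x. indicator P y * (indicator F x * (k2 (y - x))\<^sup>2) \<partial>lborel) \<partial>lborel)
         = (\<integral>\<^sup>+ x. (\<integral>\<^sup>+ y. indicator P y * (indicator F x * (k2 (y - x))\<^sup>2) \<partial>lborel) \<partial>lborel)"
      by (rule lborel_pair.Fubini') measurable
    also have "\<dots> = (\<integral>\<^sup>+ x. indicator F x * (\<integral>\<^sup>+ y\<in>P. (k2 (y - x))\<^sup>2 \<partial>lborel) \<partial>lborel)"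
      by (intro nn_integral_cong) (auto simp: nn_integral_cmult[symmetric] mult_ac intro!: nn_integral_cong)
    also have "\<dots> \<le> (\<integral>\<^sup>+ x. ennreal (pi * (ln (1 + m / \<sigma>) + 1)) * indicator F x \<partial>lborel)"
    proof (intro nn_integral_mono)
      fix x
      have "(\<integral>\<^sup>+ y\<in>P. (k2 (y - x))\<^sup>2 \<partial>lborel) = (\<integral>\<^sup>+ y\<in>P. ennreal ((1 / norm (x - y))\<^sup>2) * indicator {sqrt (\<sigma> / pi)..} (norm (x - y)) \<partial>lborel)"
        by (intro nn_integral_cong)
           (auto simp: k2_def \<rho>_def norm_minus_commute ennreal_power split: split_indicator)
      also have "\<dots> \<le> ennreal (pi * (ln (1 + m / \<sigma>) + 1))"
        by (rule kernel_square_integral_le[OF _ Pm m \<sigma>]) measurable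
      finally show "indicator F x * (\<integral>\<^sup>+ y\<in>P. (k2 (y - x))\<^sup>2 \<partial>lborel) \<le> ennreal (pi * (ln (1 + m / \<sigma>) + 1)) * indicator F x"
        by (auto split: split_indicator)
    qed
    also have "\<dots> = ennreal (pi * (ln (1 + m / \<sigma>) + 1)) * emeasure lborel F"
      by (simp add: nn_integral_cmult_indicator)
    also have "\<dots> \<le> ennreal (pi * (ln (1 + m / \<sigma>) + 1)) * ennreal t"
      by (intro mult_left_mono F) simp
    also have "ennreal t * (ennreal (pi * (ln (1 + m / \<sigma>) + 1)) * ennreal t) = ennreal (t * (pi * (ln (1 + m / \<sigma>) + 1) * t))"
      using t l by (simp add: ennreal_mult)
    finally show ?thesis by (simp add: mult_left_mono)
  qed
  have "(\<integral>\<^sup>+ y\<in>P. (riesz (indicator F) y)\<^sup>2 \<partial>lborel) \<le> (\<integral>\<^sup>+ y. (g2 y)\<^sup>2 * indicator P y + 2 * ennreal c * g1 y \<partial>lborel)"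
    by (intro nn_integral_mono ptw)
  also have "\<dots> = (\<integral>\<^sup>+ y\<in>P. (g2 y)\<^sup>2 \<partial>lborel) + 2 * ennreal c * (\<integral>\<^sup>+ y. g1 y \<partial>lborel)"
    by (subst nn_integral_add) (auto simp: nn_integral_cmult)
  also have "\<dots> \<le> ennreal (t * (pi * (ln (1 + m / \<sigma>) + 1) * t)) + 2 * ennreal c * ennreal (2 * pi * \<rho> * t)"
    by (intro add_mono mult_left_mono I1 I2) auto
  also have "\<dots> = ennreal (t * (pi * (ln (1 + m / \<sigma>) + 1) * t) + 2 * c * (2 * pi * \<rho> * t))"
  proof -
    have "2 * ennreal c * ennreal (2 * pi * \<rho> * t) = ennreal (2 * c * (2 * pi * \<rho> * t))"
    proof -
      have "2 * ennreal c = ennreal (2 * c)" using c by (simp add: ennreal_mult)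
      then show ?thesis using c \<rho> t by (simp only: ennreal_mult'[symmetric] mult_nonneg_nonneg less_imp_le pi_ge_zero zero_le_numeral)
    qed
    then show ?thesis
      using m \<sigma> t c \<rho> by (subst ennreal_plus) auto
  qed
  also have "t * (pi * (ln (1 + m / \<sigma>) + 1) * t) + 2 * c * (2 * pi * \<rho> * t) = pi * t\<^sup>2 * (ln (1 + m / \<sigma>) + 13)"
  proof -
    have "c * \<rho> = 3 * t"
      using \<sigma> by (simp add: c_def \<rho>_def real_sqrt_divide)
    then have "2 * c * (2 * pi * \<rho> * t) = 12 * pi * t\<^sup>2"
      by (simp add: power2_eq_square) 
    then show ?thesis by (simp add: algebra_simps power2_eq_square)
  qed
  finally show ?thesis .
qed

section \<open>Exponential integrability of Riesz potentials at the critical exponent\<close>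

lemma ennreal_le_of_square_le:
  assumes "x\<^sup>2 \<le> ennreal (b\<^sup>2)" "0 \<le> b"
  shows "x \<le> ennreal b"
proof (cases x)
  case (real r)
  then have "r\<^sup>2 \<le> b\<^sup>2" using assms by (simp add: ennreal_power)
  then have "r \<le> b" using assms(2) by (rule power2_le_imp_le)
  then show ?thesis using real by (simp add: ennreal_leI)
next
  case top
  then show ?thesis using assms by (simp add: power2_eq_square ennreal_mult_top top_unique)
qed

text \<open>Integrating \<open>I f \<ge> (pi s)\<^sup>1\<^sup>/\<^sup>2\<close> over \<open>F\<close> and
  moving the potential to the indicator of \<open>F\<close> leaves the integral of \<open>f \<cdot> I
  1\<^sub>F\<close>, to which the Cauchy-Schwarz inequality is applied on the two pieces separately.\<close>

lemma level_bound:
  fixes f :: "real^2 \<Rightarrow> ennreal"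
  assumes [measurable]: "f \<in> borel_measurable borel" "F \<in> sets borel" "P \<in> sets borel" "Q \<in> sets borel"
    and t: "0 < t" "emeasure lborel F = ennreal t"
    and s: "0 \<le> s" "\<And>x. x \<in> F \<Longrightarrow> ennreal (sqrt (pi * s)) \<le> riesz f x"
    and supp: "\<And>y. f y \<noteq> 0 \<Longrightarrow> y \<in> P \<union> Q"
    and fP: "(\<integral>\<^sup>+ y\<in>P. (f y)\<^sup>2 \<partial>lborel) \<le> ennreal (\<alpha>\<^sup>2)" and fQ: "(\<integral>\<^sup>+ y\<in>Q. (f y)\<^sup>2 \<partial>lborel) \<le> ennreal (\<beta>\<^sup>2)"
    and \<alpha>\<beta>: "0 \<le> \<alpha>" "0 \<le> \<beta>" and AB: "0 \<le> A" "0 \<le> B"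
    and gP: "(\<integral>\<^sup>+ y\<in>P. (riesz (indicator F) y)\<^sup>2 \<partial>lborel) \<le> ennreal (pi * t\<^sup>2 * A)"
    and gQ: "(\<integral>\<^sup>+ y\<in>Q. (riesz (indicator F) y)\<^sup>2 \<partial>lborel) \<le> ennreal (pi * t\<^sup>2 * B)"
  shows "sqrt s \<le> \<alpha> * sqrt A + \<beta> * sqrt B"
proof -
  let ?g = "riesz (indicator F)"
  have part: "(\<integral>\<^sup>+ y\<in>X. f y * ?g y \<partial>lborel) \<le> ennreal (a * (t * sqrt (pi * C)))"
    if [measurable]: "X \<in> sets borel" and a: "0 \<le> a" "0 \<le> C" and 1: "(\<integral>\<^sup>+ y\<in>X. (f y)\<^sup>2 \<partial>lborel) \<le> ennreal (a\<^sup>2)"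
      and 2: "(\<integral>\<^sup>+ y\<in>X. (?g y)\<^sup>2 \<partial>lborel) \<le> ennreal (pi * t\<^sup>2 * C)" for X a C
  proof (rule ennreal_le_of_square_le)
    have "(\<integral>\<^sup>+ y\<in>X. f y * ?g y \<partial>lborel)\<^sup>2 = (\<integral>\<^sup>+ y. (f y * indicator X y) * (?g y * indicator X y) \<partial>lborel)\<^sup>2"
      by (intro arg_cong[of _ _ "\<lambda>x. x\<^sup>2"] nn_integral_cong) (auto split: split_indicator)
    also have "\<dots> \<le> (\<integral>\<^sup>+ y. (f y * indicator X y)\<^sup>2 \<partial>lborel) * (\<integral>\<^sup>+ y. (?g y * indicator X y)\<^sup>2 \<partial>lborel)"
      by (rule Cauchy_Schwarz_nn_integral) measurable
    also have "(\<integral>\<^sup>+ y. (f y * indicator X y)\<^sup>2 \<partial>lborel) = (\<integral>\<^sup>+ y\<in>X. (f y)\<^sup>2 \<partial>lborel)"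
      by (intro nn_integral_cong) (auto split: split_indicator)
    also have "(\<integral>\<^sup>+ y. (?g y * indicator X y)\<^sup>2 \<partial>lborel) = (\<integral>\<^sup>+ y\<in>X. (?g y)\<^sup>2 \<partial>lborel)"
      by (intro nn_integral_cong) (auto split: split_indicator)
    also have "(\<integral>\<^sup>+ y\<in>X. (f y)\<^sup>2 \<partial>lborel) * (\<integral>\<^sup>+ y\<in>X. (?g y)\<^sup>2 \<partial>lborel) \<le> ennreal (a\<^sup>2) * ennreal (pi * t\<^sup>2 * C)"
      by (intro mult_mono 1 2) auto
    also have "\<dots> = ennreal ((a * (t * sqrt (pi * C)))\<^sup>2)"
      using a by (simp add: ennreal_mult''[symmetric] power_mult_distrib mult_ac)
    finally show "(\<integral>\<^sup>+ y\<in>X. f y * ?g y \<partial>lborel)\<^sup>2 \<le> ennreal ((a * (t * sqrt (pi * C)))\<^sup>2)" .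
  qed (use a t in auto)
  have "ennreal (sqrt (pi * s) * t) = (\<integral>\<^sup>+ x. ennreal (sqrt (pi * s)) * indicator F x \<partial>lborel)"
    using s t by (simp add: nn_integral_cmult_indicator ennreal_mult'')
  also have "\<dots> \<le> (\<integral>\<^sup>+ x. riesz f x * indicator F x \<partial>lborel)"
    using s(2) by (intro nn_integral_mono) (auto split: split_indicator)
  also have "\<dots> = (\<integral>\<^sup>+ y. f y * ?g y \<partial>lborel)"
    by (rule riesz_adjoint) measurable
  also have "\<dots> \<le> (\<integral>\<^sup>+ y. f y * ?g y * indicator P y + f y * ?g y * indicator Q y \<partial>lborel)"
  proof (intro nn_integral_mono)
    fix y show "f y * ?g y \<le> f y * ?g y * indicator P y + f y * ?g y * indicator Q y"
      using supp[of y] by (cases "f y = 0") (auto split: split_indicator)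
  qed
  also have "\<dots> = (\<integral>\<^sup>+ y\<in>P. f y * ?g y \<partial>lborel) + (\<integral>\<^sup>+ y\<in>Q. f y * ?g y \<partial>lborel)"
    by (rule nn_integral_add) measurable
  also have "\<dots> \<le> ennreal (\<alpha> * (t * sqrt (pi * A))) + ennreal (\<beta> * (t * sqrt (pi * B)))"
    by (intro add_mono part assms)
  also have "\<dots> = ennreal (\<alpha> * (t * sqrt (pi * A)) + \<beta> * (t * sqrt (pi * B)))"
    using \<alpha>\<beta> AB t by (subst ennreal_plus) auto
  finally have "sqrt (pi * s) * t \<le> \<alpha> * (t * sqrt (pi * A)) + \<beta> * (t * sqrt (pi * B))"
    using \<alpha>\<beta> AB t by (subst (asm) ennreal_le_iff) auto
  then have "(sqrt pi * t) * sqrt s \<le> (sqrt pi * t) * (\<alpha> * sqrt A + \<beta> * sqrt B)"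
    by (simp add: real_sqrt_mult algebra_simps)
  then show ?thesis
    using t by (subst (asm) mult_le_cancel_left_pos) auto
qed

text \<open>The numerical core. In the application \<open>exp (- \<tau>)\<close> is the relative measure of a
  level set, \<open>l\<close> bounds the defect \<open>\<tau> - s\<close>, and \<open>h\<^sup>2\<close> is the
  mass of \<open>f\<close> on a set that is no larger than the first level set. The first level forces
  \<open>h\<^sup>2\<close> to be at most of order \<open>l / s1\<close>, since any mass there is wasted for
  that level; the second level can gain on the first only through \<open>h\<close>.\<close>

lemma two_level_arithmetic:
  fixes s1 s2 \<tau>1 \<tau>2 h l :: real
  assumes h: "0 \<le> h" "h \<le> 1" and l: "1 \<le> l" and s: "500 * l \<le> s1" "s1 < s2"
    and \<tau>: "\<tau>1 \<le> s1 + l" "\<tau>2 \<le> s2 + l" "s1 - 14 \<le> \<tau>1" "\<tau>1 \<le> \<tau>2"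
    and 1: "sqrt s1 \<le> sqrt (1 - h\<^sup>2) * sqrt (\<tau>1 + 14) + h * sqrt 14"
    and 2: "sqrt s2 \<le> sqrt (\<tau>1 + 14) + h * sqrt (\<tau>2 - \<tau>1 + 14)"
  shows "s2 - s1 \<le> 1100 * l"
proof -
  define T where "T = s1 + l + 14"
  define q where "q = sqrt T"
  have T: "T > 0" "\<tau>1 + 14 \<le> T" using s l \<tau> by (auto simp: T_def)
  have q: "q > 0" "q\<^sup>2 = T" "sqrt s1 \<le> q" using T s l by (auto simp: q_def T_def)
  have "h\<^sup>2 \<le> 1" using h by (simp add: power_le_one)
  have "sqrt (1 - h\<^sup>2) \<le> 1 - h\<^sup>2 / 2"
  proof (rule real_le_lsqrt)
    have "(1 - h\<^sup>2/2)\<^sup>2 = 1 - h\<^sup>2 + (h\<^sup>2 / 2)\<^sup>2" by (simp add: power2_eq_square algebra_simps)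
    then show "1 - h\<^sup>2 \<le> (1 - h\<^sup>2/2)\<^sup>2" using zero_le_power2[of "h\<^sup>2 / 2"] by linarith
  qed (use \<open>h\<^sup>2 \<le> 1\<close> in auto)
  moreover have "sqrt (\<tau>1 + 14) \<le> q" using T by (simp add: q_def)
  ultimately have "sqrt (1 - h\<^sup>2) * sqrt (\<tau>1 + 14) \<le> (1 - h\<^sup>2/2) * q"
    using \<open>h\<^sup>2 \<le> 1\<close> \<tau> s l by (intro mult_mono) auto
  moreover have "h * sqrt 14 \<le> h * 4"
    using h by (intro mult_left_mono real_le_lsqrt) auto
  ultimately have "sqrt s1 \<le> (1 - h\<^sup>2/2) * q + h * 4"
    using 1 by linarith
  then have "sqrt s1 * q \<le> ((1 - h\<^sup>2/2) * q + h * 4) * q"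
    using q by (intro mult_right_mono) auto
  moreover have "s1 \<le> sqrt s1 * q"
    using q s l mult_left_mono[of "sqrt s1" q "sqrt s1"] by simp
  ultimately have "s1 \<le> q\<^sup>2 - (h * q)\<^sup>2/2 + 4 * (h * q)"
    by (simp add: power2_eq_square algebra_simps)
  moreover have "q\<^sup>2 - s1 \<le> 15 * l" using q l by (simp add: T_def)
  moreover have "4 * (h * q) \<le> (h * q)\<^sup>2 / 4 + 16"
    using zero_le_power2[of "h * q / 2 - 4"] by (simp add: power2_eq_square algebra_simps)
  ultimately have X: "(h * q)\<^sup>2 \<le> 124 * l"
    using l by simp
  \<comment> \<open>\<open>Y\<close> dominates the logarithm of the ratio of the two measures; it enters only
    with the small factor \<open>h\<close>.\<close>
  define Y where "Y = s2 - s1 + 29 * l"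
  have Y: "Y > 0" "\<tau>2 - \<tau>1 + 14 \<le> Y" using s l \<tau> by (auto simp: Y_def)
  have "sqrt (\<tau>1 + 14) \<le> q" using T by (simp add: q_def)
  moreover have "h * sqrt (\<tau>2 - \<tau>1 + 14) \<le> h * sqrt Y"
    using Y h by (intro mult_left_mono) auto
  ultimately have "sqrt s2 \<le> q + h * sqrt Y" using 2 by linarith
  moreover have "0 \<le> sqrt s2" using s l by simp
  ultimately have "(sqrt s2)\<^sup>2 \<le> (q + h * sqrt Y)\<^sup>2"
    by (intro power_mono)
  then have "s2 \<le> q\<^sup>2 + 2 * (h * q) * sqrt Y + h\<^sup>2 * (sqrt Y)\<^sup>2"
    using s l by (simp add: power2_eq_square algebra_simps)
  then have 3: "s2 \<le> T + 2 * (h * q) * sqrt Y + h\<^sup>2 * Y"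
    using q Y by simp
  have "h\<^sup>2 * (500 * l) \<le> h\<^sup>2 * T" using s l by (intro mult_left_mono) (auto simp: T_def)
  also have "\<dots> \<le> 124 * l" using X q by (simp add: power_mult_distrib)
  finally have "h\<^sup>2 \<le> 1/4" using l by simp
  then have 4: "h\<^sup>2 * Y \<le> Y / 4" using mult_right_mono[of "h\<^sup>2" "1/4" Y] Y by simp
  have "2 * (h * q) * sqrt Y \<le> 4 * (h * q)\<^sup>2 + (sqrt Y)\<^sup>2 / 4"
    using zero_le_power2[of "2 * (h * q) - sqrt Y / 2"] by (simp add: power2_eq_square algebra_simps)
  then have 5: "2 * (h * q) * sqrt Y \<le> 496 * l + Y / 4" using X Y by simp
  from 3 4 5 have "s2 \<le> T + 496 * l + Y / 2" by linarith
  then show ?thesis using l unfolding T_def Y_def by argo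
qed

text \<open>The factor 1602 bounds the number of levels of defect at most \<open>k\<close>, divided by
  \<open>k\<close>; the factor \<open>exp 15\<close> accounts for defects as low as \<open>-14\<close> and for
  rounding them up to integers.\<close>

definition level_const :: real where
  "level_const = exp 15 * (1602 * (\<Sum>k. real k * exp (- real k)))"

lemma summable_k_exp: "summable (\<lambda>k. real k * exp (- real k))"
proof (rule summable_comparison_test)
  show "summable (\<lambda>k. 2 * exp (- 1/2 :: real) ^ k)"
    by (intro summable_mult summable_geometric) auto
  show "\<exists>N. \<forall>k\<ge>N. norm (real k * exp (- real k)) \<le> 2 * exp (- 1/2) ^ k"
  proof (intro exI allI impI)
    fix k :: nat
    have "real k / 2 \<le> exp (real k / 2)" using exp_ge_add_one_self[of "real k / 2"] by linarith
    then have "real k * exp (- real k) \<le> (2 * exp (real k / 2)) * exp (- real k)"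
      by (intro mult_right_mono) auto
    also have "\<dots> = 2 * exp (- 1/2) ^ k"
      by (simp add: exp_of_nat_mult[symmetric] exp_add[symmetric] mult.assoc)
    finally show "norm (real k * exp (- real k)) \<le> 2 * exp (- 1/2) ^ k" by simp
  qed
qed

text \<open>Apart from those below \<open>500 k\<close>, the levels of defect at most \<open>k\<close> lie in
  an interval of length \<open>1100 k\<close>; so their number grows linearly in \<open>k\<close>, against the
  exponential weight.\<close>

lemma sum_exp_levels:
  fixes d :: "nat \<Rightarrow> real" and S :: "nat set"
  assumes fin: "finite S" and low: "\<And>n. n \<in> S \<Longrightarrow> - 14 \<le> d n"
    and gap: "\<And>l n n'. 1 \<le> l \<Longrightarrow> n \<in> S \<Longrightarrow> n' \<in> S \<Longrightarrow> n < n' \<Longrightarrow> d n \<le> l \<Longrightarrow> d n' \<le> l \<Longrightarrow> 500 * l \<le> real n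
        \<Longrightarrow> real n' - real n \<le> 1100 * l"
  shows "(\<Sum>n\<in>S. exp (- d n)) \<le> level_const"
proof -
  have card: "real (card {n\<in>S. d n \<le> real k}) \<le> 1602 * real k" if k: "1 \<le> k" for k :: nat
  proof -
    let ?B = "{n\<in>S. d n \<le> real k \<and> 500 * k \<le> n}"
    have B: "card ?B \<le> 1100 * k + 1"
    proof (cases "?B = {}")
      case False
      define a where "a = Min ?B"
      have finB: "finite ?B" using fin by simp
      have a: "a \<in> ?B" using Min_in[OF finB False] by (simp add: a_def)
      have "?B \<subseteq> {a..a + 1100 * k}"
      proof
        fix n assume n: "n \<in> ?B"
        then have "a \<le> n" using finB by (simp add: a_def)
        moreover have "n \<le> a + 1100 * k"
        proof (cases "a = n")
          case False
          then have "a < n" using \<open>a \<le> n\<close> by simp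
          then have "real n - real a \<le> 1100 * real k"
            using gap[of "real k" a n] a n k by auto
          then show ?thesis by linarith
        qed simp
        ultimately show "n \<in> {a..a + 1100 * k}" by simp
      qed
      then have "card ?B \<le> card {a..a + 1100 * k}" by (rule card_mono[rotated]) simp
      then show ?thesis by simp
    qed (simp only: card.empty)
    have "{n\<in>S. d n \<le> real k} \<subseteq> {..<500*k} \<union> ?B" by auto
    then have "card {n\<in>S. d n \<le> real k} \<le> card ({..<500*k} \<union> ?B)"
      using fin by (intro card_mono) auto
    also have "\<dots> \<le> 500 * k + card ?B"
      using card_Un_le[of "{..<500*k}" ?B] by (simp only: card_lessThan)
    also have "\<dots> \<le> 500 * k + (1100 * k + 1)" using B by (rule add_left_mono)
    also have "\<dots> \<le> 1602 * k" using k by linarith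
    finally have "real (card {n\<in>S. d n \<le> real k}) \<le> real (1602 * k)" by (rule of_nat_mono)
    then show ?thesis by simp
  qed
  define \<kappa> where "\<kappa> = (\<lambda>n. max 1 (nat \<lceil>d n\<rceil>))"
  have \<kappa>: "1 \<le> \<kappa> n" "d n \<le> real (\<kappa> n)" for n
    unfolding \<kappa>_def by (auto simp: of_nat_max) linarith
  have exp_le: "exp (- d n) \<le> exp 15 * exp (- real (\<kappa> n))" if "n \<in> S" for n
  proof -
    have "real (\<kappa> n) \<le> d n + 15"
      using low[OF that] unfolding \<kappa>_def by (auto simp: of_nat_max) linarith+
    then show ?thesis by (simp add: exp_add[symmetric])
  qed
  have "(\<Sum>n\<in>S. exp (- d n)) \<le> (\<Sum>n\<in>S. exp 15 * exp (- real (\<kappa> n)))"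
    by (intro sum_mono exp_le)
  also have "\<dots> = exp 15 * (\<Sum>n\<in>S. exp (- real (\<kappa> n)))"
    by (simp add: sum_distrib_left)
  also have "(\<Sum>n\<in>S. exp (- real (\<kappa> n))) = (\<Sum>k\<in>\<kappa> ` S. \<Sum>n\<in>{n\<in>S. \<kappa> n = k}. exp (- real (\<kappa> n)))"
    by (rule sum.image_gen[OF fin])
  also have "\<dots> = (\<Sum>k\<in>\<kappa> ` S. real (card {n\<in>S. \<kappa> n = k}) * exp (- real k))"
    by (intro sum.cong) auto
  also have "\<dots> \<le> (\<Sum>k\<in>\<kappa> ` S. 1602 * (real k * exp (- real k)))"
  proof (intro sum_mono)
    fix k assume "k \<in> \<kappa> ` S"
    then have k: "1 \<le> k" using \<kappa>(1) by auto
    have "card {n\<in>S. \<kappa> n = k} \<le> card {n\<in>S. d n \<le> real k}"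
      using fin \<kappa>(2) by (intro card_mono) auto
    then have "real (card {n\<in>S. \<kappa> n = k}) \<le> 1602 * real k" using card[OF k] by linarith
    then have "real (card {n\<in>S. \<kappa> n = k}) * exp (- real k) \<le> (1602 * real k) * exp (- real k)"
      by (rule mult_right_mono) simp
    then show "real (card {n\<in>S. \<kappa> n = k}) * exp (- real k) \<le> 1602 * (real k * exp (- real k))"
      by simp
  qed
  also have "\<dots> = 1602 * (\<Sum>k\<in>\<kappa> ` S. real k * exp (- real k))"
    by (simp add: sum_distrib_left)
  also have "\<dots> \<le> 1602 * (\<Sum>k. real k * exp (- real k))"
    using fin by (intro mult_left_mono sum_le_suminf summable_k_exp) auto
  finally show ?thesis by (simp add: level_const_def)
qed

lemma ln_one_plus_exp_le:
  assumes "0 \<le> (\<tau>::real)"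
  shows "ln (1 + exp \<tau>) \<le> \<tau> + 1"
proof -
  have "1 + exp \<tau> \<le> 2 * exp \<tau>" using assms by simp
  also have "\<dots> \<le> exp 1 * exp \<tau>"
    using exp_ge_add_one_self[of "1::real"] by (intro mult_right_mono) auto
  also have "\<dots> = exp (\<tau> + 1)" by (simp add: exp_add)
  finally have "ln (1 + exp \<tau>) \<le> ln (exp (\<tau> + 1))"
    by (intro ln_mono) (auto simp: add_pos_pos)
  then show ?thesis by simp
qed

text \<open>The critical exponential inequality on a set of finite measure. The levels are \<open>4 pi
  w\<^sup>2 \<ge> n\<close>. For two levels \<open>n < n'\<close> the set \<open>H\<close> consists of the
  points where the potential of the higher level set is large; by the weak-type bound it is no larger than the
  lower level set, and it separates the part of \<open>f\<close> that both levels use from the part that only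
  the higher one uses.\<close>

theorem riesz_exponential_integrability:
  fixes f :: "real^2 \<Rightarrow> ennreal" and w :: "real^2 \<Rightarrow> real"
  assumes [measurable]: "f \<in> borel_measurable borel" "w \<in> borel_measurable borel" "E \<in> sets borel"
    and m: "0 < m" "emeasure lborel E \<le> ennreal m"
    and supp: "\<And>y. y \<notin> E \<Longrightarrow> f y = 0" and f1: "(\<integral>\<^sup>+ y. (f y)\<^sup>2 \<partial>lborel) \<le> 1"
    and w: "\<And>x. x \<in> E \<Longrightarrow> 0 \<le> w x" "\<And>x. x \<in> E \<Longrightarrow> ennreal (2 * pi * w x) \<le> riesz f x"
  shows "(\<integral>\<^sup>+ x\<in>E. ennreal (exp (4 * pi * (w x)\<^sup>2)) \<partial>lborel) \<le> ennreal (exp 1 * (level_const * m))"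
proof -
  define F where "F = (\<lambda>n::nat. {x\<in>E. real n \<le> 4 * pi * (w x)\<^sup>2})"
  have F_meas [measurable]: "F n \<in> sets borel" for n
    unfolding F_def by measurable
  define t where "t = (\<lambda>n. measure lborel (F n))"
  have FE: "F n \<subseteq> E" for n by (auto simp: F_def)
  have emF: "emeasure lborel (F n) = ennreal (t n)" and tm: "t n \<le> m" and t0: "0 \<le> t n" for n
  proof -
    have "emeasure lborel (F n) \<le> ennreal m"
      using emeasure_mono[OF FE, of lborel n] m by auto
    moreover from this have "emeasure lborel (F n) \<noteq> \<infinity>" by (auto simp: top_unique)
    ultimately show "emeasure lborel (F n) = ennreal (t n)" "t n \<le> m" "0 \<le> t n"
      using m by (auto simp: t_def emeasure_eq_ennreal_measure)
  qed
  have tmono: "t n' \<le> t n" if "n \<le> n'" for n n'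
  proof -
    have "F n' \<subseteq> F n" using that by (auto simp: F_def intro: order_trans[of "real n"])
    then have "ennreal (t n') \<le> ennreal (t n)"
      unfolding emF[symmetric] by (intro emeasure_mono) auto
    then show ?thesis using t0 by simp
  qed
  have level: "ennreal (sqrt (pi * real n)) \<le> riesz f x" if "x \<in> F n" for n x
  proof -
    have "sqrt (pi * real n) \<le> 2 * pi * w x"
    proof (rule real_le_lsqrt)
      have "pi * real n \<le> pi * (4 * pi * (w x)\<^sup>2)"
        using that by (intro mult_left_mono) (auto simp: F_def)
      then show "pi * real n \<le> (2 * pi * w x)\<^sup>2" by (simp add: power2_eq_square mult_ac)
    qed (use that w in \<open>auto simp: F_def\<close>)
    then show ?thesis using w(2)[of x] that FE by (meson ennreal_leI order_trans subsetD)
  qed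
  define \<tau> where "\<tau> = (\<lambda>n. - ln (t n / m))"
  have exp\<tau>: "m / t n = exp (\<tau> n)" "t n = m * exp (- \<tau> n)" "0 \<le> \<tau> n" if "0 < t n" for n
    using that m tm[of n] by (auto simp: \<tau>_def exp_minus)
  have lnA: "ln (1 + m / t n) + 13 \<le> \<tau> n + 14" "0 \<le> ln (1 + m / t n) + 13" if "0 < t n" for n
    using ln_one_plus_exp_le[of "\<tau> n"] exp\<tau>[OF that] by auto
  have sqrt_id: "3 * sqrt pi * s / sqrt s = 3 * sqrt (pi * s)" if "0 < s" for s
    using that by (simp add: real_sqrt_mult real_div_sqrt mult.assoc flip: times_divide_eq_right)
  have sq_mono: "(\<integral>\<^sup>+ y\<in>X. (f y)\<^sup>2 \<partial>lborel) \<le> 1" for X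
  proof -
    have "(\<integral>\<^sup>+ y\<in>X. (f y)\<^sup>2 \<partial>lborel) \<le> (\<integral>\<^sup>+ y. (f y)\<^sup>2 \<partial>lborel)"
      by (intro nn_integral_mono) (auto split: split_indicator)
    then show ?thesis using f1 by simp
  qed
  have own: "(\<integral>\<^sup>+ y\<in>X. (riesz (indicator (F n)) y)\<^sup>2 \<partial>lborel) \<le> ennreal (pi * (t n)\<^sup>2 * A)"
    if [measurable]: "X \<in> sets borel" and "0 < t n" "emeasure lborel X \<le> ennreal a" "0 \<le> a"
      and A: "ln (1 + a / t n) + 13 \<le> A" for X n a A
  proof -
    have "(\<integral>\<^sup>+ y\<in>X. (riesz (indicator (F n)) y)\<^sup>2 \<partial>lborel) \<le> ennreal (pi * (t n)\<^sup>2 * (ln (1 + a / t n) + 13))"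
      using that riesz_indicator_le[of "F n" "t n"]
      by (intro riesz_square_integral[where \<sigma> = "t n"]) (auto simp: emF sqrt_id)
    also have "\<dots> \<le> ennreal (pi * (t n)\<^sup>2 * A)"
      by (intro ennreal_leI mult_left_mono A) auto
    finally show ?thesis .
  qed
  \<comment> \<open>One level alone: the distribution estimate, with the logarithm contributing \<open>\<tau>
    n\<close> up to a constant.\<close>
  have low: "real n \<le> \<tau> n + 14" if t: "0 < t n" for n
  proof -
    have "sqrt (real n) \<le> 1 * sqrt (\<tau> n + 14) + 0 * sqrt 0"
    proof (rule level_bound[where f = f and F = "F n" and P = E and Q = "{}" and t = "t n"])
      show "(\<integral>\<^sup>+ y\<in>E. (riesz (indicator (F n)) y)\<^sup>2 \<partial>lborel) \<le> ennreal (pi * (t n)\<^sup>2 * (\<tau> n + 14))"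
        using m lnA[OF t] t by (intro own[where a = m]) auto
    qed (use t emF level supp sq_mono exp\<tau>[OF t] in auto)
    then show ?thesis by simp
  qed
  have gap: "real n' - real n \<le> 1100 * l"
    if l: "1 \<le> l" and n: "0 < t n" "0 < t n'" "n < n'" and d: "\<tau> n - real n \<le> l" "\<tau> n' - real n' \<le> l" "500 * l \<le> real n"
    for l n n'
  proof -
    define c where "c = 3 * sqrt pi * t n' / sqrt (t n)"
    \<comment> \<open>The threshold \<open>c\<close> is the one at which the weak-type bound gives
      \<open>H\<close> at most the measure of \<open>F n\<close>.\<close>
    define H where "H = {y\<in>E. ennreal c < riesz (indicator (F n')) y}"
    have [measurable]: "H \<in> sets borel" unfolding H_def by measurable
    have HE: "H \<subseteq> E" by (auto simp: H_def)
    have Hm: "emeasure lborel H \<le> ennreal m"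
      using emeasure_mono[OF HE, of lborel] m by auto
    then have Hfin: "emeasure lborel H < \<infinity>" by (rule le_less_trans) simp
    have Ht: "emeasure lborel H \<le> ennreal (t n)"
    proof (rule riesz_weak_type)
      show "emeasure lborel (F n') \<le> ennreal (t n')" by (simp add: emF)
      show "ennreal (3 * sqrt pi * t n' / sqrt (t n)) \<le> riesz (indicator (F n')) y" if "y \<in> H" for y
        using that unfolding H_def c_def by (auto intro: less_imp_le)
    qed (use n Hfin in simp_all)
    have EHm: "emeasure lborel (E - H) \<le> ennreal m"
      using emeasure_mono[of "E - H" E lborel] m by auto
    have EHr: "riesz (indicator (F n')) y \<le> ennreal c" if "y \<in> E - H" for y
      using that by (auto simp: H_def not_less)
    define h where "h = sqrt (enn2real (\<integral>\<^sup>+ y\<in>H. (f y)\<^sup>2 \<partial>lborel))"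
    have hH: "(\<integral>\<^sup>+ y\<in>H. (f y)\<^sup>2 \<partial>lborel) = ennreal (h\<^sup>2)"
    proof -
      have "(\<integral>\<^sup>+ y\<in>H. (f y)\<^sup>2 \<partial>lborel) < top" using sq_mono[of H] by (rule le_less_trans) simp
      then show ?thesis unfolding h_def by simp
    qed
    have h: "0 \<le> h" "h \<le> 1"
    proof -
      show "0 \<le> h" by (simp add: h_def)
      moreover have "h\<^sup>2 \<le> 1" using sq_mono[of H] unfolding hH by simp
      ultimately show "h \<le> 1" by (simp add: power_le_one_iff abs_square_le_1)
    qed
    have "h\<^sup>2 \<le> 1" using h by (simp add: power_le_one)
    have hE: "(\<integral>\<^sup>+ y\<in>E - H. (f y)\<^sup>2 \<partial>lborel) \<le> ennreal ((sqrt (1 - h\<^sup>2))\<^sup>2)"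
    proof -
      have "(\<integral>\<^sup>+ y\<in>E - H. (f y)\<^sup>2 \<partial>lborel) + ennreal (h\<^sup>2) = (\<integral>\<^sup>+ y. (f y)\<^sup>2 * indicator (E - H) y + (f y)\<^sup>2 * indicator H y \<partial>lborel)"
        unfolding hH[symmetric] by (subst nn_integral_add) auto
      also have "\<dots> \<le> (\<integral>\<^sup>+ y. (f y)\<^sup>2 \<partial>lborel)"
        by (intro nn_integral_mono) (auto split: split_indicator)
      also have "\<dots> \<le> 1" by (rule f1)
      finally have *: "(\<integral>\<^sup>+ y\<in>E - H. (f y)\<^sup>2 \<partial>lborel) + ennreal (h\<^sup>2) \<le> ennreal 1" by simp
      have "(\<integral>\<^sup>+ y\<in>E - H. (f y)\<^sup>2 \<partial>lborel) \<le> ennreal (1 - h\<^sup>2)"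
        using * \<open>h\<^sup>2 \<le> 1\<close> by (cases "\<integral>\<^sup>+ y\<in>E - H. (f y)\<^sup>2 \<partial>lborel") (auto simp: ennreal_plus[symmetric] top_unique simp del: ennreal_plus)
      then show ?thesis using \<open>h\<^sup>2 \<le> 1\<close> by simp
    qed
    have tt: "t n' \<le> t n" using n by (intro tmono) auto
    have \<tau>\<tau>: "\<tau> n \<le> \<tau> n'" using tt n m by (simp add: \<tau>_def divide_right_mono)
    have ratio: "t n / t n' = exp (\<tau> n' - \<tau> n)"
    proof -
      have "t n / t n' = (m / t n') / (m / t n)" using n m by simp
      then show ?thesis by (simp only: exp\<tau>(1)[OF n(1)] exp\<tau>(1)[OF n(2)] exp_diff)
    qed
    have supp': "y \<in> (E - H) \<union> H" if "f y \<noteq> 0" for y using supp that HE by auto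
    have 1: "sqrt (real n) \<le> sqrt (1 - h\<^sup>2) * sqrt (\<tau> n + 14) + h * sqrt 14"
    proof (rule level_bound[where f = f and F = "F n" and P = "E - H" and Q = H and t = "t n"])
      show "(\<integral>\<^sup>+ y\<in>E - H. (riesz (indicator (F n)) y)\<^sup>2 \<partial>lborel) \<le> ennreal (pi * (t n)\<^sup>2 * (\<tau> n + 14))"
        using m lnA[OF n(1)] n EHm by (intro own[where a = m]) auto
      show "(\<integral>\<^sup>+ y\<in>H. (riesz (indicator (F n)) y)\<^sup>2 \<partial>lborel) \<le> ennreal (pi * (t n)\<^sup>2 * 14)"
        using n Ht ln_le_minus_one[of "2::real"] by (intro own[where a = "t n"]) auto
    qed (use n emF level supp' hE hH h exp\<tau> \<open>h\<^sup>2 \<le> 1\<close> in auto)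
    have 2: "sqrt (real n') \<le> 1 * sqrt (\<tau> n + 14) + h * sqrt (\<tau> n' - \<tau> n + 14)"
    proof (rule level_bound[where f = f and F = "F n'" and P = "E - H" and Q = H and t = "t n'"])
      have "(\<integral>\<^sup>+ y\<in>E - H. (riesz (indicator (F n')) y)\<^sup>2 \<partial>lborel) \<le> ennreal (pi * (t n')\<^sup>2 * (ln (1 + m / t n) + 13))"
      proof (rule riesz_square_integral)
        show "emeasure lborel (F n') \<le> ennreal (t n')" by (simp add: emF)
        show "riesz (indicator (F n')) y \<le> ennreal (3 * sqrt pi * t n' / sqrt (t n))" if "y \<in> E - H" for y
          using EHr[OF that] unfolding c_def .
      qed (use n m EHm in simp_all)
      also have "\<dots> \<le> ennreal (pi * (t n')\<^sup>2 * (\<tau> n + 14))"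
        using lnA[OF n(1)] by (intro ennreal_leI mult_left_mono) auto
      finally show "(\<integral>\<^sup>+ y\<in>E - H. (riesz (indicator (F n')) y)\<^sup>2 \<partial>lborel) \<le> ennreal (pi * (t n')\<^sup>2 * (\<tau> n + 14))" .
      show "(\<integral>\<^sup>+ y\<in>H. (riesz (indicator (F n')) y)\<^sup>2 \<partial>lborel) \<le> ennreal (pi * (t n')\<^sup>2 * (\<tau> n' - \<tau> n + 14))"
        using n Ht ln_one_plus_exp_le[of "\<tau> n' - \<tau> n"] \<tau>\<tau> by (intro own[where a = "t n"]) (auto simp: ratio)
    qed (use n emF level supp' sq_mono hH h exp\<tau> \<tau>\<tau> in auto)
    show ?thesis
      by (rule two_level_arithmetic[OF h l d(3) _ _ _ _ \<tau>\<tau> 1]) (use 2 n d low[OF n(1)] in auto)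
  qed
  have partial: "(\<Sum>n<N. exp (real n) * t n) \<le> level_const * m" for N
  proof -
    define S where "S = {n. n < N \<and> 0 < t n}"
    have "(\<Sum>n<N. exp (real n) * t n) = (\<Sum>n\<in>S. exp (real n) * t n)"
      using t0 by (intro sum.mono_neutral_right) (auto simp: S_def not_less intro: antisym)
    also have "\<dots> = (\<Sum>n\<in>S. exp (- (\<tau> n - real n))) * m"
      unfolding sum_distrib_right
    proof (intro sum.cong refl)
      fix n assume "n \<in> S"
      then have "t n = m * exp (- \<tau> n)" using exp\<tau>(2)[of n] by (simp add: S_def)
      then show "exp (real n) * t n = exp (- (\<tau> n - real n)) * m"
        by (simp add: exp_diff exp_minus field_simps)
    qed
    also have "\<dots> \<le> level_const * m"
    proof (intro mult_right_mono sum_exp_levels)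
      show "- 14 \<le> \<tau> n - real n" if "n \<in> S" for n
        using low[of n] that by (simp add: S_def)
      show "real n' - real n \<le> 1100 * l"
        if "1 \<le> l" "n \<in> S" "n' \<in> S" "n < n'" "\<tau> n - real n \<le> l" "\<tau> n' - real n' \<le> l" "500 * l \<le> real n" for l n n'
        using gap[of l n n'] that by (simp add: S_def)
    qed (use m in \<open>auto simp: S_def\<close>)
    finally show ?thesis .
  qed
  have "(\<integral>\<^sup>+ x\<in>E. ennreal (exp (4 * pi * (w x)\<^sup>2)) \<partial>lborel) \<le> (\<integral>\<^sup>+ x. (\<Sum>n. ennreal (exp (real n + 1)) * indicator (F n) x) \<partial>lborel)"
  proof (intro nn_integral_mono)
    fix x
    show "ennreal (exp (4 * pi * (w x)\<^sup>2)) * indicator E x \<le> (\<Sum>n. ennreal (exp (real n + 1)) * indicator (F n) x)"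
    proof (cases "x \<in> E")
      case True
      define n where "n = nat \<lfloor>4 * pi * (w x)\<^sup>2\<rfloor>"
      have n: "real n \<le> 4 * pi * (w x)\<^sup>2" "4 * pi * (w x)\<^sup>2 \<le> real n + 1"
        unfolding n_def by (auto simp: of_nat_nat intro: less_imp_le)
      have "ennreal (exp (4 * pi * (w x)\<^sup>2)) * indicator E x \<le> ennreal (exp (real n + 1)) * indicator (F n) x"
        using True n by (auto simp: F_def intro!: ennreal_leI)
      also have "\<dots> \<le> (\<Sum>n. ennreal (exp (real n + 1)) * indicator (F n) x)"
      proof -
        have "a n \<le> (\<Sum>k. a k)" for a :: "nat \<Rightarrow> ennreal"
          using sum_le_suminf[of a "{n}"] by simp
        then show ?thesis .
      qed
      finally show ?thesis .
    qed simp
  qed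
  also have "\<dots> = (\<Sum>n. \<integral>\<^sup>+ x. ennreal (exp (real n + 1)) * indicator (F n) x \<partial>lborel)"
    by (rule nn_integral_suminf) measurable
  also have "\<dots> = (\<Sum>n. ennreal (exp (real n + 1) * t n))"
    using t0 by (intro suminf_cong) (simp add: nn_integral_cmult_indicator emF ennreal_mult)
  also have "\<dots> = (SUP N. \<Sum>n<N. ennreal (exp (real n + 1) * t n))"
    by (rule suminf_eq_SUP)
  also have "\<dots> \<le> ennreal (exp 1 * (level_const * m))"
  proof (rule SUP_least)
    fix N
    have "(\<Sum>n<N. ennreal (exp (real n + 1) * t n)) = ennreal (\<Sum>n<N. exp (real n + 1) * t n)"
      using t0 by (intro sum_ennreal) auto
    also have "(\<Sum>n<N. exp (real n + 1) * t n) = exp 1 * (\<Sum>n<N. exp (real n) * t n)"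
      by (simp add: sum_distrib_left exp_add mult_ac)
    also have "ennreal (exp 1 * (\<Sum>n<N. exp (real n) * t n)) \<le> ennreal (exp 1 * (level_const * m))"
      by (intro ennreal_leI mult_left_mono partial) simp
    finally show "(\<Sum>n<N. ennreal (exp (real n + 1) * t n)) \<le> ennreal (exp 1 * (level_const * m))" .
  qed
  finally show ?thesis .
qed

section \<open>Smooth functions and bumps\<close>

lemma C_k_Suc_imp: "C_k (Suc k) f \<Longrightarrow> C_k k f"
proof (induction k arbitrary: f)
  case 0
  then show ?case
    by (auto simp: continuous_on_eq_continuous_at intro: differentiable_imp_continuous_within)
next
  case (Suc k)
  then show ?case by (metis C_k.simps(2))
qed

lemma frechet_derivative_at_works:
  assumes "f differentiable (at x)"
  shows "(f has_derivative frechet_derivative f (at x)) (at x)"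
  using assms by (simp add: frechet_derivative_works[symmetric])

lemma C_k_const: "C_k k (\<lambda>x. c)"
  by (induction k arbitrary: c) (auto simp: frechet_derivative_const)

lemma C_k_add: "C_k k f \<Longrightarrow> C_k k g \<Longrightarrow> C_k k (\<lambda>x. f x + g x)"
proof (induction k arbitrary: f g)
  case 0
  then show ?case by (simp add: continuous_on_add)
next
  case (Suc k)
  have d: "((\<lambda>x. f x + g x) has_derivative (\<lambda>v. frechet_derivative f (at x) v + frechet_derivative g (at x) v)) (at x)" for x
    using Suc.prems by (intro has_derivative_add frechet_derivative_at_works) auto
  show ?case
    unfolding C_k.simps frechet_derivative_at[OF d, symmetric]
  proof (intro conjI allI)
    show "(\<lambda>x. f x + g x) differentiable at x" for x using d differentiableI by blast
    show "C_k k (\<lambda>x. frechet_derivative f (at x) v + frechet_derivative g (at x) v)" for v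
      using Suc.prems by (intro Suc.IH) simp_all
  qed
qed

lemma C_k_mult: "C_k k f \<Longrightarrow> C_k k g \<Longrightarrow> C_k k (\<lambda>x. f x * g x)"
proof (induction k arbitrary: f g)
  case 0
  then show ?case by (simp add: continuous_on_mult)
next
  case (Suc k)
  have d: "((\<lambda>x. f x * g x) has_derivative (\<lambda>v. f x * frechet_derivative g (at x) v + frechet_derivative f (at x) v * g x)) (at x)" for x
    using Suc.prems by (intro has_derivative_mult frechet_derivative_at_works) auto
  have fg: "C_k k f" "C_k k g" using Suc.prems C_k_Suc_imp by auto
  show ?case
    unfolding C_k.simps frechet_derivative_at[OF d, symmetric]
  proof (intro conjI allI)
    show "(\<lambda>x. f x * g x) differentiable at x" for x using d differentiableI by blast
    show "C_k k (\<lambda>x. f x * frechet_derivative g (at x) v + frechet_derivative f (at x) v * g x)" for v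
      using Suc.prems fg by (intro C_k_add Suc.IH) simp_all
  qed
qed

lemma C_k_prod: "finite I \<Longrightarrow> (\<And>i. i \<in> I \<Longrightarrow> C_k k (f i)) \<Longrightarrow> C_k k (\<lambda>x. \<Prod>i\<in>I. f i x)"
  by (induction I rule: finite_induct) (auto intro: C_k_const C_k_mult)

lemma C_k_compose_affine:
  fixes f :: "'a::euclidean_space \<Rightarrow> real"
  shows "C_k k f \<Longrightarrow> C_k k (\<lambda>y. f (c + s *\<^sub>R y))"
proof (induction k arbitrary: f)
  case 0
  have "continuous_on UNIV (\<lambda>y. f (c + s *\<^sub>R y))"
    by (rule continuous_on_compose2[OF 0[unfolded C_k.simps]]) (auto intro!: continuous_intros)
  then show ?case by simp
next
  case (Suc k)
  have d: "((\<lambda>y. f (c + s *\<^sub>R y)) has_derivative (\<lambda>v. frechet_derivative f (at (c + s *\<^sub>R x)) (s *\<^sub>R v))) (at x)" for x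
  proof -
    have "((\<lambda>y. c + s *\<^sub>R y) has_derivative (\<lambda>v. s *\<^sub>R v)) (at x)"
      by (auto intro!: derivative_eq_intros)
    moreover have "(f has_derivative frechet_derivative f (at (c + s *\<^sub>R x))) (at (c + s *\<^sub>R x))"
      using Suc.prems by (intro frechet_derivative_at_works) simp
    ultimately show ?thesis by (rule has_derivative_compose)
  qed
  show ?case
    unfolding C_k.simps frechet_derivative_at[OF d, symmetric]
  proof (intro conjI allI)
    show "(\<lambda>y. f (c + s *\<^sub>R y)) differentiable at x" for x using d differentiableI by blast
    show "C_k k (\<lambda>x. frechet_derivative f (at (c + s *\<^sub>R x)) (s *\<^sub>R v))" for v
      using Suc.prems by (intro Suc.IH[of "\<lambda>z. frechet_derivative f (at z) (s *\<^sub>R v)"]) simp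
  qed
qed

text \<open>For \<open>p = 1\<close> this is the usual smooth function that is flat at the origin; with a
  polynomial factor in \<open>1 / t\<close> the family is closed under differentiation.\<close>

definition flat :: "real poly \<Rightarrow> real \<Rightarrow> real" where
  "flat p t = (if 0 < t then poly p (1 / t) * exp (- (1 / t)) else 0)"

lemma poly_times_exp_tendsto_0: "((\<lambda>x. poly p x * exp (- x)) \<longlongrightarrow> (0::real)) at_top"
proof -
  have "((\<lambda>x. \<Sum>i\<le>degree p. coeff p i * (x ^ i / exp x)) \<longlongrightarrow> (\<Sum>i\<le>degree p. coeff p i * 0)) at_top"
    by (intro tendsto_intros tendsto_power_div_exp_0)
  then show ?thesis
    by (simp add: poly_altdef sum_distrib_right exp_minus divide_inverse mult.assoc)
qed

lemma flat_at_0: "((\<lambda>t. flat p t) \<longlongrightarrow> 0) (at 0)"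
proof (rule filterlim_split_at)
  have "((\<lambda>t. poly p (inverse t) * exp (- inverse t)) \<longlongrightarrow> 0) (at_right 0)"
    by (rule filterlim_compose[OF poly_times_exp_tendsto_0 filterlim_inverse_at_top_right])
  then show "(flat p \<longlongrightarrow> 0) (at_right 0)"
    by (rule Lim_transform_eventually)
       (auto simp: flat_def eventually_at_filter inverse_eq_divide)
  show "(flat p \<longlongrightarrow> 0) (at_left 0)"
    by (rule tendsto_eventually) (auto simp: flat_def eventually_at_filter)
qed

text \<open>Away from the origin this is the product rule. At the origin the difference quotient of the member
  with polynomial \<open>p\<close> is the member with polynomial \<open>x p\<close>, which tends to
  zero.\<close>

lemma flat_has_derivative: "(flat p has_real_derivative flat ([:0, 0, 1:] * (p - pderiv p)) t) (at t)"
proof -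
  consider "t < 0" | "t = 0" | "t > 0" by linarith
  then show ?thesis
  proof cases
    case 1
    have "((\<lambda>t. 0) has_real_derivative 0) (at t)" by simp
    then have "(flat p has_real_derivative 0) (at t)"
      by (rule DERIV_cong_ev[THEN iffD1, rotated -1])
         (use 1 in \<open>auto simp: flat_def eventually_nhds intro!: exI[of _ "{..<0}"]\<close>)
    then show ?thesis using 1 by (simp add: flat_def)
  next
    case 2
    have "((\<lambda>h. flat ([:0, 1:] * p) h) \<longlongrightarrow> 0) (at 0)" by (rule flat_at_0)
    moreover have "flat ([:0, 1:] * p) h = (flat p (0 + h) - flat p 0) / h" for h
      by (simp add: flat_def)
    ultimately have "((\<lambda>h. (flat p (0 + h) - flat p 0) / h) \<longlongrightarrow> 0) (at 0)" by simp
    then show ?thesis using 2 by (simp add: DERIV_def flat_def)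
  next
    case 3
    have "((\<lambda>t. poly p (1 / t) * exp (- (1 / t))) has_real_derivative
        flat ([:0, 0, 1:] * (p - pderiv p)) t) (at t)"
      using 3
      by (auto intro!: derivative_eq_intros simp: flat_def power2_eq_square field_simps)
    then show ?thesis
      by (rule DERIV_cong_ev[THEN iffD1, rotated -1])
         (use 3 in \<open>auto simp: flat_def eventually_nhds intro!: exI[of _ "{0<..}"]\<close>)
  qed
qed

lemma flat_inner_has_derivative:
  fixes x l :: "'a::euclidean_space"
  shows "((\<lambda>x. flat p (c + x \<bullet> l)) has_derivative (\<lambda>v. flat ([:0, 0, 1:] * (p - pderiv p)) (c + x \<bullet> l) * (v \<bullet> l))) (at x)"
proof -
  have "((\<lambda>x. c + x \<bullet> l) has_derivative (\<lambda>v. v \<bullet> l)) (at x)"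
    by (auto intro!: derivative_eq_intros)
  from has_derivative_compose[OF this flat_has_derivative[unfolded has_field_derivative_def]]
  show ?thesis .
qed

lemma C_k_flat: "C_k k (\<lambda>x::'a::euclidean_space. flat p (c + x \<bullet> l))"
proof (induction k arbitrary: p)
  case 0
  show ?case
    by (auto intro!: continuous_at_imp_continuous_on has_derivative_continuous[OF flat_inner_has_derivative])
next
  case (Suc k)
  show ?case
    unfolding C_k.simps frechet_derivative_at[OF flat_inner_has_derivative, symmetric]
  proof (intro conjI allI)
    show "(\<lambda>x. flat p (c + x \<bullet> l)) differentiable at x" for x
      using flat_inner_has_derivative differentiableI by blast
    show "C_k k (\<lambda>x. flat ([:0, 0, 1:] * (p - pderiv p)) (c + x \<bullet> l) * (v \<bullet> l))" for v
      by (intro C_k_mult C_k_const Suc.IH)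
  qed
qed

text \<open>The parameter \<open>n\<close> steepens the edges: as \<open>n\<close> tends to infinity these
  functions tend to the indicator of the open box.\<close>

definition bump :: "'a::euclidean_space \<Rightarrow> 'a \<Rightarrow> nat \<Rightarrow> 'a \<Rightarrow> real" where
  "bump a b n x = (\<Prod>i\<in>Basis. flat 1 (real n * (x \<bullet> i - a \<bullet> i)) * flat 1 (real n * (b \<bullet> i - x \<bullet> i)))"

lemma flat_1_bounds: "0 \<le> flat 1 t" "flat 1 t \<le> 1"
  by (auto simp: flat_def)

lemma bump_bounds: "0 \<le> bump a b n x" "bump a b n x \<le> 1"
  unfolding bump_def using flat_1_bounds
  by (auto intro!: prod_nonneg prod_le_1 mult_le_one)

lemma bump_support: "bump a b n x \<noteq> 0 \<Longrightarrow> x \<in> box a b"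
  by (auto simp: bump_def mem_box flat_def zero_less_mult_iff split: if_splits)

lemma bump_pos: "0 < n \<Longrightarrow> x \<in> box a b \<Longrightarrow> 0 < bump a b n x"
  unfolding bump_def by (intro prod_pos) (auto simp: flat_def mem_box)

lemma C_k_bump: "C_k k (bump a b n)"
proof -
  have "bump a b n = (\<lambda>x. \<Prod>i\<in>Basis. flat 1 (- real n * (a \<bullet> i) + x \<bullet> (real n *\<^sub>R i)) * flat 1 (real n * (b \<bullet> i) + x \<bullet> (- real n *\<^sub>R i)))"
    by (simp add: bump_def fun_eq_iff algebra_simps)
  then show ?thesis by (simp only:) (intro C_k_prod C_k_mult C_k_flat finite_Basis)
qed

lemma bump_test_function:
  assumes "cbox a b \<subseteq> \<Omega>"
  shows "bump a b n \<in> test_functions \<Omega>"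
proof -
  have "closure {x. bump a b n x \<noteq> 0} \<subseteq> cbox a b"
    using bump_support box_subset_cbox by (intro closure_minimal) blast+
  then show ?thesis
    using assms C_k_bump bounded_subset[OF bounded_cbox]
    unfolding test_functions_def by (auto simp: compact_eq_bounded_closed)
qed

lemma bump_tendsto: "(\<lambda>n. bump a b n x) \<longlonglongrightarrow> indicator (box a b) x"
proof (cases "x \<in> box a b")
  case True
  have "(\<lambda>n. flat 1 (real n * s)) \<longlonglongrightarrow> 1" if "0 < s" for s
  proof -
    have "(\<lambda>n. exp (- (1 / s) * inverse (real n))) \<longlonglongrightarrow> exp (- (1 / s) * 0)"
      by (intro tendsto_intros lim_inverse_n)
    moreover have "eventually (\<lambda>n. exp (- (1 / s) * inverse (real n)) = flat 1 (real n * s)) sequentially"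
      by (rule eventually_mono[OF eventually_gt_at_top[of 0]]) (use that in \<open>auto simp: flat_def field_simps\<close>)
    ultimately show ?thesis by (simp add: tendsto_cong)
  qed
  then have "(\<lambda>n. bump a b n x) \<longlonglongrightarrow> (\<Prod>i\<in>(Basis::'a set). 1 * 1)"
    unfolding bump_def using True by (intro tendsto_prod tendsto_mult) (auto simp: mem_box)
  then show ?thesis using True by simp
next
  case False
  then have "bump a b n x = 0" for n using bump_support by blast
  then show ?thesis using False by simp
qed

section \<open>Calculus of test functions\<close>

lemma test_functionD:
  assumes "\<phi> \<in> test_functions \<Omega>"
  shows "\<phi> differentiable (at x)" "continuous_on UNIV (\<lambda>x. frechet_derivative \<phi> (at x) v)" "continuous_on UNIV \<phi>"
    "compact (closure {x. \<phi> x \<noteq> 0})" "closure {x. \<phi> x \<noteq> 0} \<subseteq> \<Omega>"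
proof -
  have C: "\<And>k. C_k k \<phi>" and "compact (closure {x. \<phi> x \<noteq> 0})" "closure {x. \<phi> x \<noteq> 0} \<subseteq> \<Omega>"
    using assms by (auto simp: test_functions_def)
  then show "compact (closure {x. \<phi> x \<noteq> 0})" "closure {x. \<phi> x \<noteq> 0} \<subseteq> \<Omega>" by auto
  show "\<phi> differentiable (at x)" "continuous_on UNIV (\<lambda>x. frechet_derivative \<phi> (at x) v)"
    using C[of "Suc 0"] by auto
  show "continuous_on UNIV \<phi>" using C[of 0] by simp
qed

lemma test_function_derivative:
  assumes "\<phi> \<in> test_functions \<Omega>"
  shows "(\<phi> has_derivative frechet_derivative \<phi> (at x)) (at x)"
  using test_functionD(1)[OF assms] by (rule frechet_derivative_at_works)

text \<open>Converts the directional derivatives in the definition of smoothness into inner products with the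
  gradient.\<close>

lemma frechet_eq_inner_grad:
  assumes "\<phi> \<in> test_functions \<Omega>"
  shows "frechet_derivative \<phi> (at x) v = grad \<phi> x \<bullet> v"
proof -
  have l: "linear (frechet_derivative \<phi> (at x))"
    using test_function_derivative[OF assms, of x] has_derivative_linear by blast
  have "frechet_derivative \<phi> (at x) v = frechet_derivative \<phi> (at x) (\<Sum>b\<in>Basis. (v \<bullet> b) *\<^sub>R b)"
    by (simp add: euclidean_representation)
  also have "\<dots> = (\<Sum>b\<in>Basis. (v \<bullet> b) * frechet_derivative \<phi> (at x) b)"
    by (simp add: linear_sum[OF l] linear_scale[OF l])
  also have "\<dots> = grad \<phi> x \<bullet> v"
    unfolding grad_def inner_sum_left by (simp add: inner_commute mult.commute)
  finally show ?thesis .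
qed

lemma continuous_grad:
  assumes "\<phi> \<in> test_functions \<Omega>"
  shows "continuous_on UNIV (grad \<phi>)"
  unfolding grad_def using test_functionD(2)[OF assms] by (auto intro!: continuous_intros)

lemma grad_eq_0_outside:
  assumes "\<phi> \<in> test_functions \<Omega>" "x \<notin> closure {x. \<phi> x \<noteq> 0}"
  shows "grad \<phi> x = 0"
proof -
  have "((\<lambda>x. 0) has_derivative (\<lambda>v. 0)) (at x)" by simp
  then have "(\<phi> has_derivative (\<lambda>v. 0)) (at x)"
    by (rule has_derivative_transform_within_open[of _ _ _ UNIV "- closure {x. \<phi> x \<noteq> 0}"])
       (use assms(2) closure_subset[of "{x. \<phi> x \<noteq> 0}"] in auto)
  then have "frechet_derivative \<phi> (at x) = (\<lambda>v. 0)"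
    by (rule frechet_derivative_at[symmetric])
  then show ?thesis by (simp add: grad_def)
qed

lemma test_function_eq_0:
  assumes "\<phi> \<in> test_functions \<Omega>" "x \<notin> closure {x. \<phi> x \<noteq> 0}"
  shows "\<phi> x = 0"
  using assms(2) closure_subset[of "{x. \<phi> x \<noteq> 0}"] by auto

lemma test_function_outside:
  assumes "\<phi> \<in> test_functions \<Omega>" "x \<notin> \<Omega>"
  shows "\<phi> x = 0" "grad \<phi> x = 0"
proof -
  have "x \<notin> closure {x. \<phi> x \<noteq> 0}" using test_functionD(5)[OF assms(1)] assms(2) by (rule contra_subsetD)
  then show "\<phi> x = 0" "grad \<phi> x = 0"
    by (rule test_function_eq_0[OF assms(1)], rule grad_eq_0_outside[OF assms(1)])
qed

lemma grad_mult:
  assumes "\<phi> \<in> test_functions \<Omega>" "\<psi> \<in> test_functions \<Omega>"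
  shows "grad (\<lambda>x. \<phi> x * \<psi> x) x = \<phi> x *\<^sub>R grad \<psi> x + \<psi> x *\<^sub>R grad \<phi> x"
proof -
  have "((\<lambda>x. \<phi> x * \<psi> x) has_derivative (\<lambda>v. \<phi> x * frechet_derivative \<psi> (at x) v + frechet_derivative \<phi> (at x) v * \<psi> x)) (at x)"
    by (intro has_derivative_mult test_function_derivative[OF assms(1)] test_function_derivative[OF assms(2)])
  from frechet_derivative_at[OF this, symmetric] show ?thesis
    by (simp add: grad_def scaleR_sum_right sum.distrib[symmetric] scaleR_add_left mult.commute)
qed

lemma grad_scale:
  assumes "\<phi> \<in> test_functions \<Omega>"
  shows "grad (\<lambda>x. c * \<phi> x) x = c *\<^sub>R grad \<phi> x"
proof -
  have "((\<lambda>x. c * \<phi> x) has_derivative (\<lambda>v. c * frechet_derivative \<phi> (at x) v)) (at x)"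
    by (intro has_derivative_mult_right test_function_derivative[OF assms(1)])
  from frechet_derivative_at[OF this, symmetric] show ?thesis
    by (simp add: grad_def scaleR_sum_right)
qed

lemma test_functions_mult:
  assumes "\<phi> \<in> test_functions \<Omega>" "\<And>k. C_k k \<psi>"
  shows "(\<lambda>x. \<phi> x * \<psi> x) \<in> test_functions \<Omega>"
proof -
  have 1: "closure {x. \<phi> x * \<psi> x \<noteq> 0} \<subseteq> closure {x. \<phi> x \<noteq> 0}" by (rule closure_mono) auto
  have 2: "bounded (closure {x. \<phi> x \<noteq> 0})"
    using assms(1) by (simp add: test_functions_def compact_eq_bounded_closed)
  have 3: "\<forall>k. C_k k (\<lambda>x. \<phi> x * \<psi> x)"
    using assms by (intro allI C_k_mult) (auto simp: test_functions_def)
  show ?thesis unfolding test_functions_def mem_Collect_eq compact_eq_bounded_closed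
    using 1 3 bounded_subset[OF 2 1] assms(1) by (auto simp: test_functions_def)
qed

lemma test_functions_scale:
  assumes "\<phi> \<in> test_functions \<Omega>"
  shows "(\<lambda>x. c * \<phi> x) \<in> test_functions \<Omega>"
  using test_functions_mult[OF assms C_k_const] by (simp only: mult.commute[of c])

lemma integrable_compact_support:
  fixes f :: "'a::euclidean_space \<Rightarrow> 'b::euclidean_space"
  assumes "continuous_on UNIV f" "compact K" "\<And>x. x \<notin> K \<Longrightarrow> f x = 0"
  shows "integrable lborel f" "integrable lebesgue f" "integral\<^sup>L lebesgue f = integral\<^sup>L lborel f"
proof -
  have "integrable lborel (\<lambda>x. indicator K x *\<^sub>R f x)"
    by (rule borel_integrable_compact[OF assms(2) continuous_on_subset[OF assms(1) subset_UNIV]])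
  also have "(\<lambda>x. indicator K x *\<^sub>R f x) = f" using assms(3) by (auto simp: fun_eq_iff split: split_indicator)
  finally show 1: "integrable lborel f" .
  have m: "f \<in> borel_measurable lborel" using assms(1) by (simp add: borel_measurable_continuous_onI)
  show "integrable lebesgue f" using 1 integrable_completion[OF m] by simp
  show "integral\<^sup>L lebesgue f = integral\<^sup>L lborel f" by (rule integral_completion[OF m])
qed

lemma integral_lebesgue_on_eq:
  fixes f :: "'a::euclidean_space \<Rightarrow> 'b::euclidean_space"
  assumes "open \<Omega>" "\<And>x. x \<notin> \<Omega> \<Longrightarrow> f x = 0"
  shows "integral\<^sup>L (lebesgue_on \<Omega>) f = integral\<^sup>L lebesgue f" "integrable (lebesgue_on \<Omega>) f \<longleftrightarrow> integrable lebesgue f"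
proof -
  have *: "(\<lambda>x. indicator \<Omega> x *\<^sub>R f x) = f" using assms(2) by (auto simp: fun_eq_iff split: split_indicator)
  show "integral\<^sup>L (lebesgue_on \<Omega>) f = integral\<^sup>L lebesgue f" "integrable (lebesgue_on \<Omega>) f \<longleftrightarrow> integrable lebesgue f"
    using assms(1) by (simp_all add: integral_restrict_space integrable_restrict_space *)
qed

text \<open>By translation invariance the difference quotients in direction \<open>b\<close> have integral
  zero. By the mean value theorem they are bounded by the supremum of the derivative on a fixed bounded set,
  so dominated convergence applies.\<close>

lemma integral_directional_derivative_eq_0:
  fixes \<psi> :: "'a::euclidean_space \<Rightarrow> real"
  assumes \<psi>: "\<psi> \<in> test_functions \<Omega>"
  shows "(\<integral>x. frechet_derivative \<psi> (at x) b \<partial>lborel) = 0"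
proof -
  define K where "K = closure {x. \<psi> x \<noteq> 0}"
  define D where "D = (\<lambda>x. frechet_derivative \<psi> (at x) b)"
  define h where "h = (\<lambda>n. inverse (real (Suc n)))"
  define q where "q = (\<lambda>n x. (\<psi> (x + h n *\<^sub>R b) - \<psi> x) / h n)"
  have h: "0 < h n" "h n \<le> 1" for n by (auto simp: h_def inverse_le_1_iff)
  have K: "compact K" using test_functionD(4)[OF \<psi>] by (simp add: K_def)
  have D0: "D x = 0" if "x \<notin> K" for x
    using grad_eq_0_outside[OF \<psi>] that by (simp add: D_def K_def frechet_eq_inner_grad[OF \<psi>])
  have \<psi>0: "\<psi> x = 0" if "x \<notin> K" for x
    by (rule test_function_eq_0[OF \<psi> that[unfolded K_def]])
  have Dc: "continuous_on UNIV D" unfolding D_def by (rule test_functionD(2)[OF \<psi>])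
  obtain M where M: "\<And>x. \<bar>D x\<bar> \<le> M" "0 \<le> M"
  proof -
    have "bounded (D ` K)"
      by (rule compact_imp_bounded[OF compact_continuous_image[OF continuous_on_subset[OF Dc subset_UNIV] K]])
    then obtain M where "\<forall>x\<in>K. \<bar>D x\<bar> \<le> M" by (auto simp: bounded_iff)
    then have "\<bar>D x\<bar> \<le> max M 0" for x using D0[of x] by (cases "x \<in> K") (auto simp: le_max_iff_disj)
    then show ?thesis by (intro that[of "max M 0"]) auto
  qed
  obtain R where R: "\<And>x. x \<in> K \<Longrightarrow> norm x \<le> R"
    using compact_imp_bounded[OF K] by (auto simp: bounded_iff)
  have der: "((\<lambda>s. \<psi> (x + s *\<^sub>R b)) has_real_derivative D (x + s *\<^sub>R b)) (at s)" for x s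
  proof -
    have "((\<lambda>s. x + s *\<^sub>R b) has_derivative (\<lambda>v. v *\<^sub>R b)) (at s)"
      by (auto intro!: derivative_eq_intros)
    from has_derivative_compose[OF this test_function_derivative[OF \<psi>]]
    have "((\<lambda>s. \<psi> (x + s *\<^sub>R b)) has_derivative (\<lambda>v. frechet_derivative \<psi> (at (x + s *\<^sub>R b)) (v *\<^sub>R b))) (at s)" .
    then show ?thesis
      by (simp add: has_field_derivative_def D_def frechet_eq_inner_grad[OF \<psi>] mult.commute[of "_ \<bullet> _"] mult_commute_abs)
  qed
  have qb: "\<bar>q n x\<bar> \<le> M * indicator (cball 0 (R + norm b)) x" for n x
  proof (cases "x \<in> cball 0 (R + norm b)")
    case True
    obtain z where "\<psi> (x + h n *\<^sub>R b) - \<psi> (x + 0 *\<^sub>R b) = (h n - 0) * D (x + z *\<^sub>R b)"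
      using MVT2[of 0 "h n" "\<lambda>s. \<psi> (x + s *\<^sub>R b)" "\<lambda>s. D (x + s *\<^sub>R b)"] der h by blast
    then have "q n x = D (x + z *\<^sub>R b)" using h[of n] by (simp add: q_def)
    then show ?thesis using M True by simp
  next
    case False
    have "x \<notin> K" using False R[of x] norm_ge_zero[of b] by (auto simp: not_le)
    moreover have "x + h n *\<^sub>R b \<notin> K"
    proof
      assume "x + h n *\<^sub>R b \<in> K"
      then have "norm (x + h n *\<^sub>R b) \<le> R" by (rule R)
      moreover have "norm x \<le> norm (x + h n *\<^sub>R b) + norm (h n *\<^sub>R b)"
        using norm_triangle_ineq4[of "x + h n *\<^sub>R b" "h n *\<^sub>R b"] by simp
      moreover have "norm (h n *\<^sub>R b) \<le> norm b" using h[of n] by (simp add: mult_left_le_one_le)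
      ultimately show False using False by simp
    qed
    ultimately show ?thesis
      using \<psi>0[of x] \<psi>0[of "x + h n *\<^sub>R b"] False by (simp add: q_def)
  qed
  have \<psi>m [measurable]: "\<psi> \<in> borel_measurable borel"
    by (rule borel_measurable_continuous_onI[OF test_functionD(3)[OF \<psi>]])
  have \<psi>i: "integrable lborel \<psi>"
    by (rule integrable_compact_support(1)[OF test_functionD(3)[OF \<psi>] K \<psi>0])
  have q0: "(\<integral>x. q n x \<partial>lborel) = 0" for n
  proof -
    have "(\<integral>x. \<psi> (h n *\<^sub>R b + x) \<partial>lborel) = (\<integral>x. \<psi> x \<partial>distr lborel borel ((+) (h n *\<^sub>R b)))"
      by (rule integral_distr[symmetric]) simp_all
    then have 1: "(\<integral>x. \<psi> (x + h n *\<^sub>R b) \<partial>lborel) = (\<integral>x. \<psi> x \<partial>lborel)"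
      by (simp add: lborel_distr_plus add.commute)
    have "integrable (distr lborel borel ((+) (h n *\<^sub>R b))) \<psi>" using \<psi>i by (simp add: lborel_distr_plus)
    then have "integrable lborel (\<lambda>x. \<psi> (x + h n *\<^sub>R b))"
      by (subst (asm) integrable_distr_eq) (simp_all add: add.commute)
    then show ?thesis using 1 \<psi>i by (simp add: q_def)
  qed
  have "(\<lambda>n. \<integral>x. q n x \<partial>lborel) \<longlonglongrightarrow> (\<integral>x. D x \<partial>lborel)"
  proof (rule integral_dominated_convergence[where w = "\<lambda>x. M * indicator (cball 0 (R + norm b)) x"])
    show "D \<in> borel_measurable lborel" using Dc by (simp add: borel_measurable_continuous_onI)
    show "q n \<in> borel_measurable lborel" for n
      unfolding q_def using \<psi>m by measurable
    show "integrable lborel (\<lambda>x. M * indicator (cball 0 (R + norm b)) x)"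
      by (intro integrable_mult_right integrable_real_indicator) (use emeasure_bounded_finite[OF bounded_cball[of 0 "R + norm b"]] in auto)
    show "AE x in lborel. (\<lambda>n. q n x) \<longlonglongrightarrow> D x"
    proof (rule AE_I2)
      fix x
      have "((\<lambda>s. (\<psi> (x + (0 + s) *\<^sub>R b) - \<psi> (x + 0 *\<^sub>R b)) / s) \<longlongrightarrow> D x) (at 0)"
        using der[of x 0] by (simp add: DERIV_def)
      moreover have "filterlim h (at 0) sequentially"
        unfolding filterlim_at
      proof
        show "\<forall>\<^sub>F n in sequentially. h n \<in> UNIV \<and> h n \<noteq> 0"
          by (rule always_eventually) (simp add: h_def)
        show "h \<longlonglongrightarrow> 0" unfolding h_def by (rule LIMSEQ_inverse_real_of_nat)
      qed
      ultimately have "(\<lambda>n. (\<psi> (x + (0 + h n) *\<^sub>R b) - \<psi> (x + 0 *\<^sub>R b)) / h n) \<longlonglongrightarrow> D x"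
        by (rule filterlim_compose)
      then show "(\<lambda>n. q n x) \<longlonglongrightarrow> D x" by (simp add: q_def)
    qed
    show "AE x in lborel. norm (q n x) \<le> M * indicator (cball 0 (R + norm b)) x" for n
      unfolding real_norm_def by (rule AE_I2, rule qb)
  qed
  then have "(\<integral>x. D x \<partial>lborel) = 0"
    unfolding q0 LIMSEQ_const_iff by (rule sym)
  then show ?thesis unfolding D_def .
qed

lemma integral_grad_eq_0:
  assumes \<psi>: "\<psi> \<in> test_functions \<Omega>"
  shows "(\<integral>x. grad \<psi> x \<partial>lborel) = 0"
proof -
  have gi: "integrable lborel (grad \<psi>)"
    by (rule integrable_compact_support(1)[OF continuous_grad[OF \<psi>] test_functionD(4)[OF \<psi>]])
       (rule grad_eq_0_outside[OF \<psi>])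
  show ?thesis
  proof (rule euclidean_eqI)
    fix b :: 'a assume "b \<in> Basis"
    have "(\<integral>x. grad \<psi> x \<partial>lborel) \<bullet> b = (\<integral>x. grad \<psi> x \<bullet> b \<partial>lborel)"
      by (rule integral_inner_left[symmetric]) (rule gi)
    also have "\<dots> = 0"
      using integral_directional_derivative_eq_0[OF \<psi>, of b] by (simp add: frechet_eq_inner_grad[OF \<psi>])
    finally show "(\<integral>x. grad \<psi> x \<partial>lborel) \<bullet> b = 0 \<bullet> b" by simp
  qed
qed

text \<open>Integration by parts: the gradient of the product of two test functions has integral zero.\<close>

lemma test_function_weak_gradient:
  assumes op: "open \<Omega>" and \<psi>: "\<psi> \<in> test_functions \<Omega>"
  shows "has_weak_gradient \<Omega> \<psi> (grad \<psi>)"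
  unfolding has_weak_gradient_def
proof (intro conjI ballI)
  have "continuous_on UNIV f \<Longrightarrow> locally_integrable_on f \<Omega>" for f :: "'a \<Rightarrow> 'c::euclidean_space"
    unfolding locally_integrable_on_def
  proof (intro allI impI)
    fix K assume f: "continuous_on UNIV f" and K: "compact K \<and> K \<subseteq> \<Omega>"
    have i: "integrable lborel (\<lambda>x. indicator K x *\<^sub>R f x)"
      by (rule borel_integrable_compact[OF conjunct1[OF K] continuous_on_subset[OF f subset_UNIV]])
    show "f absolutely_integrable_on K"
      unfolding set_integrable_def
      by (rule integrable_completion[OF borel_measurable_integrable[OF i], THEN iffD2, OF i])
  qed
  then show "locally_integrable_on \<psi> \<Omega>" "locally_integrable_on (grad \<psi>) \<Omega>"
    using test_functionD(3)[OF \<psi>] continuous_grad[OF \<psi>] by auto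
next
  fix \<phi> assume \<phi>: "\<phi> \<in> test_functions \<Omega>"
  have i: "integrable lborel (\<lambda>x. f x *\<^sub>R grad g x)" "(\<integral>x. f x *\<^sub>R grad g x \<partial>lebesgue_on \<Omega>) = (\<integral>x. f x *\<^sub>R grad g x \<partial>lborel)"
    if f: "f \<in> test_functions \<Omega>" and g: "g \<in> test_functions \<Omega>" for f g
  proof -
    have c: "continuous_on UNIV (\<lambda>x. f x *\<^sub>R grad g x)"
      by (intro continuous_intros test_functionD(3)[OF f] continuous_grad[OF g])
    have z: "f x *\<^sub>R grad g x = 0" if "x \<notin> closure {x. f x \<noteq> 0}" for x
      by (simp only: test_function_eq_0[OF f that] scaleR_zero_left)
    note ics = integrable_compact_support[OF c test_functionD(4)[OF f] z]
    show "integrable lborel (\<lambda>x. f x *\<^sub>R grad g x)" by (rule ics(1))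
    have "(\<integral>x. f x *\<^sub>R grad g x \<partial>lebesgue_on \<Omega>) = (\<integral>x. f x *\<^sub>R grad g x \<partial>lebesgue)"
      by (rule integral_lebesgue_on_eq(1)[OF op]) (drule test_function_outside(1)[OF f], simp only: scaleR_zero_left)
    then show "(\<integral>x. f x *\<^sub>R grad g x \<partial>lebesgue_on \<Omega>) = (\<integral>x. f x *\<^sub>R grad g x \<partial>lborel)"
      using ics(3) by (rule trans)
  qed
  have "(\<integral>x. grad (\<lambda>x. \<psi> x * \<phi> x) x \<partial>lborel) = 0"
    by (rule integral_grad_eq_0[OF test_functions_mult[OF \<psi>]]) (use \<phi> in \<open>simp add: test_functions_def\<close>)
  then have "(\<integral>x. \<psi> x *\<^sub>R grad \<phi> x \<partial>lborel) + (\<integral>x. \<phi> x *\<^sub>R grad \<psi> x \<partial>lborel) = 0"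
    by (simp only: grad_mult[OF \<psi> \<phi>] Bochner_Integration.integral_add[OF i(1)[OF \<psi> \<phi>] i(1)[OF \<phi> \<psi>]])
  then show "(\<integral>x. \<psi> x *\<^sub>R grad \<phi> x \<partial>lebesgue_on \<Omega>) = - (\<integral>x. \<phi> x *\<^sub>R grad \<psi> x \<partial>lebesgue_on \<Omega>)"
    by (simp only: i(2)[OF \<psi> \<phi>] i(2)[OF \<phi> \<psi>] eq_neg_iff_add_eq_0)
qed

section \<open>Weak gradients\<close>

text \<open>Boxes form an intersection-stable generator, and the sets on which the integral vanishes form a
  Dynkin system.\<close>

lemma integral_borel_sets_eq_0:
  fixes v :: "'a::euclidean_space \<Rightarrow> real"
  assumes v: "integrable lborel v" and all: "(\<integral>x. v x \<partial>lborel) = 0"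
    and box: "\<And>a b. (\<integral>x. indicator (box a b) x * v x \<partial>lborel) = 0"
    and A: "A \<in> sets borel"
  shows "(\<integral>x. indicator A x * v x \<partial>lborel) = 0"
proof -
  let ?E = "range (\<lambda>(a, b). box a b::'a set)"
  have "Int_stable ?E"
    by (auto simp: Int_stable_def box_Int_box)
  moreover have "?E \<subseteq> Pow UNIV" by simp
  moreover have "A \<in> sigma_sets UNIV ?E"
    using A by (simp add: borel_eq_box)
  ultimately have "A \<in> sets borel \<and> (\<integral>x. indicator A x * v x \<partial>lborel) = 0"
  proof (induction rule: sigma_sets_induct_disjoint)
    case (basic A)
    then show ?case using box by auto
  next
    case empty
    show ?case by simp
  next
    case (compl A)
    have "integrable lborel (\<lambda>x. indicator A x * v x)"
      using compl v integrable_mult_indicator[of A lborel v] by simp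
    then have "(\<integral>x. v x - indicator A x * v x \<partial>lborel) = 0"
      using v all compl by simp
    moreover have "(\<lambda>x. indicator (UNIV - A) x * v x) = (\<lambda>x. v x - indicator A x * v x)"
      by (auto split: split_indicator)
    ultimately have "(\<integral>x. indicator (UNIV - A) x * v x \<partial>lborel) = 0" by (simp only:)
    then show ?case using compl by auto
  next
    case (union A)
    have m: "A i \<in> sets lborel" for i using union by simp
    have i: "set_integrable lborel (\<Union>i. A i) v"
      unfolding set_integrable_def using m by (intro integrable_mult_indicator v) auto
    have "(LINT x:(\<Union>i. A i)|lborel. v x) = (\<Sum>i. (LINT x:(A i)|lborel. v x))"
      using union by (intro lebesgue_integral_countable_add i m) (auto simp: disjoint_family_on_def)
    also have "\<dots> = 0"
      using union by (simp add: set_lebesgue_integral_def)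
    finally show ?case using m by (simp add: set_lebesgue_integral_def)
  qed
  then show ?thesis by simp
qed

text \<open>A Borel version of \<open>v\<close> is used, because boxes generate only the Borel sets.\<close>

lemma AE_zero_of_box_integrals:
  fixes v :: "'a::euclidean_space \<Rightarrow> real"
  assumes v: "integrable lebesgue v" and all: "(\<integral>x. v x \<partial>lebesgue) = 0"
    and box: "\<And>a b. (\<integral>x. indicator (box a b) x * v x \<partial>lebesgue) = 0"
  shows "AE x in lebesgue. v x = 0"
proof -
  obtain v' where v'[measurable]: "v' \<in> borel_measurable lborel" and eq: "AE x in lborel. v x = v' x"
    using completion_ex_borel_measurable_real[OF borel_measurable_integrable[OF v]] by blast
  have eq': "AE x in lebesgue. v x = v' x" by (rule AE_completion[OF eq])
  have vm [measurable]: "v \<in> borel_measurable lebesgue" by (rule borel_measurable_integrable[OF v])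
  have v'm [measurable]: "v' \<in> borel_measurable lebesgue" using v' by (rule measurable_completion)
  have "integrable lebesgue v'"
    by (rule Bochner_Integration.integrable_cong_AE[OF vm v'm eq', THEN iffD1, OF v])
  then have i: "integrable lborel v'"
    by (rule integrable_completion[OF v', THEN iffD1])
  have tr: "(\<integral>x. indicator A x * v' x \<partial>lborel) = (\<integral>x. indicator A x * v x \<partial>lebesgue)" if A: "A \<in> sets borel" for A
  proof -
    have [measurable]: "A \<in> sets lborel" using A by simp
    have [measurable]: "A \<in> sets lebesgue" using A by simp
    have ae: "AE x in lebesgue. indicator A x * v x = indicator A x * v' x"
      using eq' by eventually_elim simp
    have "(\<integral>x. indicator A x * v x \<partial>lebesgue) = (\<integral>x. indicator A x * v' x \<partial>lebesgue)"
      by (rule integral_cong_AE[OF _ _ ae]) measurable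
    also have "\<dots> = (\<integral>x. indicator A x * v' x \<partial>lborel)"
      by (rule integral_completion) measurable
    finally show ?thesis by simp
  qed
  have "AE x in lborel. v' x = 0"
  proof (rule sigma_finite_measure.density_zero[OF lborel.sigma_finite_measure_axioms i])
    fix A :: "'a set" assume "A \<in> sets lborel"
    then have "A \<in> sets borel" by simp
    then have "(\<integral>x. indicator A x * v' x \<partial>lborel) = 0"
      by (rule integral_borel_sets_eq_0[OF i, rotated -1]) (use tr[of UNIV] all tr box in simp_all)
    then show "(LINT x:A|lborel. v' x) = 0" by (simp add: set_lebesgue_integral_def)
  qed
  then have "AE x in lebesgue. v' x = 0" by (rule AE_completion)
  with eq' show ?thesis by eventually_elim simp
qed

text \<open>The indicator of the box is a dominated limit of bumps.\<close>

lemma box_integral_eq_0: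
  fixes w :: "'a::euclidean_space \<Rightarrow> real"
  assumes op: "open \<Omega>" and w: "locally_integrable_on w \<Omega>"
    and test: "\<And>\<phi>. \<phi> \<in> test_functions \<Omega> \<Longrightarrow> (\<integral>x. \<phi> x * w x \<partial>lebesgue_on \<Omega>) = 0"
    and ab: "cbox a b \<subseteq> \<Omega>"
  shows "(\<integral>x. indicator (box a b) x * w x \<partial>lebesgue) = 0"
proof -
  define W where "W = (\<lambda>x. indicator (cbox a b) x * w x)"
  have W: "integrable lebesgue W"
  proof -
    have "w absolutely_integrable_on cbox a b"
      using w ab compact_cbox unfolding locally_integrable_on_def by blast
    then show ?thesis by (simp add: set_integrable_def W_def)
  qed
  have Wm: "W \<in> borel_measurable lebesgue" by (rule borel_measurable_integrable[OF W])
  have bm: "bump a b n \<in> borel_measurable borel" for n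
    using C_k_bump[of 0 a b n] by (simp add: borel_measurable_continuous_onI)
  have bml: "bump a b n \<in> borel_measurable lebesgue" for n
    by (rule measurable_completion) (use bm in simp)
  have z: "(\<integral>x. bump a b n x * W x \<partial>lebesgue) = 0" for n
  proof -
    have t: "bump a b n \<in> test_functions \<Omega>" by (rule bump_test_function[OF ab])
    have eq: "bump a b n x * w x = bump a b n x * W x" for x
      using bump_support[of a b n x] box_subset_cbox[of a b] by (cases "bump a b n x = 0") (auto simp: W_def)
    have "(\<integral>x. bump a b n x * w x \<partial>lebesgue_on \<Omega>) = (\<integral>x. bump a b n x * w x \<partial>lebesgue)"
      by (rule integral_lebesgue_on_eq(1)[OF op]) (drule test_function_outside(1)[OF t], simp)
    then show ?thesis using test[OF t] by (simp add: eq)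
  qed
  have "(\<lambda>n. \<integral>x. bump a b n x * W x \<partial>lebesgue) \<longlonglongrightarrow> (\<integral>x. indicator (box a b) x * W x \<partial>lebesgue)"
  proof (rule integral_dominated_convergence[where w = "\<lambda>x. norm (W x)"])
    show "integrable lebesgue (\<lambda>x. norm (W x))" using W by (rule integrable_norm)
    show "AE x in lebesgue. (\<lambda>n. bump a b n x * W x) \<longlonglongrightarrow> indicator (box a b) x * W x"
      by (intro AE_I2 tendsto_mult bump_tendsto tendsto_const)
    show "AE x in lebesgue. norm (bump a b n x * W x) \<le> norm (W x)" for n
      by (rule AE_I2) (use bump_bounds[of a b n] in \<open>simp add: abs_mult mult_left_le_one_le\<close>)
    have "(indicator (box a b) :: 'a \<Rightarrow> real) \<in> borel_measurable lebesgue"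
      by (rule borel_measurable_indicator) simp
    then show "(\<lambda>x. indicator (box a b) x * W x) \<in> borel_measurable lebesgue"
      by (rule borel_measurable_times[OF _ Wm])
    show "(\<lambda>x. bump a b n x * W x) \<in> borel_measurable lebesgue" for n
      by (rule borel_measurable_times[OF bml Wm])
  qed
  then have "(\<integral>x. indicator (box a b) x * W x \<partial>lebesgue) = 0"
    unfolding z LIMSEQ_const_iff by (rule sym)
  moreover have "(\<lambda>x. indicator (box a b) x * W x) = (\<lambda>x. indicator (box a b) x * w x)"
    using box_subset_cbox[of a b] by (auto simp: W_def fun_eq_iff split: split_indicator)
  ultimately show ?thesis by (simp only:)
qed

text \<open>The fundamental lemma of the calculus of variations. On each closed box inside
  \<open>\<Omega>\<close> all box integrals of \<open>w\<close> vanish, and countably many such boxes cover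
  \<open>\<Omega>\<close>.\<close>

lemma fundamental_lemma:
  fixes w :: "'a::euclidean_space \<Rightarrow> real"
  assumes op: "open \<Omega>" and w: "locally_integrable_on w \<Omega>"
    and test: "\<And>\<phi>. \<phi> \<in> test_functions \<Omega> \<Longrightarrow> (\<integral>x. \<phi> x * w x \<partial>lebesgue_on \<Omega>) = 0"
  shows "AE x in lebesgue. x \<in> \<Omega> \<longrightarrow> w x = 0"
proof -
  have loc: "AE x in lebesgue. x \<in> cbox c d \<longrightarrow> w x = 0" if cd: "cbox c d \<subseteq> \<Omega>" for c d
  proof -
    define v where "v = (\<lambda>x. indicator (box c d) x * w x)"
    have zero: "(\<integral>x. indicator (box a b) x * v x \<partial>lebesgue) = 0" for a b
    proof -
      obtain e f where ef: "box a b \<inter> box c d = box e f" using box_Int_box[of a b c d] by simp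
      have eq: "(\<lambda>x. indicator (box a b) x * v x) = (\<lambda>x. indicator (box e f) x * w x)"
        unfolding ef[symmetric] v_def by (auto simp: fun_eq_iff split: split_indicator)
      show ?thesis
      proof (cases "box e f = {}")
        case False
        have "closure (box e f) \<subseteq> closure (cbox c d)"
          using ef box_subset_cbox[of c d] by (intro closure_mono) auto
        then have "cbox e f \<subseteq> \<Omega>" using cd closure_box[OF False] by auto
        from box_integral_eq_0[OF op w test this] show ?thesis unfolding eq .
      qed (simp add: eq)
    qed
    have vi: "integrable lebesgue v"
    proof -
      have "w absolutely_integrable_on cbox c d"
        using w cd compact_cbox unfolding locally_integrable_on_def by blast
      then have "w absolutely_integrable_on box c d"
        by (rule set_integrable_subset) (auto simp: box_subset_cbox)
      then show ?thesis by (simp add: set_integrable_def v_def)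
    qed
    have "(\<lambda>x. indicator (box c d) x * v x) = v" by (auto simp: v_def fun_eq_iff split: split_indicator)
    then have "AE x in lebesgue. v x = 0"
      using AE_zero_of_box_integrals[OF vi _ zero] zero[of c d] by simp
    moreover have "AE x in lebesgue. x \<notin> cbox c d - box c d"
      using negligible_frontier_interval[of c d] by (intro AE_not_in) (simp add: negligible_iff_null_sets)
    ultimately show ?thesis
      by eventually_elim (auto simp: v_def)
  qed
  obtain \<D> where \<D>: "countable \<D>" "\<D> \<subseteq> Pow \<Omega>" "\<And>X. X \<in> \<D> \<Longrightarrow> \<exists>a b. X = cbox a b" "\<Union>\<D> = \<Omega>"
    using open_countable_Union_open_cbox[OF op] by metis
  have "AE x in lebesgue. \<forall>X\<in>\<D>. x \<in> X \<longrightarrow> w x = 0"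
    unfolding AE_ball_countable[OF \<D>(1)]
  proof
    fix X assume "X \<in> \<D>"
    then obtain a b where "X = cbox a b" "cbox a b \<subseteq> \<Omega>" using \<D>(2,3) by blast
    then show "AE x in lebesgue. x \<in> X \<longrightarrow> w x = 0" using loc by simp
  qed
  then show ?thesis by eventually_elim (use \<D>(4) in blast)
qed

lemma integrable_continuous_times_locally_integrable:
  fixes c :: "'a::euclidean_space \<Rightarrow> real" and h :: "'a \<Rightarrow> 'b::euclidean_space"
  assumes op: "open \<Omega>" and c: "continuous_on UNIV c" and K: "compact K" "K \<subseteq> \<Omega>" and z: "\<And>x. x \<notin> K \<Longrightarrow> c x = 0"
    and h: "locally_integrable_on h \<Omega>"
  shows "integrable (lebesgue_on \<Omega>) (\<lambda>x. c x *\<^sub>R h x)"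
proof -
  have out: "c x *\<^sub>R h x = 0" if "x \<notin> \<Omega>" for x
    using z[of x] that K(2) by auto
  have hK: "integrable lebesgue (\<lambda>x. indicator K x *\<^sub>R h x)"
    using h K unfolding locally_integrable_on_def set_integrable_def by blast
  have "bounded (c ` K)"
    by (rule compact_imp_bounded[OF compact_continuous_image[OF continuous_on_subset[OF c subset_UNIV] K(1)]])
  then obtain M where M: "\<And>x. x \<in> K \<Longrightarrow> \<bar>c x\<bar> \<le> M" by (auto simp: bounded_iff)
  have [measurable]: "c \<in> borel_measurable lebesgue"
    by (rule measurable_completion) (use c borel_measurable_continuous_onI in auto)
  have "integrable lebesgue (\<lambda>x. c x *\<^sub>R (indicator K x *\<^sub>R h x))"
  proof (rule Bochner_Integration.integrable_bound)
    show "integrable lebesgue (\<lambda>x. M *\<^sub>R (indicator K x *\<^sub>R h x))"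
      by (rule integrable_scaleR_right[OF hK])
    show "(\<lambda>x. c x *\<^sub>R (indicator K x *\<^sub>R h x)) \<in> borel_measurable lebesgue"
      using borel_measurable_integrable[OF hK] by measurable
    show "AE x in lebesgue. norm (c x *\<^sub>R (indicator K x *\<^sub>R h x)) \<le> norm (M *\<^sub>R (indicator K x *\<^sub>R h x))"
    proof (rule AE_I2)
      fix x show "norm (c x *\<^sub>R (indicator K x *\<^sub>R h x)) \<le> norm (M *\<^sub>R (indicator K x *\<^sub>R h x))"
        using M[of x] by (cases "x \<in> K") (auto intro!: mult_right_mono)
    qed
  qed
  also have "(\<lambda>x. c x *\<^sub>R (indicator K x *\<^sub>R h x)) = (\<lambda>x. c x *\<^sub>R h x)"
  proof
    fix x show "c x *\<^sub>R (indicator K x *\<^sub>R h x) = c x *\<^sub>R h x"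
      using z[of x] by (cases "x \<in> K") auto
  qed
  finally have "integrable lebesgue (\<lambda>x. c x *\<^sub>R h x)" .
  then show ?thesis
    using integral_lebesgue_on_eq(2)[OF op, of "\<lambda>x. c x *\<^sub>R h x", OF out] by blast
qed

lemma integrable_test_function_times:
  fixes h :: "'a::euclidean_space \<Rightarrow> 'b::euclidean_space"
  assumes op: "open \<Omega>" and \<phi>: "\<phi> \<in> test_functions \<Omega>" and h: "locally_integrable_on h \<Omega>"
  shows "integrable (lebesgue_on \<Omega>) (\<lambda>x. \<phi> x *\<^sub>R h x)"
  by (rule integrable_continuous_times_locally_integrable[OF op test_functionD(3,4,5)[OF \<phi>] test_function_eq_0[OF \<phi>] h])

lemma integrable_times_grad_test_function:
  fixes u :: "'a::euclidean_space \<Rightarrow> real"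
  assumes op: "open \<Omega>" and \<phi>: "\<phi> \<in> test_functions \<Omega>" and u: "locally_integrable_on u \<Omega>"
  shows "integrable (lebesgue_on \<Omega>) (\<lambda>x. u x *\<^sub>R grad \<phi> x)"
proof -
  have "integrable (lebesgue_on \<Omega>) (\<lambda>x. \<Sum>b\<in>Basis. ((grad \<phi> x \<bullet> b) *\<^sub>R u x) *\<^sub>R b)"
  proof (intro Bochner_Integration.integrable_sum integrable_scaleR_left)
    fix b :: 'a assume "b \<in> Basis"
    show "integrable (lebesgue_on \<Omega>) (\<lambda>x. (grad \<phi> x \<bullet> b) *\<^sub>R u x)"
    proof (rule integrable_continuous_times_locally_integrable[OF op _ test_functionD(4,5)[OF \<phi>] _ u])
      show "continuous_on UNIV (\<lambda>x. grad \<phi> x \<bullet> b)" by (intro continuous_intros continuous_grad[OF \<phi>])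
      show "grad \<phi> x \<bullet> b = 0" if "x \<notin> closure {x. \<phi> x \<noteq> 0}" for x
        unfolding grad_eq_0_outside[OF \<phi> that] by simp
    qed
  qed
  moreover have "(\<Sum>b\<in>Basis. ((grad \<phi> x \<bullet> b) *\<^sub>R u x) *\<^sub>R b) = u x *\<^sub>R grad \<phi> x" for x
  proof -
    have "(\<Sum>b\<in>Basis. ((grad \<phi> x \<bullet> b) *\<^sub>R u x) *\<^sub>R b) = u x *\<^sub>R (\<Sum>b\<in>Basis. (grad \<phi> x \<bullet> b) *\<^sub>R b)"
      by (simp add: scaleR_sum_right mult.commute)
    then show ?thesis by (simp only: euclidean_representation)
  qed
  ultimately show ?thesis by simp
qed

text \<open>Componentwise application of the fundamental lemma; this makes the choice of representative in
  \<open>weak_grad\<close> harmless.\<close>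

lemma weak_gradient_unique:
  fixes g1 g2 :: "'a::euclidean_space \<Rightarrow> 'a"
  assumes op: "open \<Omega>" and g: "has_weak_gradient \<Omega> u g1" "has_weak_gradient \<Omega> u g2"
  shows "AE x in lebesgue_on \<Omega>. g1 x = g2 x"
proof -
  have comp: "AE x in lebesgue. x \<in> \<Omega> \<longrightarrow> (g1 x - g2 x) \<bullet> b = 0" if b: "b \<in> Basis" for b
  proof (rule fundamental_lemma[OF op])
    have l: "locally_integrable_on g1 \<Omega>" "locally_integrable_on g2 \<Omega>"
      using g by (auto simp: has_weak_gradient_def)
    show "locally_integrable_on (\<lambda>x. (g1 x - g2 x) \<bullet> b) \<Omega>"
      unfolding locally_integrable_on_def
    proof (intro allI impI)
      fix K assume "compact K \<and> K \<subseteq> \<Omega>"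
      then have "g1 absolutely_integrable_on K" "g2 absolutely_integrable_on K"
        using l unfolding locally_integrable_on_def by auto
      then show "(\<lambda>x. (g1 x - g2 x) \<bullet> b) absolutely_integrable_on K"
        by (intro absolutely_integrable_component set_integral_diff(1))
    qed
    fix \<phi> assume \<phi>: "\<phi> \<in> test_functions \<Omega>"
    note i = integrable_test_function_times[OF op \<phi>]
    have "(\<integral>x. \<phi> x *\<^sub>R g1 x \<partial>lebesgue_on \<Omega>) = (\<integral>x. \<phi> x *\<^sub>R g2 x \<partial>lebesgue_on \<Omega>)"
      using g \<phi> unfolding has_weak_gradient_def by (metis neg_equal_iff_equal)
    then have "(\<integral>x. \<phi> x *\<^sub>R g1 x - \<phi> x *\<^sub>R g2 x \<partial>lebesgue_on \<Omega>) = 0"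
      by (simp only: Bochner_Integration.integral_diff[OF i[OF l(1)] i[OF l(2)]] diff_self)
    then have "(\<integral>x. (\<phi> x *\<^sub>R g1 x - \<phi> x *\<^sub>R g2 x) \<bullet> b \<partial>lebesgue_on \<Omega>) = 0"
      by (subst integral_inner_left) (auto intro!: Bochner_Integration.integrable_diff i l)
    then show "(\<integral>x. \<phi> x * ((g1 x - g2 x) \<bullet> b) \<partial>lebesgue_on \<Omega>) = 0"
      by (simp only: inner_diff_left inner_scaleR_left right_diff_distrib)
  qed
  have "AE x in lebesgue. \<forall>b\<in>Basis. x \<in> \<Omega> \<longrightarrow> (g1 x - g2 x) \<bullet> b = 0"
    unfolding AE_ball_countable[OF countable_finite[OF finite_Basis]] using comp by (rule ballI)
  then have "AE x in lebesgue. x \<in> \<Omega> \<longrightarrow> g1 x = g2 x"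
    by eventually_elim (auto intro: euclidean_eqI simp: inner_diff_left)
  then show ?thesis using op by (simp add: AE_restrict_space_iff)
qed

lemma has_weak_gradient_weak_grad:
  "has_weak_gradient \<Omega> u g \<Longrightarrow> has_weak_gradient \<Omega> u (weak_grad \<Omega> u)"
  unfolding weak_grad_def by (rule someI[of "has_weak_gradient \<Omega> u"])

lemma weak_grad_AE_eq:
  assumes "open \<Omega>" "has_weak_gradient \<Omega> u g"
  shows "AE x in lebesgue_on \<Omega>. weak_grad \<Omega> u x = g x"
  by (rule weak_gradient_unique[OF assms(1) has_weak_gradient_weak_grad[OF assms(2)] assms(2)])

text \<open>Lebesgue measure is complete, so measurability passes from one representative of the weak gradient
  to the arbitrarily chosen one.\<close>

lemma measurable_lebesgue_on_AE:
  fixes f g :: "'a::euclidean_space \<Rightarrow> 'b::euclidean_space"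
  assumes "open \<Omega>" "f \<in> borel_measurable (lebesgue_on \<Omega>)" "AE x in lebesgue_on \<Omega>. g x = f x"
  shows "g \<in> borel_measurable (lebesgue_on \<Omega>)"
proof -
  have 1: "(\<lambda>x. indicator \<Omega> x *\<^sub>R f x) \<in> borel_measurable lebesgue"
    using assms(1,2) by (simp add: borel_measurable_restrict_space_iff)
  have "AE x in lebesgue. x \<in> \<Omega> \<longrightarrow> g x = f x"
    using assms(1,3) by (simp add: AE_restrict_space_iff)
  then have "AE x in lebesgue. indicator \<Omega> x *\<^sub>R f x = indicator \<Omega> x *\<^sub>R g x"
    by eventually_elim (auto split: split_indicator)
  from borel_measurable_AE[OF 1 this] show ?thesis
    using assms(1) by (simp add: borel_measurable_restrict_space_iff)
qed

lemma dirichlet_eq: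
  assumes op: "open \<Omega>" and g: "has_weak_gradient \<Omega> u g" "g \<in> L2 \<Omega>"
  shows "dirichlet \<Omega> u = (\<integral>x. (norm (g x))\<^sup>2 \<partial>lebesgue_on \<Omega>)" "weak_grad \<Omega> u \<in> L2 \<Omega>"
proof -
  note ae = weak_grad_AE_eq[OF op g(1)]
  have gm [measurable]: "g \<in> borel_measurable (lebesgue_on \<Omega>)" using g(2) by (simp add: L2_def)
  have wm [measurable]: "weak_grad \<Omega> u \<in> borel_measurable (lebesgue_on \<Omega>)"
    by (rule measurable_lebesgue_on_AE[OF op gm ae])
  have ae2: "AE x in lebesgue_on \<Omega>. (norm (weak_grad \<Omega> u x))\<^sup>2 = (norm (g x))\<^sup>2"
    using ae by eventually_elim simp
  show "dirichlet \<Omega> u = (\<integral>x. (norm (g x))\<^sup>2 \<partial>lebesgue_on \<Omega>)"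
    unfolding dirichlet_def by (rule integral_cong_AE[OF _ _ ae2]) measurable
  have "integrable (lebesgue_on \<Omega>) (\<lambda>x. (norm (g x))\<^sup>2)" using g(2) by (simp add: L2_def)
  then have "integrable (lebesgue_on \<Omega>) (\<lambda>x. (norm (weak_grad \<Omega> u x))\<^sup>2)"
    by (rule Bochner_Integration.integrable_cong_AE[OF _ _ ae2, THEN iffD2, rotated -1]) measurable
  then show "weak_grad \<Omega> u \<in> L2 \<Omega>" using wm by (simp add: L2_def)
qed

lemma continuous_compact_support_L2:
  fixes f :: "'a::euclidean_space \<Rightarrow> 'b::euclidean_space"
  assumes op: "open \<Omega>" and f: "continuous_on UNIV f" "compact K" "\<And>x. x \<notin> K \<Longrightarrow> f x = 0" and K: "K \<subseteq> \<Omega>"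
  shows "f \<in> L2 \<Omega>" "integrable lborel (\<lambda>x. (norm (f x))\<^sup>2)"
    "(\<integral>x. (norm (f x))\<^sup>2 \<partial>lebesgue_on \<Omega>) = (\<integral>x. (norm (f x))\<^sup>2 \<partial>lborel)"
proof -
  have c: "continuous_on UNIV (\<lambda>x. (norm (f x))\<^sup>2)" by (intro continuous_intros f(1))
  have z: "(norm (f x))\<^sup>2 = 0" if "x \<notin> K" for x using f(3)[OF that] by simp
  have z': "(norm (f x))\<^sup>2 = 0" if "x \<notin> \<Omega>" for x using z[of x] that K by blast
  note i = integrable_compact_support[OF c f(2) z]
  show "integrable lborel (\<lambda>x. (norm (f x))\<^sup>2)" by (rule i(1))
  show "(\<integral>x. (norm (f x))\<^sup>2 \<partial>lebesgue_on \<Omega>) = (\<integral>x. (norm (f x))\<^sup>2 \<partial>lborel)"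
    using integral_lebesgue_on_eq(1)[OF op z'] i(3) by (rule trans)
  have "integrable (lebesgue_on \<Omega>) (\<lambda>x. (norm (f x))\<^sup>2)"
    by (rule integral_lebesgue_on_eq(2)[OF op z', THEN iffD2, OF _ i(2)])
  moreover have "f \<in> borel_measurable (lebesgue_on \<Omega>)"
    by (intro measurable_restrict_space1 measurable_completion) (simp add: borel_measurable_continuous_onI f(1))
  ultimately show "f \<in> L2 \<Omega>" by (simp add: L2_def)
qed

lemma test_function_L2:
  assumes op: "open \<Omega>" and \<phi>: "\<phi> \<in> test_functions \<Omega>"
  shows "\<phi> \<in> L2 \<Omega>" "integrable lborel (\<lambda>x. (\<phi> x)\<^sup>2)" "(\<integral>x. (\<phi> x)\<^sup>2 \<partial>lebesgue_on \<Omega>) = (\<integral>x. (\<phi> x)\<^sup>2 \<partial>lborel)"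
    "grad \<phi> \<in> L2 \<Omega>" "integrable lborel (\<lambda>x. (norm (grad \<phi> x))\<^sup>2)"
    "(\<integral>x. (norm (grad \<phi> x))\<^sup>2 \<partial>lebesgue_on \<Omega>) = (\<integral>x. (norm (grad \<phi> x))\<^sup>2 \<partial>lborel)"
proof -
  have z: "\<phi> x = 0" "grad \<phi> x = 0" if "x \<notin> closure {x. \<phi> x \<noteq> 0}" for x
    by (rule test_function_eq_0[OF \<phi> that], rule grad_eq_0_outside[OF \<phi> that])
  note A = continuous_compact_support_L2[OF op test_functionD(3,4)[OF \<phi>] z(1) test_functionD(5)[OF \<phi>]]
  note B = continuous_compact_support_L2[OF op continuous_grad[OF \<phi>] test_functionD(4)[OF \<phi>] z(2) test_functionD(5)[OF \<phi>]]
  show "\<phi> \<in> L2 \<Omega>" by (rule A(1))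
  show "integrable lborel (\<lambda>x. (\<phi> x)\<^sup>2)" by (rule A(2)[unfolded real_norm_def power2_abs])
  show "(\<integral>x. (\<phi> x)\<^sup>2 \<partial>lebesgue_on \<Omega>) = (\<integral>x. (\<phi> x)\<^sup>2 \<partial>lborel)" by (rule A(3)[unfolded real_norm_def power2_abs])
  show "grad \<phi> \<in> L2 \<Omega>" by (rule B(1))
  show "integrable lborel (\<lambda>x. (norm (grad \<phi> x))\<^sup>2)" by (rule B(2))
  show "(\<integral>x. (norm (grad \<phi> x))\<^sup>2 \<partial>lebesgue_on \<Omega>) = (\<integral>x. (norm (grad \<phi> x))\<^sup>2 \<partial>lborel)" by (rule B(3))
qed

lemma dirichlet_test_function:
  assumes op: "open \<Omega>" and \<phi>: "\<phi> \<in> test_functions \<Omega>"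
  shows "dirichlet \<Omega> \<phi> = (\<integral>x. (norm (grad \<phi> x))\<^sup>2 \<partial>lborel)"
  using dirichlet_eq(1)[OF op test_function_weak_gradient[OF op \<phi>] test_function_L2(4)[OF op \<phi>]]
    test_function_L2(6)[OF op \<phi>] by simp

lemma has_weak_gradient_diff:
  fixes u v :: "'a::euclidean_space \<Rightarrow> real"
  assumes op: "open \<Omega>" and u: "has_weak_gradient \<Omega> u g" and v: "has_weak_gradient \<Omega> v h"
  shows "has_weak_gradient \<Omega> (\<lambda>x. u x - v x) (\<lambda>x. g x - h x)"
proof -
  have loc: "locally_integrable_on u \<Omega>" "locally_integrable_on v \<Omega>" "locally_integrable_on g \<Omega>" "locally_integrable_on h \<Omega>"
    using u v by (auto simp: has_weak_gradient_def)
  show ?thesis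
    unfolding has_weak_gradient_def
  proof (intro conjI ballI)
    show "locally_integrable_on (\<lambda>x. u x - v x) \<Omega>" "locally_integrable_on (\<lambda>x. g x - h x) \<Omega>"
      using loc unfolding locally_integrable_on_def by (auto intro!: set_integral_diff(1))
    fix \<phi> assume \<phi>: "\<phi> \<in> test_functions \<Omega>"
    note iu = integrable_times_grad_test_function[OF op \<phi> loc(1)]
    note iv = integrable_times_grad_test_function[OF op \<phi> loc(2)]
    note ig = integrable_test_function_times[OF op \<phi> loc(3)]
    note ih = integrable_test_function_times[OF op \<phi> loc(4)]
    have "(\<integral>x. (u x - v x) *\<^sub>R grad \<phi> x \<partial>lebesgue_on \<Omega>) = (\<integral>x. u x *\<^sub>R grad \<phi> x \<partial>lebesgue_on \<Omega>) - (\<integral>x. v x *\<^sub>R grad \<phi> x \<partial>lebesgue_on \<Omega>)"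
      unfolding scaleR_diff_left by (rule Bochner_Integration.integral_diff[OF iu iv])
    also have "\<dots> = - (\<integral>x. \<phi> x *\<^sub>R g x \<partial>lebesgue_on \<Omega>) - - (\<integral>x. \<phi> x *\<^sub>R h x \<partial>lebesgue_on \<Omega>)"
    proof -
      have "(\<integral>x. u x *\<^sub>R grad \<phi> x \<partial>lebesgue_on \<Omega>) = - (\<integral>x. \<phi> x *\<^sub>R g x \<partial>lebesgue_on \<Omega>)"
        "(\<integral>x. v x *\<^sub>R grad \<phi> x \<partial>lebesgue_on \<Omega>) = - (\<integral>x. \<phi> x *\<^sub>R h x \<partial>lebesgue_on \<Omega>)"
        using u v \<phi> unfolding has_weak_gradient_def by blast+
      then show ?thesis by (simp only:)
    qed
    also have "\<dots> = - (\<integral>x. \<phi> x *\<^sub>R (g x - h x) \<partial>lebesgue_on \<Omega>)"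
      unfolding scaleR_diff_right Bochner_Integration.integral_diff[OF ig ih] by simp
    finally show "(\<integral>x. (u x - v x) *\<^sub>R grad \<phi> x \<partial>lebesgue_on \<Omega>) = - (\<integral>x. \<phi> x *\<^sub>R (g x - h x) \<partial>lebesgue_on \<Omega>)" .
  qed
qed

text \<open>A weighted triangle inequality for squares, used in place of the triangle inequality in
  \<open>L\<^sup>2\<close>.\<close>

lemma norm_diff_square_le:
  fixes a b :: "'a::real_inner"
  assumes "0 < \<epsilon>"
  shows "(norm (a - b))\<^sup>2 \<le> (1 + \<epsilon>) * (norm a)\<^sup>2 + (1 + 1 / \<epsilon>) * (norm b)\<^sup>2"
proof -
  have "(norm (a - b))\<^sup>2 \<le> (norm a + norm b)\<^sup>2"
    by (intro power_mono norm_triangle_ineq4) simp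
  also have "\<dots> = (norm a)\<^sup>2 + 2 * (norm a * norm b) + (norm b)\<^sup>2"
    by (simp add: power2_eq_square algebra_simps)
  also have "2 * (norm a * norm b) \<le> \<epsilon> * (norm a)\<^sup>2 + (norm b)\<^sup>2 / \<epsilon>"
  proof -
    have "0 \<le> (\<epsilon> * norm a - norm b)\<^sup>2 / \<epsilon>" using assms by simp
    also have "\<dots> = \<epsilon> * (norm a)\<^sup>2 - 2 * (norm a * norm b) + (norm b)\<^sup>2 / \<epsilon>"
      using assms by (simp add: power2_eq_square field_simps)
    finally show ?thesis by simp
  qed
  finally show ?thesis by (simp add: algebra_simps)
qed

lemma L2_diff:
  fixes f g :: "'a::euclidean_space \<Rightarrow> 'b::euclidean_space"
  assumes "f \<in> L2 \<Omega>" "g \<in> L2 \<Omega>"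
  shows "(\<lambda>x. f x - g x) \<in> L2 \<Omega>"
proof -
  have [measurable]: "f \<in> borel_measurable (lebesgue_on \<Omega>)" "g \<in> borel_measurable (lebesgue_on \<Omega>)"
    using assms by (auto simp: L2_def)
  have "integrable (lebesgue_on \<Omega>) (\<lambda>x. (norm (f x - g x))\<^sup>2)"
  proof (rule Bochner_Integration.integrable_bound)
    show "integrable (lebesgue_on \<Omega>) (\<lambda>x. 2 * (norm (f x))\<^sup>2 + 2 * (norm (g x))\<^sup>2)"
      using assms by (simp add: L2_def)
    show "AE x in lebesgue_on \<Omega>. norm ((norm (f x - g x))\<^sup>2) \<le> norm (2 * (norm (f x))\<^sup>2 + 2 * (norm (g x))\<^sup>2)"
      by (rule AE_I2) (use norm_diff_square_le[of 1] in simp)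
  qed measurable
  then show ?thesis by (simp add: L2_def)
qed

lemma test_function_in_H1_0:
  fixes u :: "'a::euclidean_space \<Rightarrow> real"
  assumes op: "open \<Omega>" and u: "u \<in> test_functions \<Omega>"
  shows "u \<in> H1_0 \<Omega>"
proof -
  have z: "(\<lambda>x. 0) \<in> test_functions \<Omega>"
    using test_functions_scale[OF u, of 0] by simp
  have "grad (\<lambda>x. 0::real) x = (0::'a)" for x
    using grad_scale[OF u, of 0 x] by simp
  then have "dirichlet \<Omega> (\<lambda>x. 0) = 0"
    using dirichlet_test_function[OF op z] by simp
  then have self: "H1_norm \<Omega> (\<lambda>x. u x - u x) = 0" by (simp add: H1_norm_def)
  have uH: "u \<in> H1 \<Omega>"
    using test_function_L2(1)[OF op u] test_function_weak_gradient[OF op u]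
      dirichlet_eq(2)[OF op test_function_weak_gradient[OF op u] test_function_L2(4)[OF op u]]
    by (auto simp: H1_def)
  show ?thesis
    unfolding H1_0_def mem_Collect_eq
  proof (intro conjI allI impI uH)
    fix \<epsilon> :: real assume "0 < \<epsilon>"
    then show "\<exists>\<phi>\<in>test_functions \<Omega>. H1_norm \<Omega> (\<lambda>x. u x - \<phi> x) < \<epsilon>"
      by (intro bexI[OF _ u]) (simp only: self)
  qed
qed

section \<open>Test functions along rays and circles\<close>

lemma measurable_test_function:
  fixes u :: "'a::euclidean_space \<Rightarrow> real"
  assumes "u \<in> test_functions \<Omega>"
  shows "u \<in> borel_measurable borel"
  by (rule borel_measurable_continuous_onI[OF test_functionD(3)[OF assms]])

lemma measurable_grad_test_function:
  fixes u :: "'a::euclidean_space \<Rightarrow> real"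
  assumes "u \<in> test_functions \<Omega>"
  shows "grad u \<in> borel_measurable borel"
  by (rule borel_measurable_continuous_onI[OF continuous_grad[OF assms]])

lemma derivative_along_curve:
  fixes u :: "'a::euclidean_space \<Rightarrow> real" and \<gamma> :: "real \<Rightarrow> 'a"
  assumes u: "u \<in> test_functions \<Omega>" and \<gamma>: "(\<gamma> has_vector_derivative \<gamma>') (at t)"
  shows "((\<lambda>t. u (\<gamma> t)) has_real_derivative (grad u (\<gamma> t) \<bullet> \<gamma>')) (at t)"
proof -
  have "((\<lambda>t. u (\<gamma> t)) has_derivative (\<lambda>h. frechet_derivative u (at (\<gamma> t)) (h *\<^sub>R \<gamma>'))) (at t)"
    by (rule has_derivative_compose[OF \<gamma>[unfolded has_vector_derivative_def] test_function_derivative[OF u]])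
  moreover have "(\<lambda>h. frechet_derivative u (at (\<gamma> t)) (h *\<^sub>R \<gamma>')) = (*) (grad u (\<gamma> t) \<bullet> \<gamma>')"
    by (simp add: fun_eq_iff frechet_eq_inner_grad[OF u] mult.commute)
  ultimately show ?thesis by (simp only: has_field_derivative_def)
qed

text \<open>Along each ray from \<open>x\<close> the function drops from \<open>u x\<close> to zero, so the
  drop to the level \<open>A\<close> is paid for by the gradient on \<open>{u > A}\<close>. Averaging over the
  directions and returning to Cartesian coordinates turns \<open>dr d\<theta>\<close> into the kernel \<open>1
  / |x - y|\<close>.\<close>

lemma ray_representation_pos:
  fixes u :: "real^2 \<Rightarrow> real"
  assumes u: "u \<in> test_functions \<Omega>" and A: "0 \<le> A" "A < u x"
  shows "ennreal (2 * pi * (u x - A)) \<le> riesz (\<lambda>y. ennreal (norm (grad u y)) * indicator {y. A < u y} y) x"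
proof -
  have [measurable]: "u \<in> borel_measurable borel" "grad u \<in> borel_measurable borel"
    by (rule measurable_test_function[OF u], rule measurable_grad_test_function[OF u])
  define G where "G = (\<lambda>y. ennreal (norm (grad u y)) * indicator {y. A < u y} y)"
  have [measurable]: "G \<in> borel_measurable borel" unfolding G_def by measurable
  obtain B where B: "\<And>y. y \<in> closure {y. u y \<noteq> 0} \<Longrightarrow> norm y \<le> B"
    using compact_imp_bounded[OF test_functionD(4)[OF u]] unfolding bounded_iff by blast
  define R where "R = \<bar>B\<bar> + norm x + 1"
  have R: "0 < R" by (simp add: R_def add_nonneg_pos)
  have ray: "ennreal (u x - A) \<le> (\<integral>\<^sup>+ r\<in>{0<..}. G (x + r *\<^sub>R dir \<theta>) \<partial>lborel)" for \<theta>
  proof -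
    have "u (x + R *\<^sub>R dir \<theta>) = 0"
    proof (rule test_function_eq_0[OF u])
      have "R \<le> norm (x + R *\<^sub>R dir \<theta>) + norm x"
        using norm_triangle_ineq4[of "x + R *\<^sub>R dir \<theta>" x] R by simp
      then show "x + R *\<^sub>R dir \<theta> \<notin> closure {y. u y \<noteq> 0}"
        using B[of "x + R *\<^sub>R dir \<theta>"] by (auto simp: R_def)
    qed
    then have "ennreal (u x - A) \<le> (\<integral>\<^sup>+ r\<in>{0<..<R}. ennreal \<bar>grad u (x + r *\<^sub>R dir \<theta>) \<bullet> dir \<theta>\<bar> * indicator {A<..<u x} (u (x + r *\<^sub>R dir \<theta>)) \<partial>lborel)"
      using A R
      by (intro crossing_down) (auto intro!: derivative_along_curve[OF u] derivative_eq_intros continuous_intros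
          continuous_on_compose2[OF continuous_grad[OF u]])
    also have "\<dots> \<le> (\<integral>\<^sup>+ r\<in>{0<..}. G (x + r *\<^sub>R dir \<theta>) \<partial>lborel)"
    proof (rule nn_integral_mono)
      fix r
      have "\<bar>grad u (x + r *\<^sub>R dir \<theta>) \<bullet> dir \<theta>\<bar> \<le> norm (grad u (x + r *\<^sub>R dir \<theta>))"
        using Cauchy_Schwarz_ineq2[of "grad u (x + r *\<^sub>R dir \<theta>)" "dir \<theta>"] by simp
      then show "ennreal \<bar>grad u (x + r *\<^sub>R dir \<theta>) \<bullet> dir \<theta>\<bar> * indicator {A<..<u x} (u (x + r *\<^sub>R dir \<theta>)) * indicator {0<..<R} r
          \<le> G (x + r *\<^sub>R dir \<theta>) * indicator {0<..} r"
        by (auto simp: G_def intro: ennreal_leI split: split_indicator)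
    qed
    finally show ?thesis .
  qed
  have "ennreal (2 * pi * (u x - A)) = (\<integral>\<^sup>+ \<theta>. ennreal (u x - A) * indicator {0<..<2*pi} \<theta> \<partial>lborel)"
    using A by (simp add: nn_integral_cmult_indicator ennreal_mult mult.commute)
  also have "\<dots> \<le> (\<integral>\<^sup>+ \<theta>. (\<integral>\<^sup>+ r\<in>{0<..}. G (x + r *\<^sub>R dir \<theta>) \<partial>lborel) * indicator {0<..<2*pi} \<theta> \<partial>lborel)"
    by (intro nn_integral_mono mult_right_mono ray) simp
  also have "\<dots> = (\<integral>\<^sup>+ \<theta>. \<integral>\<^sup>+ r. G (x + r *\<^sub>R dir \<theta>) * indicator {0<..} r * indicator {0<..<2*pi} \<theta> \<partial>lborel \<partial>lborel)"
    by (intro nn_integral_cong nn_integral_multc[symmetric]) measurable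
  also have "\<dots> = (\<integral>\<^sup>+ r. \<integral>\<^sup>+ \<theta>. G (x + r *\<^sub>R dir \<theta>) * indicator {0<..} r * indicator {0<..<2*pi} \<theta> \<partial>lborel \<partial>lborel)"
    by (rule lborel_pair.Fubini') measurable
  also have "\<dots> = (\<integral>\<^sup>+ r\<in>{0<..}. ennreal r * (\<integral>\<^sup>+ \<theta>\<in>{0<..<2*pi}. G (x + r *\<^sub>R dir \<theta>) * ennreal (1 / norm (x - (x + r *\<^sub>R dir \<theta>))) \<partial>lborel) \<partial>lborel)"
  proof (intro nn_integral_cong)
    fix r :: real
    show "(\<integral>\<^sup>+ \<theta>. G (x + r *\<^sub>R dir \<theta>) * indicator {0<..} r * indicator {0<..<2*pi} \<theta> \<partial>lborel)
       = ennreal r * (\<integral>\<^sup>+ \<theta>\<in>{0<..<2*pi}. G (x + r *\<^sub>R dir \<theta>) * ennreal (1 / norm (x - (x + r *\<^sub>R dir \<theta>))) \<partial>lborel) * indicator {0<..} r"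
    proof (cases "0 < r")
      case True
      have "ennreal r * (\<integral>\<^sup>+ \<theta>\<in>{0<..<2*pi}. G (x + r *\<^sub>R dir \<theta>) * ennreal (1 / norm (x - (x + r *\<^sub>R dir \<theta>))) \<partial>lborel)
        = (\<integral>\<^sup>+ \<theta>. ennreal r * (G (x + r *\<^sub>R dir \<theta>) * ennreal (1 / norm (x - (x + r *\<^sub>R dir \<theta>))) * indicator {0<..<2*pi} \<theta>) \<partial>lborel)"
        by (rule nn_integral_cmult[symmetric]) measurable
      also have "\<dots> = (\<integral>\<^sup>+ \<theta>. G (x + r *\<^sub>R dir \<theta>) * indicator {0<..<2*pi} \<theta> \<partial>lborel)"
      proof (intro nn_integral_cong)
        fix \<theta>
        have "ennreal r * ennreal (1 / norm (x - (x + r *\<^sub>R dir \<theta>))) = 1"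
          using True by (simp add: ennreal_mult[symmetric])
        then show "ennreal r * (G (x + r *\<^sub>R dir \<theta>) * ennreal (1 / norm (x - (x + r *\<^sub>R dir \<theta>))) * indicator {0<..<2*pi} \<theta>)
            = G (x + r *\<^sub>R dir \<theta>) * indicator {0<..<2*pi} \<theta>"
          by (metis (no_types, lifting) mult.assoc mult.left_commute mult.left_neutral)
      qed
      finally show ?thesis using True by simp
    qed simp
  qed
  also have "\<dots> = riesz G x"
    unfolding riesz_def by (rule nn_integral_polar[symmetric]) measurable
  finally show ?thesis unfolding G_def .
qed

lemma grad_uminus:
  assumes "u \<in> test_functions \<Omega>"
  shows "(\<lambda>x. - u x) \<in> test_functions \<Omega>" "grad (\<lambda>x. - u x) x = - grad u x"
  using test_functions_scale[OF assms, of "-1"] grad_scale[OF assms, of "-1"] by simp_all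

lemma ray_representation:
  fixes u :: "real^2 \<Rightarrow> real"
  assumes u: "u \<in> test_functions \<Omega>" and A: "0 \<le> A" "A < \<bar>u x\<bar>"
  shows "ennreal (2 * pi * (\<bar>u x\<bar> - A)) \<le> riesz (\<lambda>y. ennreal (norm (grad u y)) * indicator {y. A < \<bar>u y\<bar>} y) x"
proof -
  have mono: "riesz f x \<le> riesz g x" if "\<And>y. f y \<le> g y" for f g
    unfolding riesz_def by (intro nn_integral_mono mult_right_mono that) simp
  show ?thesis
  proof (cases "0 \<le> u x")
    case True
    then have "ennreal (2 * pi * (\<bar>u x\<bar> - A)) \<le> riesz (\<lambda>y. ennreal (norm (grad u y)) * indicator {y. A < u y} y) x"
      using ray_representation_pos[OF u A(1), of x] A(2) by simp
    also have "\<dots> \<le> riesz (\<lambda>y. ennreal (norm (grad u y)) * indicator {y. A < \<bar>u y\<bar>} y) x"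
      by (rule mono) (auto split: split_indicator)
    finally show ?thesis .
  next
    case False
    then have "ennreal (2 * pi * (\<bar>u x\<bar> - A)) \<le> riesz (\<lambda>y. ennreal (norm (grad u y)) * indicator {y. A < - u y} y) x"
      using ray_representation_pos[OF grad_uminus(1)[OF u] A(1), of x] A(2) by (simp add: grad_uminus(2)[OF u])
    also have "\<dots> \<le> riesz (\<lambda>y. ennreal (norm (grad u y)) * indicator {y. A < \<bar>u y\<bar>} y) x"
      by (rule mono) (auto split: split_indicator)
    finally show ?thesis .
  qed
qed

text \<open>The starting point may lie on either side of \<open>b\<close>, and \<open>p b\<close> may have
  either sign; in all cases the path between the two points crosses the values below \<open>d\<close>.\<close>

lemma crossing_from_zero:
  fixes p p' :: "real \<Rightarrow> real"
  assumes der: "\<And>t. (p has_real_derivative p' t) (at t)" and cont': "continuous_on UNIV p'"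
    and ab: "a \<in> {0..L}" "b \<in> {0..L}" and pa: "p a = 0" and d: "0 < d" "d \<le> \<bar>p b\<bar>"
  shows "ennreal d \<le> (\<integral>\<^sup>+ t\<in>{0<..<L}. ennreal \<bar>p' t\<bar> * indicator {..d} \<bar>p t\<bar> \<partial>lborel)"
proof -
  have pos: "ennreal d \<le> (\<integral>\<^sup>+ t\<in>{0<..<L}. ennreal \<bar>q' t\<bar> * indicator {..d} \<bar>q t\<bar> \<partial>lborel)"
    if q: "\<And>t. (q has_real_derivative q' t) (at t)" "continuous_on UNIV q'" "q a = 0" "d \<le> q b" for q q'
  proof -
    have c: "continuous_on S q'" for S using continuous_on_subset[OF q(2) subset_UNIV] .
    have mono: "(\<integral>\<^sup>+ t\<in>{s<..<s'}. ennreal \<bar>q' t\<bar> * indicator {0<..<d} (q t) \<partial>lborel)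
       \<le> (\<integral>\<^sup>+ t\<in>{0<..<L}. ennreal \<bar>q' t\<bar> * indicator {..d} \<bar>q t\<bar> \<partial>lborel)" if "0 \<le> s" "s' \<le> L" for s s'
      using that by (intro nn_integral_mono) (auto split: split_indicator)
    have "ennreal (d - 0) \<le> (\<integral>\<^sup>+ t\<in>{min a b<..<max a b}. ennreal \<bar>q' t\<bar> * indicator {0<..<d} (q t) \<partial>lborel)"
    proof (cases "a \<le> b")
      case True
      then have "ennreal (d - 0) \<le> (\<integral>\<^sup>+ t\<in>{a<..<b}. ennreal \<bar>q' t\<bar> * indicator {0<..<d} (q t) \<partial>lborel)"
        by (intro crossing_up[OF _ q(1) c]) (use q d in auto)
      then show ?thesis using True by (simp add: min_def max_def)
    next
      case False
      then have "ennreal (d - 0) \<le> (\<integral>\<^sup>+ t\<in>{b<..<a}. ennreal \<bar>q' t\<bar> * indicator {0<..<d} (q t) \<partial>lborel)"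
        by (intro crossing_down[OF _ q(1) c]) (use q d in auto)
      then show ?thesis using False by (simp add: min_def max_def)
    qed
    also have "\<dots> \<le> (\<integral>\<^sup>+ t\<in>{0<..<L}. ennreal \<bar>q' t\<bar> * indicator {..d} \<bar>q t\<bar> \<partial>lborel)"
      using ab by (intro mono) auto
    finally show ?thesis by simp
  qed
  show ?thesis
  proof (cases "0 \<le> p b")
    case True
    then show ?thesis using pos[OF der cont' pa] d by simp
  next
    case False
    have "((\<lambda>t. - p t) has_real_derivative - p' t) (at t)" for t by (intro derivative_intros der)
    moreover have "continuous_on UNIV (\<lambda>t. - p' t)" by (intro continuous_intros cont')
    ultimately show ?thesis using pos[of "\<lambda>t. - p t" "\<lambda>t. - p' t"] pa d False by simp
  qed
qed

lemma dir_has_vector_derivative: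
  "((\<lambda>t. z + r *\<^sub>R dir t) has_vector_derivative r *\<^sub>R pt (- sin t) (cos t)) (at t)"
  unfolding dir_def pt_eq_axis
  by (auto intro!: derivative_eq_intros simp: has_real_derivative_iff_has_vector_derivative[symmetric] algebra_simps)

text \<open>On the circle \<open>u\<close> vanishes somewhere, so its truncation is bounded everywhere by the
  derivative along the circle on \<open>{|u| \<le> A}\<close>; then the Cauchy-Schwarz inequality and
  integration over the angle.\<close>

lemma circle_bound:
  fixes u :: "real^2 \<Rightarrow> real"
  assumes u: "u \<in> test_functions \<Omega>" and sc: "simply_connected \<Omega>" and z: "z \<notin> \<Omega>" and r: "0 < r" and A: "0 < A"
  shows "(\<integral>\<^sup>+ \<theta>\<in>{0<..<2*pi}. ennreal ((min \<bar>u (z + r *\<^sub>R dir \<theta>)\<bar> A)\<^sup>2) \<partial>lborel)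
    \<le> ennreal (4 * pi\<^sup>2 * r\<^sup>2) * (\<integral>\<^sup>+ \<theta>\<in>{0<..<2*pi}. ennreal ((norm (grad u (z + r *\<^sub>R dir \<theta>)))\<^sup>2) * indicator {..A} \<bar>u (z + r *\<^sub>R dir \<theta>)\<bar> \<partial>lborel)"
proof -
  define N where "N = (\<lambda>\<theta>. norm (grad u (z + r *\<^sub>R dir \<theta>)))"
  define U where "U = (\<lambda>\<theta>. u (z + r *\<^sub>R dir \<theta>))"
  define U' where "U' = (\<lambda>\<theta>. grad u (z + r *\<^sub>R dir \<theta>) \<bullet> (r *\<^sub>R pt (- sin \<theta>) (cos \<theta>)))"
  have [measurable]: "u \<in> borel_measurable borel" "grad u \<in> borel_measurable borel"
    by (rule measurable_test_function[OF u], rule measurable_grad_test_function[OF u])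
  have [measurable]: "N \<in> borel_measurable borel" "U \<in> borel_measurable borel"
    unfolding N_def U_def by measurable
  let ?I = "\<integral>\<^sup>+ \<theta>\<in>{0<..<2*pi}. ennreal ((N \<theta>)\<^sup>2) * indicator {..A} \<bar>U \<theta>\<bar> \<partial>lborel"
  have der: "(U has_real_derivative U' t) (at t)" for t
    unfolding U_def U'_def by (rule derivative_along_curve[OF u dir_has_vector_derivative])
  have cd: "continuous_on UNIV dir"
    unfolding dir_def pt_eq_axis by (intro continuous_intros)
  have cont: "continuous_on UNIV U'"
    unfolding U'_def pt_eq_axis
    by (intro continuous_intros continuous_on_compose2[OF continuous_grad[OF u]] cd) auto
  have U'N: "\<bar>U' t\<bar> \<le> r * N t" for t
  proof -
    have "norm (pt (- sin t) (cos t)) = 1" by (simp add: norm_real2 vector_2)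
    then show ?thesis
      using Cauchy_Schwarz_ineq2[of "grad u (z + r *\<^sub>R dir t)" "r *\<^sub>R pt (- sin t) (cos t)"] r
      by (simp add: U'_def N_def mult.commute)
  qed
  obtain \<theta>0 where \<theta>0: "\<theta>0 \<in> {0..2*pi}" "z + r *\<^sub>R dir \<theta>0 \<notin> \<Omega>"
    using circle_meets_complement[OF sc z r] by blast
  have U0: "U \<theta>0 = 0"
    unfolding U_def by (rule test_function_outside(1)[OF u \<theta>0(2)])
  have pw: "ennreal ((min \<bar>U \<theta>\<bar> A)\<^sup>2) \<le> ennreal (2 * pi * r\<^sup>2) * ?I" if \<theta>: "\<theta> \<in> {0<..<2*pi}" for \<theta>
  proof (cases "U \<theta> = 0")
    case False
    define d where "d = min \<bar>U \<theta>\<bar> A"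
    have d: "0 < d" "d \<le> \<bar>U \<theta>\<bar>" "d \<le> A" using False A by (auto simp: d_def)
    have "ennreal d \<le> (\<integral>\<^sup>+ t\<in>{0<..<2*pi}. ennreal \<bar>U' t\<bar> * indicator {..d} \<bar>U t\<bar> \<partial>lborel)"
      by (rule crossing_from_zero[OF der cont \<theta>0(1) _ U0 d(1,2)]) (use \<theta> in auto)
    also have "\<dots> \<le> (\<integral>\<^sup>+ t. indicator {0<..<2*pi} t * (ennreal (r * N t) * indicator {..A} \<bar>U t\<bar> * indicator {0<..<2*pi} t) \<partial>lborel)"
      using d(3) U'N by (intro nn_integral_mono) (auto intro!: ennreal_leI split: split_indicator)
    finally have "(ennreal d)\<^sup>2 \<le> (\<integral>\<^sup>+ t. indicator {0<..<2*pi} t * (ennreal (r * N t) * indicator {..A} \<bar>U t\<bar> * indicator {0<..<2*pi} t) \<partial>lborel)\<^sup>2"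
      by (intro power_mono) auto
    also have "\<dots> \<le> (\<integral>\<^sup>+ t. (indicator {0<..<2*pi} t)\<^sup>2 \<partial>lborel) * (\<integral>\<^sup>+ t. (ennreal (r * N t) * indicator {..A} \<bar>U t\<bar> * indicator {0<..<2*pi} t)\<^sup>2 \<partial>lborel)"
      by (rule Cauchy_Schwarz_nn_integral) measurable
    also have "(\<integral>\<^sup>+ t. (indicator {0<..<2*pi} t)\<^sup>2 \<partial>lborel) = (\<integral>\<^sup>+ t. indicator {0<..<2*pi::real} t \<partial>lborel)"
      by (intro nn_integral_cong) (auto split: split_indicator)
    also have "\<dots> = ennreal (2 * pi)" by simp
    also have "(\<integral>\<^sup>+ t. (ennreal (r * N t) * indicator {..A} \<bar>U t\<bar> * indicator {0<..<2*pi} t)\<^sup>2 \<partial>lborel)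
       = (\<integral>\<^sup>+ t. ennreal (r\<^sup>2) * (ennreal ((N t)\<^sup>2) * indicator {..A} \<bar>U t\<bar> * indicator {0<..<2*pi} t) \<partial>lborel)"
      using r by (intro nn_integral_cong)
        (auto simp: ennreal_power N_def power_mult_distrib ennreal_mult'[symmetric] split: split_indicator)
    also have "\<dots> = ennreal (r\<^sup>2) * ?I"
      by (rule nn_integral_cmult) measurable
    finally have "(ennreal d)\<^sup>2 \<le> ennreal (2 * pi) * (ennreal (r\<^sup>2) * ?I)" .
    also have "\<dots> = ennreal (2 * pi * r\<^sup>2) * ?I"
      by (simp add: ennreal_mult' mult.assoc)
    finally show ?thesis using d by (simp add: ennreal_power d_def[symmetric])
  qed (use A in simp)
  have "(\<integral>\<^sup>+ \<theta>\<in>{0<..<2*pi}. ennreal ((min \<bar>U \<theta>\<bar> A)\<^sup>2) \<partial>lborel) \<le> (\<integral>\<^sup>+ \<theta>. (ennreal (2 * pi * r\<^sup>2) * ?I) * indicator {0<..<2*pi} \<theta> \<partial>lborel)"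
    using pw by (intro nn_integral_mono) (auto split: split_indicator)
  also have "\<dots> = (ennreal (2 * pi * r\<^sup>2) * ?I) * ennreal (2 * pi)"
    by (simp add: nn_integral_cmult_indicator)
  also have "\<dots> = ennreal (4 * pi\<^sup>2 * r\<^sup>2) * ?I"
  proof -
    have "ennreal (2 * pi * r\<^sup>2) * ennreal (2 * pi) = ennreal (4 * pi\<^sup>2 * r\<^sup>2)"
      by (subst ennreal_mult'[symmetric]) (auto simp: power2_eq_square mult_ac)
    moreover have "(a * i) * b = (a * b) * i" for a b i :: ennreal by (simp add: mult_ac)
    ultimately show ?thesis by metis
  qed
  finally show ?thesis unfolding U_def N_def .
qed

section \<open>A truncated Poincare inequality\<close>

lemma ball_poincare:
  fixes u :: "real^2 \<Rightarrow> real"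
  assumes u: "u \<in> test_functions \<Omega>" and sc: "simply_connected \<Omega>" and z: "z \<notin> \<Omega>" and R: "0 < R" and A: "0 < A"
  shows "(\<integral>\<^sup>+ x\<in>ball z R. ennreal ((min \<bar>u x\<bar> A)\<^sup>2) \<partial>lborel)
    \<le> ennreal (4 * pi\<^sup>2 * R\<^sup>2) * (\<integral>\<^sup>+ x\<in>ball z R. ennreal ((norm (grad u x))\<^sup>2) * indicator {..A} \<bar>u x\<bar> \<partial>lborel)"
proof -
  have [measurable]: "u \<in> borel_measurable borel" "grad u \<in> borel_measurable borel"
    by (rule measurable_test_function[OF u], rule measurable_grad_test_function[OF u])
  define F where "F = (\<lambda>x. ennreal ((min \<bar>u x\<bar> A)\<^sup>2))"
  define E where "E = (\<lambda>x. ennreal ((norm (grad u x))\<^sup>2) * indicator {..A} \<bar>u x\<bar>)"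
  have Fm [measurable]: "F \<in> borel_measurable borel" unfolding F_def by measurable
  have Em [measurable]: "E \<in> borel_measurable borel" unfolding E_def by measurable
  have [measurable]: "ball z R \<in> sets borel" by simp
  have polar: "(\<integral>\<^sup>+ x\<in>ball z R. G x \<partial>lborel) = (\<integral>\<^sup>+ r\<in>{0<..}. ennreal r * indicator {..<R} r * (\<integral>\<^sup>+ \<theta>\<in>{0<..<2*pi}. G (z + r *\<^sub>R dir \<theta>) \<partial>lborel) \<partial>lborel)"
    if [measurable]: "G \<in> borel_measurable borel" for G
  proof -
    have "(\<integral>\<^sup>+ x\<in>ball z R. G x \<partial>lborel) = (\<integral>\<^sup>+ r\<in>{0<..}. ennreal r * (\<integral>\<^sup>+ \<theta>\<in>{0<..<2*pi}. G (z + r *\<^sub>R dir \<theta>) * indicator (ball z R) (z + r *\<^sub>R dir \<theta>) \<partial>lborel) \<partial>lborel)"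
      by (rule nn_integral_polar) measurable
    also have "\<dots> = (\<integral>\<^sup>+ r\<in>{0<..}. ennreal r * indicator {..<R} r * (\<integral>\<^sup>+ \<theta>\<in>{0<..<2*pi}. G (z + r *\<^sub>R dir \<theta>) \<partial>lborel) \<partial>lborel)"
    proof (intro nn_integral_cong)
      fix r :: real
      have "indicator (ball z R) (z + r *\<^sub>R dir \<theta>) = (indicator {..<R} r :: ennreal)" if "0 < r" for \<theta>
        using that by (auto simp: dist_norm split: split_indicator)
      then show "ennreal r * (\<integral>\<^sup>+ \<theta>\<in>{0<..<2*pi}. G (z + r *\<^sub>R dir \<theta>) * indicator (ball z R) (z + r *\<^sub>R dir \<theta>) \<partial>lborel) * indicator {0<..} r
        = ennreal r * indicator {..<R} r * (\<integral>\<^sup>+ \<theta>\<in>{0<..<2*pi}. G (z + r *\<^sub>R dir \<theta>) \<partial>lborel) * indicator {0<..} r"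
        by (cases "0 < r"; cases "r < R") simp_all
    qed
    finally show ?thesis .
  qed
  have "(\<integral>\<^sup>+ x\<in>ball z R. F x \<partial>lborel) = (\<integral>\<^sup>+ r\<in>{0<..}. ennreal r * indicator {..<R} r * (\<integral>\<^sup>+ \<theta>\<in>{0<..<2*pi}. F (z + r *\<^sub>R dir \<theta>) \<partial>lborel) \<partial>lborel)"
    by (rule polar[OF Fm])
  also have "\<dots> \<le> (\<integral>\<^sup>+ r. ennreal (4 * pi\<^sup>2 * R\<^sup>2) * (ennreal r * indicator {..<R} r * (\<integral>\<^sup>+ \<theta>\<in>{0<..<2*pi}. E (z + r *\<^sub>R dir \<theta>) \<partial>lborel) * indicator {0<..} r) \<partial>lborel)"
  proof (intro nn_integral_mono)
    fix r :: real
    show "ennreal r * indicator {..<R} r * (\<integral>\<^sup>+ \<theta>\<in>{0<..<2*pi}. F (z + r *\<^sub>R dir \<theta>) \<partial>lborel) * indicator {0<..} r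
      \<le> ennreal (4 * pi\<^sup>2 * R\<^sup>2) * (ennreal r * indicator {..<R} r * (\<integral>\<^sup>+ \<theta>\<in>{0<..<2*pi}. E (z + r *\<^sub>R dir \<theta>) \<partial>lborel) * indicator {0<..} r)"
    proof (cases "0 < r \<and> r < R")
      case True
      let ?IE = "\<integral>\<^sup>+ \<theta>\<in>{0<..<2*pi}. E (z + r *\<^sub>R dir \<theta>) \<partial>lborel"
      have "(\<integral>\<^sup>+ \<theta>\<in>{0<..<2*pi}. F (z + r *\<^sub>R dir \<theta>) \<partial>lborel) \<le> ennreal (4 * pi\<^sup>2 * r\<^sup>2) * ?IE"
        unfolding F_def E_def using True by (intro circle_bound[OF u sc z _ A]) simp
      also have "\<dots> \<le> ennreal (4 * pi\<^sup>2 * R\<^sup>2) * ?IE"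
        using True by (intro mult_right_mono ennreal_leI mult_left_mono power_mono) auto
      finally have "ennreal r * (\<integral>\<^sup>+ \<theta>\<in>{0<..<2*pi}. F (z + r *\<^sub>R dir \<theta>) \<partial>lborel) \<le> ennreal r * (ennreal (4 * pi\<^sup>2 * R\<^sup>2) * ?IE)"
        by (rule mult_left_mono) simp
      then show ?thesis using True by (simp add: mult.left_commute)
    qed (auto split: split_indicator)
  qed
  also have "\<dots> = ennreal (4 * pi\<^sup>2 * R\<^sup>2) * (\<integral>\<^sup>+ r\<in>{0<..}. ennreal r * indicator {..<R} r * (\<integral>\<^sup>+ \<theta>\<in>{0<..<2*pi}. E (z + r *\<^sub>R dir \<theta>) \<partial>lborel) \<partial>lborel)"
    by (rule nn_integral_cmult) measurable
  also have "\<dots> = ennreal (4 * pi\<^sup>2 * R\<^sup>2) * (\<integral>\<^sup>+ x\<in>ball z R. E x \<partial>lborel)"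
    by (simp only: polar[OF Em])
  finally show ?thesis unfolding F_def E_def .
qed

text \<open>For every unit cell of the integer grid choose a point outside \<open>\<Omega>\<close> close to it
  and apply \<open>ball_poincare\<close> on a disc about that point which contains the cell. All these discs
  have the same radius and their centres are close to distinct grid points, so they overlap boundedly.\<close>

lemma truncated_poincare:
  fixes \<Omega> :: "(real^2) set"
  assumes sc: "simply_connected \<Omega>" and \<rho>: "0 < \<rho>" and dense: "\<And>x. \<exists>z. z \<notin> \<Omega> \<and> dist x z < \<rho>"
  shows "\<exists>C>0. \<forall>u\<in>test_functions \<Omega>. \<forall>A>0.
    (\<integral>\<^sup>+ x. ennreal ((min \<bar>u x\<bar> A)\<^sup>2) \<partial>lborel)
      \<le> ennreal C * (\<integral>\<^sup>+ x. ennreal ((norm (grad u x))\<^sup>2) * indicator {..A} \<bar>u x\<bar> \<partial>lborel)"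
proof -
  define R where "R = \<rho> + 2"
  have R: "0 < R" using \<rho> by (simp add: R_def)
  define c :: "int \<times> int \<Rightarrow> real^2" where "c = (\<lambda>k. pt (of_int (fst k)) (of_int (snd k)))"
  have "\<forall>k. \<exists>z. z \<notin> \<Omega> \<and> dist (c k) z < \<rho>" using dense by (rule allI)
  from choice[OF this] obtain z where z: "\<And>k. z k \<notin> \<Omega> \<and> dist (c k) (z k) < \<rho>"
    by auto
  \<comment> \<open>A disc of radius \<open>R\<close> contains \<open>x\<close> only if its grid point is
    within \<open>\<rho> + R\<close> of \<open>x\<close>.\<close>
  define d where "d = \<lceil>\<rho> + R\<rceil> + 1"
  have d: "0 \<le> d" using \<rho> R by (simp add: d_def)
  define M where "M = (2 * d + 1) * (2 * d + 1)"
  \<comment> \<open>The grid is enumerated by natural numbers so that sums over cells are series; indices that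
    are no codes get empty sets.\<close>
  define I where "I = range (to_nat :: int \<times> int \<Rightarrow> nat)"
  define Q where "Q = (\<lambda>n. if n \<in> I then {x::real^2. \<lfloor>x$1\<rfloor> = fst (from_nat n :: int \<times> int) \<and> \<lfloor>x$2\<rfloor> = snd (from_nat n :: int \<times> int)} else {})"
  define B where "B = (\<lambda>n. if n \<in> I then ball (z (from_nat n)) R else {})"
  have comp_m [measurable]: "(\<lambda>x::real^2. x$1) \<in> borel_measurable borel" "(\<lambda>x::real^2. x$2) \<in> borel_measurable borel"
    by (auto intro!: borel_measurable_continuous_onI continuous_intros)
  have Qm [measurable]: "Q n \<in> sets borel" for n
    unfolding Q_def by (cases "n \<in> I") (simp_all, measurable)
  have Bm [measurable]: "B n \<in> sets borel" for n
    unfolding B_def by simp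
  have norm_le: "norm x \<le> \<bar>x$1\<bar> + \<bar>x$2\<bar>" for x :: "real^2"
    using norm_le_l1_cart[of x] by (simp add: UNIV_2)
  have QB: "Q n \<subseteq> B n" for n
  proof
    fix x assume x: "x \<in> Q n"
    then have n: "n \<in> I" by (auto simp: Q_def split: if_splits)
    define k where "k = (from_nat n :: int \<times> int)"
    have "\<lfloor>x$1\<rfloor> = fst k" "\<lfloor>x$2\<rfloor> = snd k" using x n by (auto simp: Q_def k_def)
    then have "\<bar>(x - c k)$1\<bar> \<le> 1" "\<bar>(x - c k)$2\<bar> \<le> 1"
      by (simp_all add: c_def vector_2) linarith+
    then have "dist (c k) x \<le> 2" using norm_le[of "x - c k"] by (simp add: dist_norm norm_minus_commute)
    moreover have "dist (c k) (z k) < \<rho>" using z by simp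
    ultimately have "dist (z k) x < R"
      using dist_triangle[of "z k" x "c k"] by (simp add: R_def dist_commute)
    then show "x \<in> B n" using n by (simp add: B_def k_def)
  qed
  have single: "(\<Sum>n. f * indicator (Q n) x) = f" for x and f :: ennreal
  proof -
    define m where "m = to_nat (\<lfloor>x$1\<rfloor>, \<lfloor>x$2\<rfloor>)"
    have m: "x \<in> Q n \<longleftrightarrow> n = m" for n
      by (auto simp: Q_def I_def m_def)
    have "(\<Sum>n. f * indicator (Q n) x) = (\<Sum>n\<in>{m}. f * indicator (Q n) x)"
      by (rule suminf_finite) (auto simp: m)
    also have "\<dots> = f" using m[of m] by (simp add: indicator_def)
    finally show ?thesis .
  qed
  have overlap: "(\<Sum>n. indicator (B n) x) \<le> ennreal (of_int M)" for x
  proof -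
    define S where "S = {\<lfloor>x$1\<rfloor> - d..\<lfloor>x$1\<rfloor> + d} \<times> {\<lfloor>x$2\<rfloor> - d..\<lfloor>x$2\<rfloor> + d}"
    have S: "n \<in> to_nat ` S" if n: "x \<in> B n" for n
    proof -
      from n have "n \<in> I" by (auto simp: B_def split: if_splits)
      then obtain k :: "int \<times> int" where k: "n = to_nat k" by (auto simp: I_def)
      have "dist (z k) x < R" using n \<open>n \<in> I\<close> by (simp add: B_def k)
      moreover have "dist (c k) (z k) < \<rho>" using z by simp
      ultimately have "norm (c k - x) < \<rho> + R"
        using dist_triangle[of "c k" x "z k"] by (simp add: dist_norm)
      then have "\<bar>(c k - x)$1\<bar> < \<rho> + R" "\<bar>(c k - x)$2\<bar> < \<rho> + R"
        using component_le_norm_cart[of "c k - x" 1] component_le_norm_cart[of "c k - x" 2] by linarith+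
      then have "\<bar>of_int (fst k) - x$1\<bar> < of_int (d - 1)" "\<bar>of_int (snd k) - x$2\<bar> < of_int (d - 1)"
        unfolding d_def by (simp_all add: c_def vector_2) linarith+
      then have "\<bar>fst k - \<lfloor>x$1\<rfloor>\<bar> \<le> d" "\<bar>snd k - \<lfloor>x$2\<rfloor>\<bar> \<le> d" by linarith+
      then have "k \<in> S" by (cases k) (auto simp: S_def)
      then show ?thesis using k by blast
    qed
    have finS: "finite (to_nat ` S)" by (simp add: S_def)
    have "(\<Sum>n. indicator (B n) x :: ennreal) = (\<Sum>n\<in>to_nat ` S. indicator (B n) x)"
      by (rule suminf_finite[OF finS]) (use S in \<open>auto split: split_indicator\<close>)
    also have "\<dots> \<le> (\<Sum>n\<in>to_nat ` S. 1)"
      by (intro sum_mono) (auto split: split_indicator)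
    also have "\<dots> = of_nat (card (to_nat ` S))" by simp
    also have "card (to_nat ` S) \<le> card S" by (rule card_image_le) (simp add: S_def)
    also have "card S = nat M"
      using d by (simp add: S_def M_def card_cartesian_product nat_mult_distrib)
    also have "of_nat (nat M) = ennreal (of_int M)"
      using d by (simp add: M_def ennreal_of_nat_eq_real_of_nat)
    finally show ?thesis by simp
  qed
  define C where "C = 4 * pi\<^sup>2 * R\<^sup>2 * of_int M"
  have "0 < M" using d by (simp add: M_def)
  then have "0 < C" using R by (simp add: C_def)
  moreover have "(\<integral>\<^sup>+ x. ennreal ((min \<bar>u x\<bar> A)\<^sup>2) \<partial>lborel)
      \<le> ennreal C * (\<integral>\<^sup>+ x. ennreal ((norm (grad u x))\<^sup>2) * indicator {..A} \<bar>u x\<bar> \<partial>lborel)"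
    if u: "u \<in> test_functions \<Omega>" and A: "0 < A" for u A
  proof -
    have [measurable]: "u \<in> borel_measurable borel" "grad u \<in> borel_measurable borel"
      by (rule measurable_test_function[OF u], rule measurable_grad_test_function[OF u])
    define F where "F = (\<lambda>x. ennreal ((min \<bar>u x\<bar> A)\<^sup>2))"
    define E where "E = (\<lambda>x. ennreal ((norm (grad u x))\<^sup>2) * indicator {..A} \<bar>u x\<bar>)"
    have Fm [measurable]: "F \<in> borel_measurable borel" unfolding F_def by measurable
    have Em [measurable]: "E \<in> borel_measurable borel" unfolding E_def by measurable
    define K where "K = ennreal (4 * pi\<^sup>2 * R\<^sup>2)"
    have cell: "(\<integral>\<^sup>+ x. F x * indicator (Q n) x \<partial>lborel) \<le> K * (\<integral>\<^sup>+ x. E x * indicator (B n) x \<partial>lborel)" for n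
    proof (cases "n \<in> I")
      case True
      have "(\<integral>\<^sup>+ x. F x * indicator (Q n) x \<partial>lborel) \<le> (\<integral>\<^sup>+ x. F x * indicator (B n) x \<partial>lborel)"
        using QB[of n] by (intro nn_integral_mono) (auto split: split_indicator)
      also have "\<dots> \<le> K * (\<integral>\<^sup>+ x. E x * indicator (B n) x \<partial>lborel)"
        using ball_poincare[OF u sc conjunct1[OF z] R A, of "from_nat n"] True
        by (simp add: B_def F_def E_def K_def)
      finally show ?thesis .
    qed (simp add: Q_def)
    have "(\<integral>\<^sup>+ x. F x \<partial>lborel) = (\<integral>\<^sup>+ x. (\<Sum>n. F x * indicator (Q n) x) \<partial>lborel)"
      by (simp only: single)
    also have "\<dots> = (\<Sum>n. \<integral>\<^sup>+ x. F x * indicator (Q n) x \<partial>lborel)"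
      by (rule nn_integral_suminf) measurable
    also have "\<dots> \<le> (\<Sum>n. K * (\<integral>\<^sup>+ x. E x * indicator (B n) x \<partial>lborel))"
      by (intro suminf_le cell) auto
    also have "\<dots> = K * (\<Sum>n. \<integral>\<^sup>+ x. E x * indicator (B n) x \<partial>lborel)"
      by (rule ennreal_suminf_cmult)
    also have "(\<Sum>n. \<integral>\<^sup>+ x. E x * indicator (B n) x \<partial>lborel) = (\<integral>\<^sup>+ x. (\<Sum>n. E x * indicator (B n) x) \<partial>lborel)"
      by (rule nn_integral_suminf[symmetric]) measurable
    also have "\<dots> = (\<integral>\<^sup>+ x. E x * (\<Sum>n. indicator (B n) x) \<partial>lborel)"
      by (simp only: ennreal_suminf_cmult)
    also have "\<dots> \<le> (\<integral>\<^sup>+ x. E x * ennreal (of_int M) \<partial>lborel)"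
      by (intro nn_integral_mono mult_left_mono overlap) simp
    also have "\<dots> = (\<integral>\<^sup>+ x. E x \<partial>lborel) * ennreal (of_int M)"
      by (rule nn_integral_multc) measurable
    finally have "(\<integral>\<^sup>+ x. F x \<partial>lborel) \<le> K * ((\<integral>\<^sup>+ x. E x \<partial>lborel) * ennreal (of_int M))"
      by (simp add: mult_left_mono)
    also have "\<dots> = ennreal C * (\<integral>\<^sup>+ x. E x \<partial>lborel)"
      unfolding C_def K_def using \<open>0 < M\<close> by (simp add: ennreal_mult' mult_ac)
    finally show ?thesis unfolding F_def E_def .
  qed
  ultimately show ?thesis by blast
qed

section \<open>The Moser-Trudinger inequality\<close>

lemma riesz_cmult:
  assumes [measurable]: "f \<in> borel_measurable borel"
  shows "riesz (\<lambda>y. c * f y) x = c * riesz f x"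
  unfolding riesz_def by (simp add: mult.assoc nn_integral_cmult)

text \<open>The constant \<open>C\<close> of the truncated Poincare inequality controls everything. Above the
  level \<open>A\<close> the enlarged function \<open>w\<close> has unit energy and lives on a set of measure
  at most one, and \<open>u\<^sup>2 \<le> w\<^sup>2 + 2 C\<close>. Below the level \<open>u\<close> is
  bounded, and the integrand is comparable to \<open>u\<^sup>2\<close>.\<close>

lemma moser_trudinger_test_functions:
  fixes \<Omega> :: "(real^2) set"
  assumes C: "0 < C"
    and poincare: "\<And>u A. u \<in> test_functions \<Omega> \<Longrightarrow> 0 < A \<Longrightarrow>
      (\<integral>\<^sup>+ x. ennreal ((min \<bar>u x\<bar> A)\<^sup>2) \<partial>lborel)
        \<le> ennreal C * (\<integral>\<^sup>+ x. ennreal ((norm (grad u x))\<^sup>2) * indicator {..A} \<bar>u x\<bar> \<partial>lborel)"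
    and u: "u \<in> test_functions \<Omega>" and u1: "(\<integral>\<^sup>+ x. ennreal ((norm (grad u x))\<^sup>2) \<partial>lborel) \<le> 1"
  shows "(\<integral>\<^sup>+ x. ennreal (exp (4 * pi * (u x)\<^sup>2) - 1) \<partial>lborel)
    \<le> ennreal (exp (8 * pi * C) * (exp 1 * level_const) + 4 * pi * exp (4 * pi * C) * C)"
proof -
  have [measurable]: "u \<in> borel_measurable borel" "grad u \<in> borel_measurable borel"
    by (rule measurable_test_function[OF u], rule measurable_grad_test_function[OF u])
  define N where "N = (\<lambda>x. ennreal ((norm (grad u x))\<^sup>2))"
  have [measurable]: "N \<in> borel_measurable borel" unfolding N_def by measurable
  obtain B where B: "0 < B" "\<And>x. \<bar>u x\<bar> \<le> B"
  proof -
    have "bounded (u ` closure {x. u x \<noteq> 0})"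
      by (rule compact_imp_bounded[OF compact_continuous_image[OF continuous_on_subset[OF test_functionD(3)[OF u] subset_UNIV] test_functionD(4)[OF u]]])
    then obtain b where b: "\<And>x. x \<in> closure {x. u x \<noteq> 0} \<Longrightarrow> \<bar>u x\<bar> \<le> b"
      unfolding bounded_iff by auto
    have "\<bar>u x\<bar> \<le> max b 1" for x
    proof (cases "x \<in> closure {x. u x \<noteq> 0}")
      case True then show ?thesis using b[of x] by simp
    next
      case False show ?thesis unfolding test_function_eq_0[OF u False] by simp
    qed
    then show ?thesis by (intro that[of "max b 1"]) auto
  qed
  have L2: "(\<integral>\<^sup>+ x. ennreal ((u x)\<^sup>2) \<partial>lborel) \<le> ennreal C"
  proof -
    have "(\<integral>\<^sup>+ x. ennreal ((u x)\<^sup>2) \<partial>lborel) = (\<integral>\<^sup>+ x. ennreal ((min \<bar>u x\<bar> B)\<^sup>2) \<partial>lborel)"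
      using B(2) by (intro nn_integral_cong) (simp add: min_absorb1)
    also have "\<dots> \<le> ennreal C * (\<integral>\<^sup>+ x. N x * indicator {..B} \<bar>u x\<bar> \<partial>lborel)"
      unfolding N_def by (rule poincare[OF u B(1)])
    also have "\<dots> \<le> ennreal C * (\<integral>\<^sup>+ x. N x \<partial>lborel)"
      by (intro mult_left_mono nn_integral_mono) (auto split: split_indicator)
    also have "\<dots> \<le> ennreal C * 1"
      using u1 by (intro mult_left_mono) (auto simp: N_def)
    finally show ?thesis by simp
  qed
  define \<phi> where "\<phi> = (\<lambda>a. emeasure lborel {x. a < \<bar>u x\<bar>})"
  define S where "S = {a. 0 \<le> a \<and> \<phi> a \<le> 1}"
  have \<phi>_mono: "\<phi> b \<le> \<phi> a" if "a \<le> b" for a b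
    unfolding \<phi>_def using that by (intro emeasure_mono) auto
  have "{x. B < \<bar>u x\<bar>} = {}" using B(2) by (auto simp: not_less)
  then have BS: "B \<in> S" using B(1) by (simp add: S_def \<phi>_def)
  have S: "S \<noteq> {}" "bdd_below S" using BS by (auto simp: S_def intro: bdd_belowI[of _ 0])
  define A where "A = Inf S"
  have A0: "0 \<le> A" unfolding A_def by (rule cInf_greatest[OF S(1)]) (simp add: S_def)
  define G where "G = {x. A < \<bar>u x\<bar>}"
  have [measurable]: "G \<in> sets borel" unfolding G_def by measurable
  have G1: "emeasure lborel G \<le> 1"
  proof -
    let ?G = "\<lambda>n. {x. A + inverse (real (Suc n)) < \<bar>u x\<bar>}"
    have le: "emeasure lborel (?G n) \<le> 1" for n
    proof -
      obtain a where "a \<in> S" "a < A + inverse (real (Suc n))"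
        using cInf_lessD[OF S(1), of "A + inverse (real (Suc n))"] unfolding A_def[symmetric] by auto
      then show ?thesis using \<phi>_mono[of a "A + inverse (real (Suc n))"] by (auto simp: S_def \<phi>_def)
    qed
    have "(\<Union>n. ?G n) = G"
    proof
      show "(\<Union>n. ?G n) \<subseteq> G"
        by (auto simp: G_def intro: less_trans[rotated] elim: order.strict_trans1[rotated])
      show "G \<subseteq> (\<Union>n. ?G n)"
      proof
        fix x assume "x \<in> G"
        then have "0 < \<bar>u x\<bar> - A" by (simp add: G_def)
        then obtain n where "inverse (real (Suc n)) < \<bar>u x\<bar> - A" using reals_Archimedean by blast
        then show "x \<in> (\<Union>n. ?G n)" by (auto simp: algebra_simps)
      qed
    qed
    moreover have "incseq ?G"
    proof (rule incseq_SucI, rule subsetI)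
      fix n x assume x: "x \<in> ?G n"
      have "inverse (real (Suc (Suc n))) \<le> inverse (real (Suc n))" by (simp add: le_imp_inverse_le)
      then have "A + inverse (real (Suc (Suc n))) < \<bar>u x\<bar>" using x unfolding mem_Collect_eq by linarith
      then show "x \<in> ?G (Suc n)" by (rule CollectI)
    qed
    then have "(SUP n. emeasure lborel (?G n)) = emeasure lborel (\<Union>n. ?G n)"
      by (intro SUP_emeasure_incseq) auto
    ultimately have "emeasure lborel G = (SUP n. emeasure lborel (?G n))" by simp
    also have "\<dots> \<le> 1" by (rule SUP_least) (rule le)
    finally show ?thesis .
  qed
  define e where "e = (\<integral>\<^sup>+ x. N x * indicator {..A} \<bar>u x\<bar> \<partial>lborel)"
  define g where "g = (\<integral>\<^sup>+ x. N x * indicator G x \<partial>lborel)"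
  have eg: "e + g \<le> 1"
  proof -
    have "e + g = (\<integral>\<^sup>+ x. N x * indicator {..A} \<bar>u x\<bar> + N x * indicator G x \<partial>lborel)"
      unfolding e_def g_def by (rule nn_integral_add[symmetric]) measurable
    also have "\<dots> = (\<integral>\<^sup>+ x. N x \<partial>lborel)"
      by (intro nn_integral_cong) (auto simp: G_def split: split_indicator)
    finally show ?thesis using u1 by (simp add: N_def)
  qed
  obtain e' g' where e': "e = ennreal e'" "0 \<le> e'" and g': "g = ennreal g'" "0 \<le> g'" and eg': "e' + g' \<le> 1"
  proof -
    have eg_top: "e + g < top" using eg by (rule le_less_trans) simp
    have "e < top" by (rule le_less_trans[OF _ eg_top]) simp
    moreover have "g < top" by (rule le_less_trans[OF _ eg_top]) simp
    ultimately obtain e' g' where "e = ennreal e'" "0 \<le> e'" "g = ennreal g'" "0 \<le> g'"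
      by (cases e; cases g) auto
    moreover from this eg have "e' + g' \<le> 1" by (simp add: ennreal_plus[symmetric] del: ennreal_plus)
    ultimately show ?thesis by (rule that)
  qed
  \<comment> \<open>Just below \<open>A\<close> the superlevel sets have measure at least one, so the
    truncated Poincare inequality forces energy below the level.\<close>
  have small: "a\<^sup>2 \<le> C * e'" if a: "0 < a" "a < A" for a
  proof -
    have "a \<notin> S" using a cInf_lower[OF _ S(2), of a] by (auto simp: A_def)
    then have "1 \<le> \<phi> a" using a by (simp add: S_def)
    then have "ennreal (a\<^sup>2) * 1 \<le> ennreal (a\<^sup>2) * \<phi> a" by (intro mult_left_mono) auto
    also have "\<dots> = (\<integral>\<^sup>+ x. ennreal (a\<^sup>2) * indicator {x. a < \<bar>u x\<bar>} x \<partial>lborel)"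
      unfolding \<phi>_def by (rule nn_integral_cmult_indicator[symmetric]) measurable
    also have "\<dots> \<le> (\<integral>\<^sup>+ x. ennreal ((min \<bar>u x\<bar> a)\<^sup>2) \<partial>lborel)"
      by (intro nn_integral_mono) (auto simp: min_def split: split_indicator)
    also have "\<dots> \<le> ennreal C * (\<integral>\<^sup>+ x. N x * indicator {..a} \<bar>u x\<bar> \<partial>lborel)"
      unfolding N_def by (rule poincare[OF u a(1)])
    also have "\<dots> \<le> ennreal C * e"
      unfolding e_def using a by (intro mult_left_mono nn_integral_mono) (auto split: split_indicator)
    also have "\<dots> = ennreal (C * e')" using C e' by (simp add: ennreal_mult)
    finally show ?thesis using C e' by simp
  qed
  have Ae: "A\<^sup>2 \<le> C * e'"
  proof (cases "A = 0")
    case False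
    then have "0 < A" using A0 by simp
    have "A \<le> sqrt (C * e')"
      by (rule dense_le_bounded[OF \<open>0 < A\<close>]) (auto intro!: real_le_rsqrt small)
    then have "A\<^sup>2 \<le> (sqrt (C * e'))\<^sup>2" using A0 by (rule power_mono)
    then show ?thesis using C e' by simp
  qed (use C e' in simp)
  have "C * e' \<le> C * 1" using C eg' e' g' by (intro mult_left_mono) auto
  then have AC: "A\<^sup>2 \<le> C" using Ae by simp
  \<comment> \<open>\<open>q\<close> is the square of the enlargement factor; the energy \<open>g'\<close>
    above the level is at most \<open>1 - A\<^sup>2 / C\<close>.\<close>
  define q where "q = 1 + A\<^sup>2 / C"
  have q: "1 \<le> q" "0 \<le> sqrt q" "0 < q" using C by (auto simp: q_def add_pos_nonneg)
  have qg: "q * g' \<le> 1"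
  proof -
    have "A\<^sup>2 / C \<le> e'" using Ae C by (simp add: field_simps)
    then have "q * g' \<le> q * (1 - A\<^sup>2 / C)" using eg' q by (intro mult_left_mono) auto
    also have "\<dots> = 1 - (A\<^sup>2 / C)\<^sup>2" by (simp add: q_def power2_eq_square algebra_simps)
    also have "\<dots> \<le> 1" by simp
    finally show ?thesis .
  qed
  define f where "f = (\<lambda>y. ennreal (sqrt q) * (ennreal (norm (grad u y)) * indicator {y. A < \<bar>u y\<bar>} y))"
  have [measurable]: "f \<in> borel_measurable borel" unfolding f_def by measurable
  define w where "w = (\<lambda>x. sqrt q * (\<bar>u x\<bar> - A))"
  have [measurable]: "w \<in> borel_measurable borel" unfolding w_def by measurable
  have expw: "(\<integral>\<^sup>+ x\<in>G. ennreal (exp (4 * pi * (w x)\<^sup>2)) \<partial>lborel) \<le> ennreal (exp 1 * (level_const * 1))"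
  proof (rule riesz_exponential_integrability)
    show "emeasure lborel G \<le> ennreal 1" using G1 by simp
    show "f y = 0" if "y \<notin> G" for y using that by (simp add: f_def G_def)
    have "(\<integral>\<^sup>+ y. (f y)\<^sup>2 \<partial>lborel) = (\<integral>\<^sup>+ y. ennreal q * (N y * indicator G y) \<partial>lborel)"
      using q by (intro nn_integral_cong)
        (auto simp: f_def N_def G_def power_mult_distrib ennreal_power split: split_indicator)
    also have "\<dots> = ennreal q * g"
      unfolding g_def by (rule nn_integral_cmult) measurable
    also have "\<dots> = ennreal (q * g')" using q g' by (simp add: ennreal_mult)
    also have "\<dots> \<le> 1" using qg by simp
    finally show "(\<integral>\<^sup>+ y. (f y)\<^sup>2 \<partial>lborel) \<le> 1" .
    fix x assume x: "x \<in> G"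
    then show "0 \<le> w x" using q by (simp add: w_def G_def)
    have "ennreal (2 * pi * w x) = ennreal (sqrt q) * ennreal (2 * pi * (\<bar>u x\<bar> - A))"
      using x q by (subst ennreal_mult[symmetric]) (auto simp: w_def G_def mult_ac)
    also have "\<dots> \<le> ennreal (sqrt q) * riesz (\<lambda>y. ennreal (norm (grad u y)) * indicator {y. A < \<bar>u y\<bar>} y) x"
      using x by (intro mult_left_mono ray_representation[OF u A0]) (auto simp: G_def)
    also have "\<dots> = riesz f x"
      unfolding f_def by (rule riesz_cmult[symmetric]) measurable
    finally show "ennreal (2 * pi * w x) \<le> riesz f x" .
  qed simp_all
  have on_G: "exp (4 * pi * (u x)\<^sup>2) - 1 \<le> exp (8 * pi * C) * exp (4 * pi * (w x)\<^sup>2)" for x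
  proof -
    define v where "v = \<bar>u x\<bar> - A"
    \<comment> \<open>The first term on the right is the gain built into \<open>w\<close>.\<close>
    have "2 * v * A \<le> v\<^sup>2 * A\<^sup>2 / C + C"
    proof -
      have "0 \<le> (v * A - C)\<^sup>2 / C" using C by simp
      also have "\<dots> = v\<^sup>2 * A\<^sup>2 / C - 2 * v * A + C"
        using C by (simp add: power2_eq_square field_simps)
      finally show ?thesis by simp
    qed
    moreover have "(u x)\<^sup>2 = v\<^sup>2 + 2 * v * A + A\<^sup>2"
    proof -
      have "(u x)\<^sup>2 = (v + A)\<^sup>2" by (simp add: v_def)
      then show ?thesis by (simp add: power2_eq_square algebra_simps)
    qed
    moreover have "(w x)\<^sup>2 = v\<^sup>2 + v\<^sup>2 * A\<^sup>2 / C"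
    proof -
      have "w x = sqrt q * v" by (simp only: w_def v_def)
      then have "(w x)\<^sup>2 = q * v\<^sup>2" using q by (simp add: power_mult_distrib)
      then show ?thesis by (simp add: q_def algebra_simps)
    qed
    ultimately have "(u x)\<^sup>2 \<le> (w x)\<^sup>2 + 2 * C" using AC by simp
    then have "4 * pi * (u x)\<^sup>2 \<le> 4 * pi * ((w x)\<^sup>2 + 2 * C)" by (intro mult_left_mono) auto
    then have "exp (4 * pi * (u x)\<^sup>2) \<le> exp (8 * pi * C + 4 * pi * (w x)\<^sup>2)"
      by (simp add: algebra_simps)
    then show ?thesis by (simp add: exp_add)
  qed
  have off_G: "exp (4 * pi * (u x)\<^sup>2) - 1 \<le> 4 * pi * exp (4 * pi * C) * (u x)\<^sup>2" if "x \<notin> G" for x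
  proof -
    define s where "s = 4 * pi * (u x)\<^sup>2"
    have "exp s * (1 - s) \<le> exp s * exp (- s)"
      using exp_ge_add_one_self[of "- s"] by (intro mult_left_mono) auto
    then have "exp s - 1 \<le> s * exp s" by (simp add: exp_minus algebra_simps)
    also have "\<dots> \<le> s * exp (4 * pi * C)"
    proof (intro mult_left_mono)
      have "(u x)\<^sup>2 \<le> A\<^sup>2" using that A0 by (simp add: G_def not_less abs_le_square_iff[symmetric])
      then show "exp s \<le> exp (4 * pi * C)" using AC by (simp add: s_def)
    qed (simp add: s_def)
    finally show ?thesis by (simp add: s_def mult_ac)
  qed
  have "(\<integral>\<^sup>+ x. ennreal (exp (4 * pi * (u x)\<^sup>2) - 1) \<partial>lborel)
    \<le> (\<integral>\<^sup>+ x. ennreal (exp (8 * pi * C)) * (ennreal (exp (4 * pi * (w x)\<^sup>2)) * indicator G x) + ennreal (4 * pi * exp (4 * pi * C)) * ennreal ((u x)\<^sup>2) \<partial>lborel)"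
  proof (rule nn_integral_mono)
    fix x
    show "ennreal (exp (4 * pi * (u x)\<^sup>2) - 1) \<le> ennreal (exp (8 * pi * C)) * (ennreal (exp (4 * pi * (w x)\<^sup>2)) * indicator G x) + ennreal (4 * pi * exp (4 * pi * C)) * ennreal ((u x)\<^sup>2)"
    proof (cases "x \<in> G")
      case True
      have "ennreal (exp (4 * pi * (u x)\<^sup>2) - 1) \<le> ennreal (exp (8 * pi * C)) * ennreal (exp (4 * pi * (w x)\<^sup>2))"
        using on_G[of x] by (subst ennreal_mult[symmetric]) (auto intro: ennreal_leI)
      then show ?thesis using True by (simp add: add_increasing2)
    next
      case False
      have "ennreal (exp (4 * pi * (u x)\<^sup>2) - 1) \<le> ennreal (4 * pi * exp (4 * pi * C)) * ennreal ((u x)\<^sup>2)"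
        using off_G[OF False] by (subst ennreal_mult[symmetric]) (auto intro: ennreal_leI)
      then show ?thesis using False by simp
    qed
  qed
  also have "\<dots> = ennreal (exp (8 * pi * C)) * (\<integral>\<^sup>+ x\<in>G. ennreal (exp (4 * pi * (w x)\<^sup>2)) \<partial>lborel) + ennreal (4 * pi * exp (4 * pi * C)) * (\<integral>\<^sup>+ x. ennreal ((u x)\<^sup>2) \<partial>lborel)"
    by (subst nn_integral_add) (simp_all add: nn_integral_cmult)
  also have "\<dots> \<le> ennreal (exp (8 * pi * C)) * ennreal (exp 1 * (level_const * 1)) + ennreal (4 * pi * exp (4 * pi * C)) * ennreal C"
    by (intro add_mono mult_left_mono expw L2) auto
  also have "\<dots> = ennreal (exp (8 * pi * C) * (exp 1 * level_const) + 4 * pi * exp (4 * pi * C) * C)"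
  proof -
    have "0 \<le> level_const"
      unfolding level_const_def by (intro mult_nonneg_nonneg suminf_nonneg summable_k_exp) auto
    then show ?thesis using C by (simp only: mult_1_right) (subst ennreal_mult[symmetric] | subst ennreal_plus[symmetric] | simp)+
  qed
  finally show ?thesis .
qed

lemma nn_integral_lebesgue_on_le:
  fixes f :: "'a::euclidean_space \<Rightarrow> ennreal"
  assumes "open \<Omega>"
  shows "(\<integral>\<^sup>+ x. f x \<partial>lebesgue_on \<Omega>) \<le> (\<integral>\<^sup>+ x. f x \<partial>lborel)"
proof -
  have "(\<integral>\<^sup>+ x. f x \<partial>lebesgue_on \<Omega>) = (\<integral>\<^sup>+ x. f x * indicator \<Omega> x \<partial>lebesgue)"
    using assms(1) by (simp add: nn_integral_restrict_space)
  also have "\<dots> \<le> (\<integral>\<^sup>+ x. f x \<partial>lebesgue)"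
    by (intro nn_integral_mono) (auto split: split_indicator)
  also have "\<dots> = (\<integral>\<^sup>+ x. f x \<partial>lborel)"
    by (rule nn_integral_completion)
  finally show ?thesis .
qed

text \<open>Approximate \<open>u\<close> by test functions in the \<open>H1\<close> norm, divide them by
  \<open>1 + \<epsilon>\<close> to restore energy at most one, pass to an almost everywhere convergent
  subsequence and apply Fatou's lemma.\<close>

lemma moser_trudinger_H1_0:
  fixes \<Omega> :: "(real^2) set"
  assumes op: "open \<Omega>"
    and test: "\<And>\<psi>. \<psi> \<in> test_functions \<Omega> \<Longrightarrow> (\<integral>x. (norm (grad \<psi> x))\<^sup>2 \<partial>lborel) \<le> 1 \<Longrightarrow>
       (\<integral>\<^sup>+ x. ennreal (exp (4 * pi * (\<psi> x)\<^sup>2) - 1) \<partial>lborel) \<le> S"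
    and u: "u \<in> H1_0 \<Omega>" and D: "dirichlet \<Omega> u \<le> 1"
  shows "(\<integral>\<^sup>+ x. ennreal (exp (4 * pi * (u x)\<^sup>2) - 1) \<partial>lebesgue_on \<Omega>) \<le> S"
proof -
  define \<epsilon> where "\<epsilon> = (\<lambda>n. inverse (real (Suc n)))"
  have \<epsilon>: "0 < \<epsilon> n" for n by (simp add: \<epsilon>_def)
  have \<epsilon>0: "\<epsilon> \<longlonglongrightarrow> 0" unfolding \<epsilon>_def by (rule LIMSEQ_inverse_real_of_nat)
  have uH: "u \<in> H1 \<Omega>" and "\<forall>n. \<exists>\<phi>\<in>test_functions \<Omega>. H1_norm \<Omega> (\<lambda>x. u x - \<phi> x) < \<epsilon> n"
    using u \<epsilon> by (auto simp: H1_0_def)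
  then obtain \<phi> where \<phi>: "\<And>n. \<phi> n \<in> test_functions \<Omega>" and close: "\<And>n. H1_norm \<Omega> (\<lambda>x. u x - \<phi> n x) < \<epsilon> n"
    by metis
  define g where "g = weak_grad \<Omega> u"
  have uL: "u \<in> L2 \<Omega>" and gL: "g \<in> L2 \<Omega>" and ug: "has_weak_gradient \<Omega> u g"
    using uH has_weak_gradient_weak_grad by (auto simp: H1_def g_def)
  have [measurable]: "u \<in> borel_measurable (lebesgue_on \<Omega>)" using uL by (simp add: L2_def)
  have [measurable]: "\<phi> n \<in> borel_measurable (lebesgue_on \<Omega>)" for n
    using test_function_L2(1)[OF op \<phi>] by (simp add: L2_def)
  define a where "a = (\<lambda>n. \<integral>x. \<bar>u x - \<phi> n x\<bar>\<^sup>2 \<partial>lebesgue_on \<Omega>)"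
  define b where "b = (\<lambda>n. \<integral>x. (norm (g x - grad (\<phi> n) x))\<^sup>2 \<partial>lebesgue_on \<Omega>)"
  have dL: "(\<lambda>x. g x - grad (\<phi> n) x) \<in> L2 \<Omega>" for n
    by (rule L2_diff[OF gL test_function_L2(4)[OF op \<phi>]])
  have udL: "(\<lambda>x. u x - \<phi> n x) \<in> L2 \<Omega>" for n
    by (rule L2_diff[OF uL test_function_L2(1)[OF op \<phi>]])
  have ab0: "0 \<le> a n" "0 \<le> b n" for n
    unfolding a_def b_def by (auto intro!: integral_nonneg_AE)
  have ab: "a n + b n < (\<epsilon> n)\<^sup>2" for n
  proof -
    have "dirichlet \<Omega> (\<lambda>x. u x - \<phi> n x) = b n"
      unfolding b_def
      by (rule dirichlet_eq(1)[OF op has_weak_gradient_diff[OF op ug test_function_weak_gradient[OF op \<phi>]] dL])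
    then have "sqrt (a n + b n) < \<epsilon> n" using close[of n] by (simp add: H1_norm_def a_def)
    then have "(sqrt (a n + b n))\<^sup>2 < (\<epsilon> n)\<^sup>2" using ab0 by (intro power_strict_mono) auto
    then show ?thesis using ab0[of n] by simp
  qed
  have energy: "(\<integral>x. (norm (grad (\<phi> n) x))\<^sup>2 \<partial>lborel) \<le> (1 + \<epsilon> n)\<^sup>2" for n
  proof -
    have ig: "integrable (lebesgue_on \<Omega>) (\<lambda>x. (norm (g x))\<^sup>2)" and id: "integrable (lebesgue_on \<Omega>) (\<lambda>x. (norm (g x - grad (\<phi> n) x))\<^sup>2)"
      and ip: "integrable (lebesgue_on \<Omega>) (\<lambda>x. (norm (grad (\<phi> n) x))\<^sup>2)"
      using gL dL[of n] test_function_L2(4)[OF op \<phi>, of n] by (simp_all add: L2_def)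
    have "(\<integral>x. (norm (grad (\<phi> n) x))\<^sup>2 \<partial>lborel) = (\<integral>x. (norm (grad (\<phi> n) x))\<^sup>2 \<partial>lebesgue_on \<Omega>)"
      by (rule test_function_L2(6)[OF op \<phi>, symmetric])
    also have "\<dots> \<le> (\<integral>x. (1 + \<epsilon> n) * (norm (g x))\<^sup>2 + (1 + 1 / \<epsilon> n) * (norm (g x - grad (\<phi> n) x))\<^sup>2 \<partial>lebesgue_on \<Omega>)"
    proof (rule integral_mono)
      show "(norm (grad (\<phi> n) x))\<^sup>2 \<le> (1 + \<epsilon> n) * (norm (g x))\<^sup>2 + (1 + 1 / \<epsilon> n) * (norm (g x - grad (\<phi> n) x))\<^sup>2" for x
        using norm_diff_square_le[OF \<epsilon>, of "g x" "g x - grad (\<phi> n) x" n] by simp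
    qed (use ig id ip in auto)
    also have "\<dots> = (1 + \<epsilon> n) * dirichlet \<Omega> u + (1 + 1 / \<epsilon> n) * b n"
      using ig id by (simp add: dirichlet_def g_def b_def)
    also have "\<dots> \<le> (1 + \<epsilon> n) * 1 + (1 + 1 / \<epsilon> n) * (\<epsilon> n)\<^sup>2"
      using D ab[of n] ab0[of n] \<epsilon>[of n] by (intro add_mono mult_left_mono) auto
    also have "\<dots> = (1 + \<epsilon> n)\<^sup>2"
      using \<epsilon>[of n] by (simp add: power2_eq_square field_simps)
    finally show ?thesis .
  qed
  define \<psi> where "\<psi> = (\<lambda>n x. (1 / (1 + \<epsilon> n)) * \<phi> n x)"
  have \<psi>: "\<psi> n \<in> test_functions \<Omega>" for n
    unfolding \<psi>_def by (rule test_functions_scale[OF \<phi>])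
  have [measurable]: "\<psi> n \<in> borel_measurable (lebesgue_on \<Omega>)" for n
    unfolding \<psi>_def by measurable
  have \<psi>S: "(\<integral>\<^sup>+ x. ennreal (exp (4 * pi * (\<psi> n x)\<^sup>2) - 1) \<partial>lebesgue_on \<Omega>) \<le> S" for n
  proof -
    have [measurable]: "\<psi> n \<in> borel_measurable borel" by (rule measurable_test_function[OF \<psi>])
    have "(\<integral>x. (norm (grad (\<psi> n) x))\<^sup>2 \<partial>lborel) = (1 / (1 + \<epsilon> n))\<^sup>2 * (\<integral>x. (norm (grad (\<phi> n) x))\<^sup>2 \<partial>lborel)"
      unfolding \<psi>_def grad_scale[OF \<phi>] by (simp add: power_mult_distrib power_divide)
    also have "\<dots> \<le> (1 / (1 + \<epsilon> n))\<^sup>2 * (1 + \<epsilon> n)\<^sup>2"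
      by (intro mult_left_mono energy) simp
    also have "\<dots> = 1" using \<epsilon>[of n] by (simp add: power_mult_distrib[symmetric])
    finally have "(\<integral>\<^sup>+ x. ennreal (exp (4 * pi * (\<psi> n x)\<^sup>2) - 1) \<partial>lborel) \<le> S"
      by (rule test[OF \<psi>])
    moreover have "(\<integral>\<^sup>+ x. ennreal (exp (4 * pi * (\<psi> n x)\<^sup>2) - 1) \<partial>lebesgue_on \<Omega>) \<le> (\<integral>\<^sup>+ x. ennreal (exp (4 * pi * (\<psi> n x)\<^sup>2) - 1) \<partial>lborel)"
      by (rule nn_integral_lebesgue_on_le[OF op])
    ultimately show ?thesis by (rule order_trans[rotated])
  qed
  have a_lim: "(\<lambda>n. \<integral>x. norm (\<bar>u x - \<phi> n x\<bar>\<^sup>2) \<partial>lebesgue_on \<Omega>) \<longlonglongrightarrow> 0"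
  proof (rule tendsto_sandwich[of "\<lambda>_. 0" _ _ "\<lambda>n. (\<epsilon> n)\<^sup>2"])
    have "(\<integral>x. norm (\<bar>u x - \<phi> n x\<bar>\<^sup>2) \<partial>lebesgue_on \<Omega>) = a n" for n by (simp add: a_def)
    then show "\<forall>\<^sub>F n in sequentially. (\<integral>x. norm (\<bar>u x - \<phi> n x\<bar>\<^sup>2) \<partial>lebesgue_on \<Omega>) \<le> (\<epsilon> n)\<^sup>2"
      "\<forall>\<^sub>F n in sequentially. 0 \<le> (\<integral>x. norm (\<bar>u x - \<phi> n x\<bar>\<^sup>2) \<partial>lebesgue_on \<Omega>)"
      using ab ab0 by (auto intro!: always_eventually intro: less_imp_le le_less_trans[rotated] add_increasing2) (smt (verit))
    show "(\<lambda>n. (\<epsilon> n)\<^sup>2) \<longlonglongrightarrow> 0" using tendsto_power[OF \<epsilon>0, of 2] by simp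
  qed simp
  have a_int: "integrable (lebesgue_on \<Omega>) (\<lambda>x. \<bar>u x - \<phi> n x\<bar>\<^sup>2)" for n
    using udL[of n] by (simp add: L2_def)
  obtain r :: "nat \<Rightarrow> nat" where r: "strict_mono r"
    and AE0: "AE x in lebesgue_on \<Omega>. (\<lambda>n. \<bar>u x - \<phi> (r n) x\<bar>\<^sup>2) \<longlonglongrightarrow> 0"
    using tendsto_L1_AE_subseq[OF a_int a_lim] by blast
  have lim: "AE x in lebesgue_on \<Omega>. (\<lambda>n. ennreal (exp (4 * pi * (\<psi> (r n) x)\<^sup>2) - 1)) \<longlonglongrightarrow> ennreal (exp (4 * pi * (u x)\<^sup>2) - 1)"
    using AE0
  proof eventually_elim
    case (elim x)
    have "(\<lambda>n. sqrt (\<bar>u x - \<phi> (r n) x\<bar>\<^sup>2)) \<longlonglongrightarrow> sqrt 0" by (intro tendsto_real_sqrt elim)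
    then have "(\<lambda>n. u x - \<phi> (r n) x) \<longlonglongrightarrow> 0" by (simp add: tendsto_rabs_zero_iff)
    then have "(\<lambda>n. u x - (u x - \<phi> (r n) x)) \<longlonglongrightarrow> u x - 0" by (intro tendsto_intros)
    then have 1: "(\<lambda>n. \<phi> (r n) x) \<longlonglongrightarrow> u x" by simp
    have "(\<lambda>n. \<epsilon> (r n)) \<longlonglongrightarrow> 0" using LIMSEQ_subseq_LIMSEQ[OF \<epsilon>0 r] by (simp add: o_def)
    then have "(\<lambda>n. \<psi> (r n) x) \<longlonglongrightarrow> (1 / (1 + 0)) * u x"
      unfolding \<psi>_def by (intro tendsto_intros 1) auto
    then have "(\<lambda>n. \<psi> (r n) x) \<longlonglongrightarrow> u x" by simp
    then show ?case by (intro tendsto_intros)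
  qed
  have "(\<integral>\<^sup>+ x. ennreal (exp (4 * pi * (u x)\<^sup>2) - 1) \<partial>lebesgue_on \<Omega>)
     = (\<integral>\<^sup>+ x. liminf (\<lambda>n. ennreal (exp (4 * pi * (\<psi> (r n) x)\<^sup>2) - 1)) \<partial>lebesgue_on \<Omega>)"
  proof (rule nn_integral_cong_AE)
    show "AE x in lebesgue_on \<Omega>. ennreal (exp (4 * pi * (u x)\<^sup>2) - 1) = liminf (\<lambda>n. ennreal (exp (4 * pi * (\<psi> (r n) x)\<^sup>2) - 1))"
      using lim by eventually_elim (rule lim_imp_Liminf[symmetric], simp_all)
  qed
  also have "\<dots> \<le> liminf (\<lambda>n. \<integral>\<^sup>+ x. ennreal (exp (4 * pi * (\<psi> (r n) x)\<^sup>2) - 1) \<partial>lebesgue_on \<Omega>)"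
    by (rule nn_integral_liminf) measurable
  also have "\<dots> \<le> S"
    by (rule Liminf_le) (use \<psi>S in auto)
  finally show ?thesis .
qed

section \<open>Rayleigh quotients and the equivalence\<close>

text \<open>Translation and dilation move a fixed test function into an arbitrary disc.\<close>

lemma test_function_compose_affine:
  fixes \<phi> :: "'a::euclidean_space \<Rightarrow> real"
  assumes \<phi>: "\<phi> \<in> test_functions U" and s: "0 < s" and sub: "\<And>y. c + s *\<^sub>R y \<in> U \<Longrightarrow> y \<in> \<Omega>"
  shows "(\<lambda>y. \<phi> (c + s *\<^sub>R y)) \<in> test_functions \<Omega>"
    "grad (\<lambda>y. \<phi> (c + s *\<^sub>R y)) x = s *\<^sub>R grad \<phi> (c + s *\<^sub>R x)"
proof -
  define K where "K = closure {x. \<phi> x \<noteq> 0}"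
  define K' where "K' = (\<lambda>z. (1 / s) *\<^sub>R (z - c)) ` K"
  have K: "compact K" "K \<subseteq> U" using test_functionD(4,5)[OF \<phi>] by (auto simp: K_def)
  have K': "compact K'"
    unfolding K'_def by (intro compact_continuous_image K continuous_intros)
  have "K' \<subseteq> \<Omega>"
  proof
    fix y assume "y \<in> K'"
    then obtain z where "z \<in> K" "y = (1 / s) *\<^sub>R (z - c)" by (auto simp: K'_def)
    then have "c + s *\<^sub>R y = z" using s by simp
    then show "y \<in> \<Omega>" using sub[of y] K(2) \<open>z \<in> K\<close> by auto
  qed
  have "closure {y. \<phi> (c + s *\<^sub>R y) \<noteq> 0} \<subseteq> K'"
  proof (rule closure_minimal)
    show "{y. \<phi> (c + s *\<^sub>R y) \<noteq> 0} \<subseteq> K'"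
    proof
      fix y assume "y \<in> {y. \<phi> (c + s *\<^sub>R y) \<noteq> 0}"
      then have "c + s *\<^sub>R y \<in> K" using closure_subset[of "{x. \<phi> x \<noteq> 0}"] by (auto simp: K_def)
      moreover have "y = (1 / s) *\<^sub>R (c + s *\<^sub>R y - c)" using s by simp
      ultimately show "y \<in> K'" unfolding K'_def by (rule rev_image_eqI)
    qed
    show "closed K'" using K' by (rule compact_imp_closed)
  qed
  moreover have "bounded (closure {y. \<phi> (c + s *\<^sub>R y) \<noteq> 0})"
    using bounded_subset[OF compact_imp_bounded[OF K'] calculation] .
  moreover have "\<forall>k. C_k k (\<lambda>y. \<phi> (c + s *\<^sub>R y))"
    using \<phi> by (intro allI C_k_compose_affine) (simp add: test_functions_def)
  ultimately show "(\<lambda>y. \<phi> (c + s *\<^sub>R y)) \<in> test_functions \<Omega>"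
    using \<open>K' \<subseteq> \<Omega>\<close> unfolding test_functions_def mem_Collect_eq compact_eq_bounded_closed by auto
  have "((\<lambda>y. c + s *\<^sub>R y) has_derivative (\<lambda>v. s *\<^sub>R v)) (at x)"
    by (auto intro!: derivative_eq_intros)
  from frechet_derivative_at[OF has_derivative_compose[OF this test_function_derivative[OF \<phi>]], symmetric]
  show "grad (\<lambda>y. \<phi> (c + s *\<^sub>R y)) x = s *\<^sub>R grad \<phi> (c + s *\<^sub>R x)"
    unfolding grad_def by (simp add: frechet_eq_inner_grad[OF \<phi>] scaleR_sum_right)
qed

lemma integral_compose_affine_real2:
  fixes f :: "real^2 \<Rightarrow> real"
  assumes [measurable]: "f \<in> borel_measurable borel" and s: "0 < s"
  shows "(\<integral>x. f x \<partial>lborel) = s\<^sup>2 * (\<integral>x. f (c + s *\<^sub>R x) \<partial>lborel)"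
proof -
  have "(\<integral>x. f x \<partial>lborel) = (\<integral>x. f x \<partial>density (distr lborel borel (\<lambda>x. c + s *\<^sub>R x)) (\<lambda>_. ennreal (s\<^sup>2)))"
    using lborel_affine[of s c] s by (simp add: ennreal_power)
  also have "\<dots> = (\<integral>x. s\<^sup>2 *\<^sub>R f x \<partial>distr lborel borel (\<lambda>x. c + s *\<^sub>R x))"
    by (rule integral_density) simp_all
  also have "\<dots> = (\<integral>x. s\<^sup>2 *\<^sub>R f (c + s *\<^sub>R x) \<partial>lborel)"
    by (rule integral_distr) simp_all
  finally show ?thesis by simp
qed

lemma bump_in_unit_ball:
  obtains \<Phi> :: "real^2 \<Rightarrow> real" where "\<Phi> \<in> test_functions (ball 0 1)" "0 < (\<integral>x. (\<Phi> x)\<^sup>2 \<partial>lborel)"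
proof -
  define a where "a = (1/4) *\<^sub>R (One :: real^2)"
  define \<Phi> where "\<Phi> = bump (- a) a 1"
  have sub: "cbox (- a) a \<subseteq> ball 0 1"
  proof
    fix x assume x: "x \<in> cbox (- a) a"
    have "\<bar>x $ i\<bar> \<le> 1/4" for i
      using x by (simp add: a_def mem_box_cart abs_le_iff cart_eq_inner_axis axis_in_Basis_iff inner_not_same_Basis) (drule spec[of _ i], linarith)
    then have "\<bar>x $ 1\<bar> + \<bar>x $ 2\<bar> \<le> 1/4 + 1/4" by (intro add_mono)
    then show "x \<in> ball 0 1"
      using norm_le_l1_cart[of x] by (simp add: UNIV_2)
  qed
  have \<Phi>: "\<Phi> \<in> test_functions (ball 0 1)" unfolding \<Phi>_def by (rule bump_test_function[OF sub])
  have i: "integrable lborel (\<lambda>x. (\<Phi> x)\<^sup>2)" by (rule test_function_L2(2)[OF open_ball \<Phi>])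
  have "(\<integral>x. (\<Phi> x)\<^sup>2 \<partial>lborel) \<noteq> 0"
  proof
    assume "(\<integral>x. (\<Phi> x)\<^sup>2 \<partial>lborel) = 0"
    then have "AE x in lborel. (\<Phi> x)\<^sup>2 = 0"
      using integral_nonneg_eq_0_iff_AE[OF i] by simp
    then have "AE x in lborel. x \<notin> box (- a) a"
      by eventually_elim (use bump_pos[of 1 _ "- a" a] in \<open>force simp: \<Phi>_def\<close>)
    then have "emeasure lborel (box (- a) a) = 0"
      by (subst (asm) AE_iff_measurable[of "box (- a) a"]) auto
    moreover have "emeasure lborel (box (- a) a) = ennreal (\<Prod>b\<in>(Basis::(real^2) set). 1/2)"
      by (subst emeasure_lborel_box) (auto simp: a_def inner_diff_left intro!: arg_cong[of _ _ ennreal] prod.cong)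
    ultimately show False by (simp add: prod_pos)
  qed
  moreover have "0 \<le> (\<integral>x. (\<Phi> x)\<^sup>2 \<partial>lborel)" by (intro integral_nonneg_AE) simp
  ultimately have "0 < (\<integral>x. (\<Phi> x)\<^sup>2 \<partial>lborel)" by linarith
  then show ?thesis by (rule that[OF \<Phi>])
qed

text \<open>In dimension two the Dirichlet energy is invariant under dilations, whereas the squared
  \<open>L\<^sup>2\<close> norm scales with \<open>r\<^sup>2\<close>.\<close>

lemma ball_rayleigh_quotient:
  "\<exists>K\<ge>0. \<forall>\<Omega> (x::real^2) r. open \<Omega> \<longrightarrow> 0 < r \<longrightarrow> ball x r \<subseteq> \<Omega> \<longrightarrow>
     (\<exists>u\<in>test_functions \<Omega>. (\<integral>x. (u x)\<^sup>2 \<partial>lborel) = 1 \<and> (\<integral>x. (norm (grad u x))\<^sup>2 \<partial>lborel) = K / r\<^sup>2)"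
proof -
  obtain \<Phi> :: "real^2 \<Rightarrow> real" where \<Phi>: "\<Phi> \<in> test_functions (ball 0 1)" and pos: "0 < (\<integral>x. (\<Phi> x)\<^sup>2 \<partial>lborel)"
    by (rule bump_in_unit_ball)
  define a where "a = (\<integral>x. (\<Phi> x)\<^sup>2 \<partial>lborel)"
  define b where "b = (\<integral>x. (norm (grad \<Phi> x))\<^sup>2 \<partial>lborel)"
  have a: "0 < a" using pos by (simp add: a_def)
  have b: "0 \<le> b" unfolding b_def by (intro integral_nonneg_AE) simp
  have [measurable]: "\<Phi> \<in> borel_measurable borel" "grad \<Phi> \<in> borel_measurable borel"
    by (rule measurable_test_function[OF \<Phi>], rule measurable_grad_test_function[OF \<Phi>])
  show ?thesis
  proof (intro exI[of _ "b / a"] conjI allI impI)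
    fix \<Omega> and x :: "real^2" and r :: real
    assume \<Omega>: "open \<Omega>" "0 < r" "ball x r \<subseteq> \<Omega>"
    define s where "s = 1 / r"
    define c where "c = - (s *\<^sub>R x)"
    define \<phi> where "\<phi> = (\<lambda>y. \<Phi> (c + s *\<^sub>R y))"
    have s: "0 < s" using \<Omega> by (simp add: s_def)
    have sub: "y \<in> \<Omega>" if "c + s *\<^sub>R y \<in> ball 0 1" for y
    proof -
      have "c + s *\<^sub>R y = s *\<^sub>R (y - x)" by (simp add: c_def algebra_simps)
      then have "s * norm (y - x) < 1" using that s by simp
      then have "dist x y < r" using \<Omega>(2) by (simp add: s_def dist_norm norm_minus_commute field_simps)
      then show ?thesis using \<Omega>(3) by auto
    qed
    have \<phi>t: "\<phi> \<in> test_functions \<Omega>"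
      unfolding \<phi>_def by (rule test_function_compose_affine(1)[OF \<Phi> s sub])
    have grad_\<phi>: "grad \<phi> y = s *\<^sub>R grad \<Phi> (c + s *\<^sub>R y)" for y
      unfolding \<phi>_def by (rule test_function_compose_affine(2)[OF \<Phi> s sub])
    have I1: "a = s\<^sup>2 * (\<integral>y. (\<phi> y)\<^sup>2 \<partial>lborel)"
      unfolding a_def \<phi>_def by (rule integral_compose_affine_real2[OF _ s]) measurable
    have I2: "(\<integral>y. (norm (grad \<phi> y))\<^sup>2 \<partial>lborel) = b"
    proof -
      have "b = s\<^sup>2 * (\<integral>y. (norm (grad \<Phi> (c + s *\<^sub>R y)))\<^sup>2 \<partial>lborel)"
        unfolding b_def by (rule integral_compose_affine_real2[OF _ s]) measurable
      then show ?thesis unfolding grad_\<phi> by (simp add: power_mult_distrib)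
    qed
    define t where "t = s / sqrt a"
    define u where "u = (\<lambda>y. t * \<phi> y)"
    have t2: "t\<^sup>2 = s\<^sup>2 / a" using a by (simp add: t_def power_divide)
    have "u \<in> test_functions \<Omega>" unfolding u_def by (rule test_functions_scale[OF \<phi>t])
    moreover have "(\<integral>x. (u x)\<^sup>2 \<partial>lborel) = 1"
    proof -
      have "(\<integral>x. (u x)\<^sup>2 \<partial>lborel) = t\<^sup>2 * (\<integral>y. (\<phi> y)\<^sup>2 \<partial>lborel)" by (simp add: u_def power_mult_distrib)
      also have "\<dots> = a / a" by (simp only: t2 times_divide_eq_left I1[symmetric])
      also have "\<dots> = 1" using a by simp
      finally show ?thesis .
    qed
    moreover have "(\<integral>x. (norm (grad u x))\<^sup>2 \<partial>lborel) = b / a / r\<^sup>2"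
    proof -
      have "(\<integral>x. (norm (grad u x))\<^sup>2 \<partial>lborel) = t\<^sup>2 * (\<integral>y. (norm (grad \<phi> y))\<^sup>2 \<partial>lborel)"
        unfolding u_def grad_scale[OF \<phi>t] by (simp add: power_mult_distrib)
      also have "\<dots> = b / a / r\<^sup>2" unfolding I2 t2 by (simp add: s_def power_divide)
      finally show ?thesis .
    qed
    ultimately show "\<exists>u\<in>test_functions \<Omega>. (\<integral>x. (u x)\<^sup>2 \<partial>lborel) = 1 \<and> (\<integral>x. (norm (grad u x))\<^sup>2 \<partial>lborel) = b / a / r\<^sup>2"
      by blast
  qed (use a b in simp)
qed

text \<open>The set whose infimum is \<open>lambda1\<close>, with the integrals taken over the whole plane,
  where test functions are extended by zero.\<close>

definition rayleigh_values :: "(real^2) set \<Rightarrow> real set" where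
  "rayleigh_values \<Omega> = {\<integral>x. (norm (grad u x))\<^sup>2 \<partial>lborel | u. u \<in> test_functions \<Omega> \<and> (\<integral>x. (u x)\<^sup>2 \<partial>lborel) = 1}"

lemma lambda1_eq_Inf:
  assumes op: "open \<Omega>"
  shows "lambda1 \<Omega> = Inf (rayleigh_values \<Omega>)"
proof -
  have "{integral\<^sup>L (lebesgue_on \<Omega>) (\<lambda>x. (norm (grad u x))\<^sup>2) | u.
            u \<in> test_functions \<Omega> \<and> integral\<^sup>L (lebesgue_on \<Omega>) (\<lambda>x. \<bar>u x\<bar>\<^sup>2) = 1} = rayleigh_values \<Omega>"
    unfolding rayleigh_values_def
  proof (rule Collect_cong, rule ex_cong1)
    fix D and u :: "real^2 \<Rightarrow> real"
    show "(D = (\<integral>x. (norm (grad u x))\<^sup>2 \<partial>lebesgue_on \<Omega>) \<and> u \<in> test_functions \<Omega> \<and> (\<integral>x. \<bar>u x\<bar>\<^sup>2 \<partial>lebesgue_on \<Omega>) = 1)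
       = (D = (\<integral>x. (norm (grad u x))\<^sup>2 \<partial>lborel) \<and> u \<in> test_functions \<Omega> \<and> (\<integral>x. (u x)\<^sup>2 \<partial>lborel) = 1)"
    proof (cases "u \<in> test_functions \<Omega>")
      case True
      show ?thesis unfolding power2_abs test_function_L2(3,6)[OF op True] ..
    qed simp
  qed
  then show ?thesis by (simp only: lambda1_def)
qed

lemma rayleigh_values_nonneg: "x \<in> rayleigh_values \<Omega> \<Longrightarrow> 0 \<le> x"
  by (auto simp: rayleigh_values_def intro!: integral_nonneg_AE)

text \<open>An energy below \<open>4 pi / (S + 1)\<close> would leave room for the multiple \<open>t u\<close>
  with \<open>4 pi t\<^sup>2 = S + 1\<close>, whose exponential integral exceeds \<open>S\<close>. That some
  test function has unit norm matters too: the infimum of the empty set carries no information.\<close>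

lemma moser_trudinger_imp_lambda1_pos:
  fixes \<Omega> :: "(real^2) set"
  assumes op: "open \<Omega>" and ne: "\<Omega> \<noteq> {}"
    and fin: "(SUP u\<in>{u \<in> H1_0 \<Omega>. dirichlet \<Omega> u \<le> 1}.
             \<integral>\<^sup>+ x. ennreal (exp (4 * pi * (u x)\<^sup>2) - 1) \<partial>lebesgue_on \<Omega>) < \<infinity>"
  shows "lambda1 \<Omega> > 0"
proof -
  let ?J = "\<lambda>u. \<integral>\<^sup>+ x. ennreal (exp (4 * pi * (u x)\<^sup>2) - 1) \<partial>lebesgue_on \<Omega>"
  obtain S where S: "0 \<le> S" "(SUP u\<in>{u \<in> H1_0 \<Omega>. dirichlet \<Omega> u \<le> 1}. ?J u) = ennreal S"
    using fin by (cases "SUP u\<in>{u \<in> H1_0 \<Omega>. dirichlet \<Omega> u \<le> 1}. ?J u") auto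
  have bound: "?J u \<le> ennreal S" if "u \<in> H1_0 \<Omega>" "dirichlet \<Omega> u \<le> 1" for u
    unfolding S(2)[symmetric] by (rule SUP_upper) (use that in simp)
  have "4 * pi / (S + 1) \<le> D" if D_in: "D \<in> rayleigh_values \<Omega>" for D
  proof (rule ccontr)
    assume "\<not> 4 * pi / (S + 1) \<le> D"
    then have D: "D < 4 * pi / (S + 1)" by simp
    obtain u where u: "u \<in> test_functions \<Omega>" "(\<integral>x. (u x)\<^sup>2 \<partial>lborel) = 1" "D = (\<integral>x. (norm (grad u x))\<^sup>2 \<partial>lborel)"
      using D_in unfolding rayleigh_values_def by blast
    define t where "t = sqrt ((S + 1) / (4 * pi))"
    have t2: "t\<^sup>2 = (S + 1) / (4 * pi)" using S(1) by (simp add: t_def)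
    define v where "v = (\<lambda>x. t * u x)"
    have v: "v \<in> test_functions \<Omega>" unfolding v_def by (rule test_functions_scale[OF u(1)])
    have "dirichlet \<Omega> v = t\<^sup>2 * D"
      unfolding dirichlet_test_function[OF op v] u(3) unfolding v_def grad_scale[OF u(1)]
      by (simp add: power_mult_distrib)
    also have "\<dots> \<le> 1" using D S(1) by (simp add: t2 field_simps)
    finally have "?J v \<le> ennreal S" by (intro bound test_function_in_H1_0[OF op v])
    moreover have "ennreal (S + 1) \<le> ?J v"
    proof -
      have i: "integrable (lebesgue_on \<Omega>) (\<lambda>x. (v x)\<^sup>2)"
        using test_function_L2(1)[OF op v] by (simp add: L2_def)
      have "(\<integral>x. (v x)\<^sup>2 \<partial>lebesgue_on \<Omega>) = t\<^sup>2"
        unfolding test_function_L2(3)[OF op v] using u(2) by (simp add: v_def power_mult_distrib)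
      then have "S + 1 = (\<integral>x. 4 * pi * (v x)\<^sup>2 \<partial>lebesgue_on \<Omega>)" by (simp add: t2)
      then have "ennreal (S + 1) = (\<integral>\<^sup>+ x. ennreal (4 * pi * (v x)\<^sup>2) \<partial>lebesgue_on \<Omega>)"
        using i by (subst nn_integral_eq_integral) auto
      also have "\<dots> \<le> ?J v"
      proof (intro nn_integral_mono ennreal_leI)
        fix x show "4 * pi * (v x)\<^sup>2 \<le> exp (4 * pi * (v x)\<^sup>2) - 1"
          using exp_ge_add_one_self[of "4 * pi * (v x)\<^sup>2"] by linarith
      qed
      finally show ?thesis .
    qed
    ultimately have "ennreal (S + 1) \<le> ennreal S" by (rule order_trans[rotated])
    then show False using S(1) by (simp add: ennreal_le_iff)
  qed
  moreover have "rayleigh_values \<Omega> \<noteq> {}"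
  proof -
    obtain x r where "0 < r" "ball x r \<subseteq> \<Omega>" using op ne open_contains_ball by blast
    then show ?thesis using ball_rayleigh_quotient op unfolding rayleigh_values_def by blast
  qed
  ultimately have "4 * pi / (S + 1) \<le> lambda1 \<Omega>"
    unfolding lambda1_eq_Inf[OF op] by (intro cInf_greatest)
  moreover have "0 < 4 * pi / (S + 1)" using S(1) by simp
  ultimately show ?thesis by linarith
qed

lemma lambda1_pos_imp_inradius_finite:
  fixes \<Omega> :: "(real^2) set"
  assumes op: "open \<Omega>" and pos: "lambda1 \<Omega> > 0"
  shows "inradius \<Omega> < \<infinity>"
proof -
  obtain K where K: "0 \<le> K" and quot: "\<And>\<Omega> (x::real^2) r. open \<Omega> \<Longrightarrow> 0 < r \<Longrightarrow> ball x r \<subseteq> \<Omega> \<Longrightarrow>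
     \<exists>u\<in>test_functions \<Omega>. (\<integral>x. (u x)\<^sup>2 \<partial>lborel) = 1 \<and> (\<integral>x. (norm (grad u x))\<^sup>2 \<partial>lborel) = K / r\<^sup>2"
    using ball_rayleigh_quotient by blast
  have "r \<le> sqrt (K / lambda1 \<Omega>)" if "0 < r" "ball x r \<subseteq> \<Omega>" for x r
  proof (rule real_le_rsqrt)
    have "K / r\<^sup>2 \<in> rayleigh_values \<Omega>"
      using quot[OF op that] unfolding rayleigh_values_def by force
    then have "lambda1 \<Omega> \<le> K / r\<^sup>2"
      unfolding lambda1_eq_Inf[OF op]
      by (rule cInf_lower) (rule bdd_belowI[of _ 0], rule rayleigh_values_nonneg)
    then show "r\<^sup>2 \<le> K / lambda1 \<Omega>" using that(1) pos by (simp add: field_simps)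
  qed
  then have "inradius \<Omega> \<le> ereal (sqrt (K / lambda1 \<Omega>))"
    unfolding inradius_def by (intro Sup_least) auto
  then show ?thesis by (rule le_less_trans) simp
qed

lemma inradius_finite_imp_moser_trudinger:
  fixes \<Omega> :: "(real^2) set"
  assumes op: "open \<Omega>" and sc: "simply_connected \<Omega>" and fin: "inradius \<Omega> < \<infinity>"
  shows "(SUP u\<in>{u \<in> H1_0 \<Omega>. dirichlet \<Omega> u \<le> 1}.
             \<integral>\<^sup>+ x. ennreal (exp (4 * pi * (u x)\<^sup>2) - 1) \<partial>lebesgue_on \<Omega>) < \<infinity>"
proof -
  obtain \<rho>0 :: real where "inradius \<Omega> < ereal \<rho>0" using less_PInf_Ex_of_nat[THEN iffD1] fin
    by (metis infinity_ereal_def ereal_dense2)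
  define \<rho> where "\<rho> = max \<rho>0 1"
  have \<rho>: "0 < \<rho>" by (simp add: \<rho>_def)
  have lt: "inradius \<Omega> < ereal \<rho>"
    using \<open>inradius \<Omega> < ereal \<rho>0\<close> by (rule less_le_trans) (simp add: \<rho>_def)
  have "\<exists>z. z \<notin> \<Omega> \<and> dist x z < \<rho>" for x
  proof (rule ccontr)
    assume "\<nexists>z. z \<notin> \<Omega> \<and> dist x z < \<rho>"
    then have "ball x \<rho> \<subseteq> \<Omega>" by auto
    then have "ereal \<rho> \<le> inradius \<Omega>" unfolding inradius_def using \<rho> by (intro Sup_upper) auto
    then show False using lt by simp
  qed
  from truncated_poincare[OF sc \<rho> this] obtain C where C: "0 < C" and P: "\<And>u A. u \<in> test_functions \<Omega> \<Longrightarrow> 0 < A \<Longrightarrow>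
      (\<integral>\<^sup>+ x. ennreal ((min \<bar>u x\<bar> A)\<^sup>2) \<partial>lborel)
        \<le> ennreal C * (\<integral>\<^sup>+ x. ennreal ((norm (grad u x))\<^sup>2) * indicator {..A} \<bar>u x\<bar> \<partial>lborel)"
    by blast
  let ?S = "ennreal (exp (8 * pi * C) * (exp 1 * level_const) + 4 * pi * exp (4 * pi * C) * C)"
  have "(\<integral>\<^sup>+ x. ennreal (exp (4 * pi * (u x)\<^sup>2) - 1) \<partial>lebesgue_on \<Omega>) \<le> ?S" if "u \<in> H1_0 \<Omega>" "dirichlet \<Omega> u \<le> 1" for u
  proof (rule moser_trudinger_H1_0[OF op _ that])
    fix \<psi> assume \<psi>: "\<psi> \<in> test_functions \<Omega>" and le: "(\<integral>x. (norm (grad \<psi> x))\<^sup>2 \<partial>lborel) \<le> 1"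
    have "(\<integral>\<^sup>+ x. ennreal ((norm (grad \<psi> x))\<^sup>2) \<partial>lborel) = ennreal (\<integral>x. (norm (grad \<psi> x))\<^sup>2 \<partial>lborel)"
      by (rule nn_integral_eq_integral[OF test_function_L2(5)[OF op \<psi>]]) simp
    also have "\<dots> \<le> 1" using le by simp
    finally have "(\<integral>\<^sup>+ x. ennreal ((norm (grad \<psi> x))\<^sup>2) \<partial>lborel) \<le> 1" .
    from moser_trudinger_test_functions[OF C P \<psi> this]
    show "(\<integral>\<^sup>+ x. ennreal (exp (4 * pi * (\<psi> x)\<^sup>2) - 1) \<partial>lborel) \<le> ?S" .
  qed
  then have "(SUP u\<in>{u \<in> H1_0 \<Omega>. dirichlet \<Omega> u \<le> 1}.
             \<integral>\<^sup>+ x. ennreal (exp (4 * pi * (u x)\<^sup>2) - 1) \<partial>lebesgue_on \<Omega>) \<le> ?S"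
    by (intro SUP_least) auto
  then show ?thesis by (rule le_less_trans) simp
qed

theorem theorem1p2:
  fixes \<Omega> :: "(real ^ 2) set"
  assumes "open \<Omega>" and "connected \<Omega>" and "\<Omega> \<noteq> {}" and "simply_connected \<Omega>"
  shows "((SUP u\<in>{u \<in> H1_0 \<Omega>. dirichlet \<Omega> u \<le> 1}.
             \<integral>\<^sup>+ x. ennreal (exp (4 * pi * (u x)\<^sup>2) - 1) \<partial>lebesgue_on \<Omega>) < \<infinity>
           \<longleftrightarrow> lambda1 \<Omega> > 0) \<and>
         (lambda1 \<Omega> > 0 \<longleftrightarrow> inradius \<Omega> < \<infinity>)"
  using moser_trudinger_imp_lambda1_pos[OF assms(1,3)] lambda1_pos_imp_inradius_finite[OF assms(1)]
    inradius_finite_imp_moser_trudinger[OF assms(1,4)]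
  by blast

end
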